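(* Let $\epsilon\in\{-1,0,1\}$ and let $f:M^m:=N^{m-1}\times I\to\mathbb{Q}_\epsilon^n\times\mathbb{R}$ be given by the construction in the context, with $\alpha:I\to\mathbb{Q}_\epsilon^k\times\mathbb{R}$ a geodesic of $\mathbb{Q}_\epsilon^k\times\mathbb{R}$. Then $f$ defines, at regular points, an immersion for which the normal vector field $\eta$ defined by $\frac{\partial}{\partial t}=f_*T+\eta$ is parallel in the normal connection. Conversely, any isometric immersion $f:M^m\to\mathbb{Q}_\epsilon^n\times\mathbb{R}$, $m\ge2$, such that $T$ is nowhere vanishing and $\eta$ is parallel in the normal connection is locally given in this way.
   Context: $\mathbb{Q}_\epsilon^n$ denotes $\mathbb{S}^n$, $\mathbb{R}^n$ or $\mathbb{H}^n$ according as $\epsilon=1,0,-1$. $\partial/\partial t$ is a unit vector field tangent to the factor $\mathbb{R}$ (for $\epsilon=0$, a constant unit vector field in $\mathbb{R}^{n+1}$). For an isometric immersion $f$, $T$ (tangent to $M$) and $\eta$ (normal to $f$) are defined by $\frac{\partial}{\partial t}=f_*T+\eta$. Construction for $\epsilon\in\{-1,1\}$. Let $\mathbb{E}^{n+2}$ be $\mathbb{R}^{n+2}$ if $\epsilon=1$ and Lorentzian space $\mathbb{L}^{n+2}$ if $\epsilon=-1$; let $j:\mathbb{Q}_\epsilon^n\to\mathbb{Q}_\epsilon^n\times\mathbb{R}$ and $\iota:\mathbb{Q}_\epsilon^n\times\mathbb{R}\to\mathbb{E}^{n+2}$ be the canonical inclusions and $\kappa=\iota\circ j$. Let $g:N^{m-1}\to\mathbb{Q}_\epsilon^n$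 be an isometric immersion with an orthonormal set $\xi_1,\dots,\xi_k$ of normal vector fields parallel in the normal connection of $g$ (the set may be empty, $k=0$). Put $\tilde\xi_0=\tilde g:=\kappa\circ g$, $\tilde\xi_i=\kappa_*\xi_i$ for $1\le i\le k$, and $\tilde\xi_{k+1}=\iota_*\partial/\partial t$. Let $\alpha=(\alpha_0,\dots,\alpha_{k+1}):I\to\mathbb{Q}_\epsilon^k\times\mathbb{R}\subset\mathbb{E}^{k+2}$ be a smooth regular curve with $\epsilon\alpha_0^2+\alpha_1^2+\cdots+\alpha_k^2=\epsilon$ and $\alpha_{k+1}'$ nowhere zero. Then $(\iota\circ f)(x,s)=\sum_{i=0}^{k+1}\alpha_i(s)\tilde\xi_i(x)$ for $(x,s)\in N^{m-1}\times I$. Construction for $\epsilon=0$. Analogously, $f(x,s)=g(x)+\sum_{i=1}^k\alpha_i(s)\xi_i(x)+\alpha_{k+1}(s)\frac{\partial}{\partial t}$, for $g:N^{m-1}\to\mathbb{R}^n$ and a smooth regular curve $\alpha=(\alpha_1,\dots,\alpha_{k+1}):I\to\mathbb{R}^k\times\mathbb{R}$ with $\alpha_{k+1}'$ nowhere zero. A regular point is a point where the differential of $f$ is injective. "Locally given in this way" means every point of $M^m$ has an open neighborhood isometric to a product $N^{m-1}\times I$ with the metric induced by such a map, under which $f$ corresponds to that map (up to a translation along the $\mathbb{R}$ factor). *)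

theory Defs
  imports "HOL-Analysis.Analysis"
begin

section \<open>Smooth maps, manifolds and Riemannian metrics\<close>

primrec Ck_on :: "nat \<Rightarrow> 'a::real_normed_vector set \<Rightarrow> ('a \<Rightarrow> 'b::real_normed_vector) \<Rightarrow> bool" where
  "Ck_on 0 S f \<longleftrightarrow> continuous_on S f"
| "Ck_on (Suc n) S f \<longleftrightarrow>
     (\<forall>x\<in>S. f differentiable (at x)) \<and> (\<forall>v. Ck_on n S (\<lambda>x. frechet_derivative f (at x) v))"

text \<open>Meant for open subsets of finite-dimensional spaces.\<close>

definition smooth_on :: "'a::real_normed_vector set \<Rightarrow> ('a \<Rightarrow> 'b::real_normed_vector) \<Rightarrow> bool" where
  "smooth_on S f \<longleftrightarrow> (\<forall>n. Ck_on n S f)"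

text \<open>A chart is a pair of an open domain and a coordinate map, which is relevant on the domain only.
  The dimension of the manifold is that of the model space \<open>'e\<close>. The class
  \<open>euclidean_space\<close> would exclude dimension 0, so the model space is only required to be normed,
  and its finite dimension is part of the definition of a manifold.\<close>

record ('p, 'e) manifold =
  topo :: "'p topology"
  charts :: "('p set \<times> ('p \<Rightarrow> 'e)) set"

abbreviation cinv :: "'p set \<times> ('p \<Rightarrow> 'e) \<Rightarrow> 'e \<Rightarrow> 'p" where
  "cinv c \<equiv> inv_into (fst c) (snd c)"

abbreviation cimage :: "'p set \<times> ('p \<Rightarrow> 'e) \<Rightarrow> 'e set" where
  "cimage c \<equiv> snd c ` fst c"

definition is_manifold :: "('p, 'e::real_normed_vector) manifold \<Rightarrow> bool" where
  "is_manifold M \<longleftrightarrow>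
     (\<exists>B::'e set. finite B \<and> span B = UNIV) \<and>
     Hausdorff_space (topo M) \<and> second_countable (topo M) \<and>
     topspace (topo M) = (\<Union>c\<in>charts M. fst c) \<and>
     (\<forall>c\<in>charts M. openin (topo M) (fst c) \<and> open (cimage c) \<and>
        homeomorphic_map (subtopology (topo M) (fst c)) (top_of_set (cimage c)) (snd c)) \<and>
     (\<forall>c\<in>charts M. \<forall>d\<in>charts M. smooth_on (snd c ` (fst c \<inter> fst d)) (snd d \<circ> cinv c))"

definition restrict_manifold :: "('p, 'e) manifold \<Rightarrow> 'p set \<Rightarrow> ('p, 'e) manifold" where
  "restrict_manifold M W =
     \<lparr>topo = subtopology (topo M) W, charts = (\<lambda>c. (fst c \<inter> W, snd c)) ` charts M\<rparr>"

definition times_interval :: "('p, 'e) manifold \<Rightarrow> real set \<Rightarrow> ('p \<times> real, 'e \<times> real) manifold" where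
  "times_interval N I =
     \<lparr>topo = prod_topology (topo N) (top_of_set I),
      charts = (\<lambda>c. (fst c \<times> I, \<lambda>(x, s). (snd c x, s))) ` charts N\<rparr>"

definition smooth_map :: "('p, 'e::real_normed_vector) manifold \<Rightarrow> ('p \<Rightarrow> 'w::real_normed_vector) \<Rightarrow> bool" where
  "smooth_map M f \<longleftrightarrow> (\<forall>c\<in>charts M. smooth_on (cimage c) (f \<circ> cinv c))"

text \<open>The differential of \<open>f\<close> at \<open>p\<close>, the tangent vector \<open>u\<close> at \<open>p\<close> being given by its
  components in the chart \<open>c\<close>.\<close>

definition dmap :: "'p set \<times> ('p \<Rightarrow> 'e::real_normed_vector) \<Rightarrow> ('p \<Rightarrow> 'w::real_normed_vector) \<Rightarrow> 'p \<Rightarrow> 'e \<Rightarrow> 'w" where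
  "dmap c f p u = frechet_derivative (f \<circ> cinv c) (at (snd c p)) u"

definition smooth_between ::
    "('p, 'e::real_normed_vector) manifold \<Rightarrow> ('q, 'f::real_normed_vector) manifold \<Rightarrow> ('p \<Rightarrow> 'q) \<Rightarrow> bool" where
  "smooth_between M M' \<Phi> \<longleftrightarrow> continuous_map (topo M) (topo M') \<Phi> \<and>
     (\<forall>c\<in>charts M. \<forall>d\<in>charts M'.
        smooth_on (snd c ` {p \<in> fst c. \<Phi> p \<in> fst d}) (snd d \<circ> \<Phi> \<circ> cinv c))"

definition diffeomorphism ::
    "('p, 'e::real_normed_vector) manifold \<Rightarrow> ('q, 'f::real_normed_vector) manifold \<Rightarrow> ('p \<Rightarrow> 'q) \<Rightarrow> bool" where
  "diffeomorphism M M' \<Phi> \<longleftrightarrow> homeomorphic_map (topo M) (topo M') \<Phi> \<and>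
     smooth_between M M' \<Phi> \<and> smooth_between M' M (inv_into (topspace (topo M)) \<Phi>)"

text \<open>Tangent vector fields and metrics are families of component functions, indexed by the
  coordinate maps and subject to the transformation laws.\<close>

type_synonym ('p, 'e) vfield = "('p \<Rightarrow> 'e) \<Rightarrow> 'p \<Rightarrow> 'e"
type_synonym ('p, 'e) metric = "('p \<Rightarrow> 'e) \<Rightarrow> 'p \<Rightarrow> 'e \<Rightarrow> 'e \<Rightarrow> real"

definition tangent_field :: "('p, 'e::real_normed_vector) manifold \<Rightarrow> ('p, 'e) vfield \<Rightarrow> bool" where
  "tangent_field M T \<longleftrightarrow>
     (\<forall>c\<in>charts M. smooth_on (cimage c) (T (snd c) \<circ> cinv c)) \<and>
     (\<forall>c\<in>charts M. \<forall>d\<in>charts M. \<forall>p\<in>fst c \<inter> fst d. T (snd d) p = dmap c (snd d) p (T (snd c) p))"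

definition riemannian_metric :: "('p, 'e::real_normed_vector) manifold \<Rightarrow> ('p, 'e) metric \<Rightarrow> bool" where
  "riemannian_metric M h \<longleftrightarrow>
     (\<forall>c\<in>charts M. \<forall>p\<in>fst c. bilinear (h (snd c) p) \<and>
        (\<forall>u v. h (snd c) p u v = h (snd c) p v u) \<and> (\<forall>u. u \<noteq> 0 \<longrightarrow> h (snd c) p u u > 0)) \<and>
     (\<forall>c\<in>charts M. \<forall>u v. smooth_on (cimage c) (\<lambda>y. h (snd c) (cinv c y) u v)) \<and>
     (\<forall>c\<in>charts M. \<forall>d\<in>charts M. \<forall>p\<in>fst c \<inter> fst d. \<forall>u v.
        h (snd c) p u v = h (snd d) p (dmap c (snd d) p u) (dmap c (snd d) p v))"

definition isometry ::
    "('p, 'e::real_normed_vector) manifold \<Rightarrow> ('p, 'e) metric \<Rightarrow>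
     ('q, 'f::real_normed_vector) manifold \<Rightarrow> ('q, 'f) metric \<Rightarrow> ('p \<Rightarrow> 'q) \<Rightarrow> bool" where
  "isometry M h M' h' \<Phi> \<longleftrightarrow> diffeomorphism M M' \<Phi> \<and>
     (\<forall>c\<in>charts M. \<forall>d\<in>charts M'. \<forall>p\<in>fst c. \<Phi> p \<in> fst d \<longrightarrow>
        (\<forall>u v. h' (snd d) (\<Phi> p) (dmap c (snd d \<circ> \<Phi>) p u) (dmap c (snd d \<circ> \<Phi>) p v) = h (snd c) p u v))"

section \<open>Ambient spaces\<close>

text \<open>Ambient spaces are submanifolds of a vector space with a symmetric bilinear form that is
  positive definite on their tangent spaces.\<close>

record 'w ambient =
  points :: "'w set"
  tspace :: "'w \<Rightarrow> 'w set"
  form :: "'w \<Rightarrow> 'w \<Rightarrow> real"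

text \<open>With \<open>'v\<close> standing for \<open>\<real>\<^sup>n\<close>, the space \<open>\<real> \<times> 'v\<close> with the following form is Euclidean for
  \<open>\<epsilon> = 1\<close> and Lorentzian for \<open>\<epsilon> = -1\<close>. For \<open>\<epsilon> = 0\<close> the flat space form is the hyperplane
  \<open>{0} \<times> 'v\<close>, on which the form is the Euclidean inner product. For \<open>\<epsilon> = -1\<close> one sheet of the
  hyperboloid is taken.\<close>

definition space_form :: "real \<Rightarrow> (real \<times> 'v::euclidean_space) ambient" where
  "space_form \<epsilon> =
     (let B = (\<lambda>x y. \<epsilon> * fst x * fst y + snd x \<bullet> snd y) in
      \<lparr>points = (if \<epsilon> = 0 then {x. fst x = 0} else {x. B x x = \<epsilon> \<and> (\<epsilon> = -1 \<longrightarrow> fst x > 0)}),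
       tspace = (\<lambda>p. if \<epsilon> = 0 then {v. fst v = 0} else {v. B p v = 0}),
       form = B\<rparr>)"

definition cylinder :: "real \<Rightarrow> ((real \<times> 'v::euclidean_space) \<times> real) ambient" where
  "cylinder \<epsilon> =
     \<lparr>points = points (space_form \<epsilon>) \<times> UNIV,
      tspace = (\<lambda>p. tspace (space_form \<epsilon>) (fst p) \<times> UNIV),
      form = (\<lambda>x y. form (space_form \<epsilon>) (fst x) (fst y) + snd x * snd y)\<rparr>"

definition dt :: "(real \<times> 'v::euclidean_space) \<times> real" where
  "dt = (0, 1)"

text \<open>The product of the \<open>k\<close>-dimensional space form with \<open>\<real>\<close>, where \<open>k \<ge> 0\<close> is a number, in
  coordinates \<open>a\<^sub>0, \<dots>, a\<^bsub>k+1\<^esub>\<close>. As above, \<open>a\<^sub>0 = 0\<close> if \<open>\<epsilon> = 0\<close>.\<close>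

definition coord_cylinder :: "real \<Rightarrow> nat \<Rightarrow> (nat \<Rightarrow> real) ambient" where
  "coord_cylinder \<epsilon> k =
     (let B = (\<lambda>a b. \<epsilon> * a 0 * b 0 + (\<Sum>i=1..k. a i * b i)) in
      \<lparr>points = {a. (\<forall>i>k+1. a i = 0) \<and>
                    (if \<epsilon> = 0 then a 0 = 0 else B a a = \<epsilon> \<and> (\<epsilon> = -1 \<longrightarrow> a 0 > 0))},
       tspace = (\<lambda>a. {b. (\<forall>i>k+1. b i = 0) \<and> (if \<epsilon> = 0 then b 0 = 0 else B a b = 0)}),
       form = (\<lambda>a b. B a b + a (k+1) * b (k+1))\<rparr>)"

definition orth_proj :: "('w \<Rightarrow> 'w \<Rightarrow> real) \<Rightarrow> 'w set \<Rightarrow> 'w \<Rightarrow> 'w::minus" where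
  "orth_proj B V v = (THE w. w \<in> V \<and> (\<forall>u\<in>V. B (v - w) u = 0))"

text \<open>On an open interval. The covariant derivative of the velocity is the tangential component
  of the second derivative; thus geodesics are parametrized proportionally to arc length.\<close>

definition geodesic_on :: "(nat \<Rightarrow> real) ambient \<Rightarrow> real set \<Rightarrow> (real \<Rightarrow> nat \<Rightarrow> real) \<Rightarrow> bool" where
  "geodesic_on A I \<alpha> \<longleftrightarrow>
     (\<forall>i. smooth_on I (\<lambda>s. \<alpha> s i)) \<and> (\<forall>s\<in>I. \<alpha> s \<in> points A) \<and>
     (\<forall>s\<in>I. orth_proj (form A) (tspace A (\<alpha> s)) (\<lambda>i. deriv (deriv (\<lambda>r. \<alpha> r i)) s) = (\<lambda>_. 0))"

section \<open>Immersions and their normal connections\<close>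

definition regular_points :: "('p, 'e::real_normed_vector) manifold \<Rightarrow> ('p \<Rightarrow> 'w::real_normed_vector) \<Rightarrow> 'p set" where
  "regular_points M f = {p \<in> topspace (topo M). \<forall>c\<in>charts M. p \<in> fst c \<longrightarrow> inj (dmap c f p)}"

definition immersion :: "'w ambient \<Rightarrow> ('p, 'e::real_normed_vector) manifold \<Rightarrow> ('p \<Rightarrow> 'w::real_normed_vector) \<Rightarrow> bool" where
  "immersion A M f \<longleftrightarrow> smooth_map M f \<and> f ` topspace (topo M) \<subseteq> points A \<and>
     regular_points M f = topspace (topo M)"

definition isometric_immersion ::
    "'w ambient \<Rightarrow> ('p, 'e::real_normed_vector) manifold \<Rightarrow> ('p, 'e) metric \<Rightarrow> ('p \<Rightarrow> 'w::real_normed_vector) \<Rightarrow> bool" where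
  "isometric_immersion A M h f \<longleftrightarrow> immersion A M f \<and>
     (\<forall>c\<in>charts M. \<forall>p\<in>fst c. \<forall>u v. form A (dmap c f p u) (dmap c f p v) = h (snd c) p u v)"

definition normal_space ::
    "'w ambient \<Rightarrow> ('p, 'e::real_normed_vector) manifold \<Rightarrow> ('p \<Rightarrow> 'w::real_normed_vector) \<Rightarrow> 'p \<Rightarrow> 'w set" where
  "normal_space A M f p =
     {w \<in> tspace A (f p). \<forall>c\<in>charts M. p \<in> fst c \<longrightarrow> (\<forall>u. form A w (dmap c f p u) = 0)}"

definition normal_field ::
    "'w ambient \<Rightarrow> ('p, 'e::real_normed_vector) manifold \<Rightarrow> ('p \<Rightarrow> 'w::real_normed_vector) \<Rightarrow> ('p \<Rightarrow> 'w) \<Rightarrow> bool" where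
  "normal_field A M f \<xi> \<longleftrightarrow> smooth_map M \<xi> \<and> (\<forall>p\<in>topspace (topo M). \<xi> p \<in> normal_space A M f p)"

text \<open>The derivative of a vector field \<open>\<xi>\<close> along \<open>f\<close> with respect to the Levi-Civita connection of
  the ambient space, and its normal part.\<close>

definition ambient_connection ::
    "'w ambient \<Rightarrow> 'p set \<times> ('p \<Rightarrow> 'e::real_normed_vector) \<Rightarrow> ('p \<Rightarrow> 'w::real_normed_vector) \<Rightarrow> ('p \<Rightarrow> 'w) \<Rightarrow> 'p \<Rightarrow> 'e \<Rightarrow> 'w" where
  "ambient_connection A c f \<xi> p u = orth_proj (form A) (tspace A (f p)) (dmap c \<xi> p u)"

definition normal_connection ::
    "'w ambient \<Rightarrow> ('p, 'e::real_normed_vector) manifold \<Rightarrow> 'p set \<times> ('p \<Rightarrow> 'e) \<Rightarrow>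
     ('p \<Rightarrow> 'w::real_normed_vector) \<Rightarrow> ('p \<Rightarrow> 'w) \<Rightarrow> 'p \<Rightarrow> 'e \<Rightarrow> 'w" where
  "normal_connection A M c f \<xi> p u =
     orth_proj (form A) (normal_space A M f p) (ambient_connection A c f \<xi> p u)"

definition parallel_normal_field ::
    "'w ambient \<Rightarrow> ('p, 'e::real_normed_vector) manifold \<Rightarrow> ('p \<Rightarrow> 'w::real_normed_vector) \<Rightarrow> ('p \<Rightarrow> 'w) \<Rightarrow> bool" where
  "parallel_normal_field A M f \<xi> \<longleftrightarrow> normal_field A M f \<xi> \<and>
     (\<forall>c\<in>charts M. \<forall>p\<in>fst c. \<forall>u. normal_connection A M c f \<xi> p u = 0)"

text \<open>The decomposition \<open>\<partial>/\<partial>t = f\<^sub>* T + \<eta>\<close>.\<close>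

definition dt_decomposition ::
    "real \<Rightarrow> ('p, 'e::real_normed_vector) manifold \<Rightarrow> ('p \<Rightarrow> (real \<times> 'v::euclidean_space) \<times> real) \<Rightarrow>
     ('p, 'e) vfield \<Rightarrow> ('p \<Rightarrow> (real \<times> 'v) \<times> real) \<Rightarrow> bool" where
  "dt_decomposition \<epsilon> M f T \<eta> \<longleftrightarrow> tangent_field M T \<and> normal_field (cylinder \<epsilon>) M f \<eta> \<and>
     (\<forall>c\<in>charts M. \<forall>p\<in>fst c. dt = dmap c f p (T (snd c) p) + \<eta> p)"

section \<open>The construction\<close>

definition construction_data ::
    "real \<Rightarrow> ('p, 'e::real_normed_vector) manifold \<Rightarrow> ('p, 'e) metric \<Rightarrow> real set \<Rightarrow> nat \<Rightarrow>
     ('p \<Rightarrow> real \<times> 'v::euclidean_space) \<Rightarrow> (nat \<Rightarrow> 'p \<Rightarrow> real \<times> 'v) \<Rightarrow> (real \<Rightarrow> nat \<Rightarrow> real) \<Rightarrow> bool" where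
  "construction_data \<epsilon> N h I k g \<xi> \<alpha> \<longleftrightarrow>
     is_manifold N \<and> riemannian_metric N h \<and> isometric_immersion (space_form \<epsilon>) N h g \<and>
     (\<forall>i\<in>{1..k}. parallel_normal_field (space_form \<epsilon>) N g (\<xi> i)) \<and>
     (\<forall>x\<in>topspace (topo N). \<forall>i\<in>{1..k}. \<forall>j\<in>{1..k}.
        form (space_form \<epsilon>) (\<xi> i x) (\<xi> j x) = (if i = j then 1 else 0)) \<and>
     open I \<and> is_interval I \<and> I \<noteq> {} \<and>
     (\<forall>i. smooth_on I (\<lambda>s. \<alpha> s i)) \<and> (\<forall>s\<in>I. \<alpha> s \<in> points (coord_cylinder \<epsilon> k)) \<and>
     (\<forall>s\<in>I. \<exists>i\<le>k+1. deriv (\<lambda>r. \<alpha> r i) s \<noteq> 0) \<and>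
     (\<forall>s\<in>I. deriv (\<lambda>r. \<alpha> r (k+1)) s \<noteq> 0)"

definition frame_field ::
    "nat \<Rightarrow> ('p \<Rightarrow> real \<times> 'v::euclidean_space) \<Rightarrow> (nat \<Rightarrow> 'p \<Rightarrow> real \<times> 'v) \<Rightarrow> nat \<Rightarrow> 'p \<Rightarrow> (real \<times> 'v) \<times> real" where
  "frame_field k g \<xi> i x = (if i = 0 then (g x, 0) else if i \<le> k then (\<xi> i x, 0) else dt)"

text \<open>For \<open>\<epsilon> = 0\<close> the coefficient of \<open>g\<close> is 1, the curve being given by the components from
  1 to \<open>k + 1\<close>.\<close>

definition construction ::
    "real \<Rightarrow> nat \<Rightarrow> ('p \<Rightarrow> real \<times> 'v::euclidean_space) \<Rightarrow> (nat \<Rightarrow> 'p \<Rightarrow> real \<times> 'v) \<Rightarrow> (real \<Rightarrow> nat \<Rightarrow> real) \<Rightarrow>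
     'p \<times> real \<Rightarrow> (real \<times> 'v) \<times> real" where
  "construction \<epsilon> k g \<xi> \<alpha> = (\<lambda>(x, s).
     \<Sum>i=0..k+1. (if \<epsilon> = 0 \<and> i = 0 then 1 else \<alpha> s i) *\<^sub>R frame_field k g \<xi> i x)"

text \<open>As the statement is local, the points of the manifold \<open>N\<close> can be taken from its model space.\<close>

definition locally_given ::
    "real \<Rightarrow> ('p, 'e::real_normed_vector \<times> real) manifold \<Rightarrow> ('p, 'e \<times> real) metric \<Rightarrow>
     ('p \<Rightarrow> (real \<times> 'v::euclidean_space) \<times> real) \<Rightarrow> bool" where
  "locally_given \<epsilon> M h f \<longleftrightarrow>
     (\<forall>p\<in>topspace (topo M).
        \<exists>W (N :: ('e, 'e) manifold) hN I k g \<xi> \<alpha> hP \<Phi> \<tau>.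
          openin (topo M) W \<and> p \<in> W \<and>
          construction_data \<epsilon> N hN I k g \<xi> \<alpha> \<and> geodesic_on (coord_cylinder \<epsilon> k) I \<alpha> \<and>
          riemannian_metric (times_interval N I) hP \<and>
          isometric_immersion (cylinder \<epsilon>) (times_interval N I) hP (construction \<epsilon> k g \<xi> \<alpha>) \<and>
          isometry (times_interval N I) hP (restrict_manifold M W) h \<Phi> \<and>
          (\<forall>q\<in>topspace (topo (times_interval N I)).
             f (\<Phi> q) = construction \<epsilon> k g \<xi> \<alpha> q + \<tau> *\<^sub>R dt))"

end

theory Submission
  imports Defs
begin

text \<open>In the construction, the derivatives of the map along \<open>N\<close> are tangent to \<open>g\<close>, since the \<open>\<xi>\<^sub>i\<close> are
  parallel, and hence orthogonal to its derivative along the curve. So \<open>T = \<kappa> \<partial>/\<partial>s\<close> and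
  \<open>\<eta> = \<partial>/\<partial>t - \<kappa> f\<^sub>* \<partial>/\<partial>s\<close>, where \<open>\<kappa>\<close> is constant as the curve is a geodesic. At regular points the
  derivatives along \<open>N\<close> exhaust the tangent spaces of \<open>g\<close>, so that the derivatives of \<open>\<eta>\<close> are tangent to \<open>f\<close>.

  Conversely, if \<open>\<eta>\<close> is parallel then it is of constant length and \<open>A\<^sub>\<eta> T = 0\<close>, so that the integral curves
  of \<open>T\<close> are mapped to geodesics of the cylinder with initial velocity \<open>\<partial>/\<partial>t - \<eta>\<close>. These geodesics are explicit:
  flowing back along them to a fixed height is a map that is constant along \<open>T\<close>. Together with the
  height it gives, by the inverse function theorem, coordinates in which \<open>T\<close> is a coordinate field. The
  submanifold \<open>g\<close> is the slice of fixed height, and \<open>k = 0\<close> or \<open>k = 1\<close> according as \<open>\<eta>\<close> vanishes or not.\<close>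

section \<open>Smooth maps\<close>

text \<open>In the converse everything rests on one number. Pairing \<partial>/\<partial>t = f_*T +
  \<eta> with \<eta> shows that the height component of \<eta> is its squared length c, and T
  \<noteq> 0 gives c < 1. So f_*T climbs at the constant rate 1 - c > 0: the slices of fixed height
  are transverse to T, and the height divided by this rate is the flow time. Flowing back lands in
  the ambient space rather than in M, so it gives coordinates only after composition with a linear
  left inverse of its differential along the slice. The form of the analytic part has two causes.
  Smoothness is defined by iterated derivatives in constant directions, so that the chain rule and
  inversion, where the direction varies with the point, need an expansion in a basis. And N is
  modelled on a finite-dimensional normed space that may have dimension 0, so statements about it
  use finite spanning sets instead of \<open>Basis\<close>.\<close>

abbreviation fd :: "('a::real_normed_vector \<Rightarrow> 'b::real_normed_vector) \<Rightarrow> 'a \<Rightarrow> 'a \<Rightarrow> 'b" where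
  "fd f x \<equiv> frechet_derivative f (at x)"

lemma frechet_derivative_eqI:
  "(f has_derivative f') (at x) \<Longrightarrow> fd f x = f'"
  by (metis frechet_derivative_at)

text \<open>Induction on the order. Openness of S lets equality pass to the derivatives, which are
  taken in the whole space.\<close>

lemma Ck_on_cong:
  assumes "open S" "\<And>x. x \<in> S \<Longrightarrow> f x = g x" "Ck_on n S f"
  shows "Ck_on n S g"
  using assms(2,3)
proof (induction n arbitrary: f g)
  case 0
  then show ?case by (simp cong: continuous_on_cong)
next
  case (Suc n)
  have D: "(g has_derivative fd f x) (at x)" if "x \<in> S" for x
    using Suc.prems that assms(1)
    by (auto intro: has_derivative_transform_within_open[where f = f and s = S]
        simp: frechet_derivative_works)
  then have "fd f x v = fd g x v" if "x \<in> S" for x v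
    using that frechet_derivative_eqI by metis
  then have "Ck_on n S (\<lambda>x. fd g x v)" for v
    by (rule Suc.IH) (use Suc.prems in auto)
  then show ?case
    using D by (auto simp: differentiable_def)
qed

text \<open>The working form of the recursion: any expression f' for the derivative may be supplied,
  so the output of the derivative rules can be used directly.\<close>

lemma Ck_on_SucI:
  assumes "open S" "\<And>x. x \<in> S \<Longrightarrow> (f has_derivative f' x) (at x)"
    "\<And>v. Ck_on n S (\<lambda>x. f' x v)"
  shows "Ck_on (Suc n) S f"
proof -
  have "Ck_on n S (\<lambda>x. fd f x v)" for v
    by (rule Ck_on_cong[OF assms(1) _ assms(3)[of v]]) (simp add: frechet_derivative_eqI[OF assms(2)])
  then show ?thesis using assms(2) by (auto simp: differentiable_def)
qed

lemma Ck_on_SucD: "Ck_on (Suc n) S f \<Longrightarrow> Ck_on n S f"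
proof (induction n arbitrary: f)
  case 0
  then show ?case
    by (simp add: continuous_at_imp_continuous_on differentiable_imp_continuous_within)
qed auto

lemma Ck_on_has_derivative:
  "Ck_on (Suc n) S f \<Longrightarrow> x \<in> S \<Longrightarrow> (f has_derivative fd f x) (at x)"
  by (simp add: frechet_derivative_works)

lemma Ck_on_subset: "Ck_on n S f \<Longrightarrow> T \<subseteq> S \<Longrightarrow> Ck_on n T f"
  by (induction n arbitrary: f) (auto intro: continuous_on_subset)

lemma Ck_on_const: "Ck_on n S (\<lambda>_. c)"
  by (induction n arbitrary: c) auto

lemma Ck_on_bounded_linear:
  assumes "open S" "bounded_linear L" "Ck_on n S f"
  shows "Ck_on n S (\<lambda>x. L (f x))"
  using assms(3)
proof (induction n arbitrary: f)
  case 0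
  then show ?case using assms(2) by (simp add: bounded_linear.continuous_on)
next
  case (Suc n)
  show ?case
    by (rule Ck_on_SucI[OF assms(1) bounded_linear.has_derivative[OF assms(2) Ck_on_has_derivative[OF Suc.prems]]])
       (use Suc in auto)
qed

lemma Ck_on_add:
  assumes "open S" "Ck_on n S f" "Ck_on n S g"
  shows "Ck_on n S (\<lambda>x. f x + g x)"
  using assms(2,3)
proof (induction n arbitrary: f g)
  case 0
  then show ?case by (simp add: continuous_on_add)
next
  case (Suc n)
  show ?case
    by (rule Ck_on_SucI[OF assms(1) has_derivative_add[OF Ck_on_has_derivative[OF Suc.prems(1)]
          Ck_on_has_derivative[OF Suc.prems(2)]]])
       (use Suc in auto)
qed

lemma Ck_on_bilinear:
  assumes "open S" "bounded_bilinear B" "Ck_on n S f" "Ck_on n S g"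
  shows "Ck_on n S (\<lambda>x. B (f x) (g x))"
  using assms(3,4)
proof (induction n arbitrary: f g)
  case 0
  then show ?case using assms(2) by (simp add: bounded_bilinear.continuous_on)
next
  case (Suc n)
  \<comment> \<open>Leibniz rule: in each summand one factor has been differentiated and the other
    is downgraded by one order, so the induction hypothesis applies to both.\<close>
  have *: "Ck_on n S (\<lambda>x. B (f x) (fd g x v) + B (fd f x v) (g x))" for v
    using Suc.prems Ck_on_SucD[OF Suc.prems(1)] Ck_on_SucD[OF Suc.prems(2)]
    by (intro Ck_on_add assms(1) Suc.IH) auto
  show ?case
    by (rule Ck_on_SucI[OF assms(1) bounded_bilinear.FDERIV[OF assms(2) Ck_on_has_derivative[OF Suc.prems(1)]
          Ck_on_has_derivative[OF Suc.prems(2)]] *])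
qed

lemma Ck_on_sum:
  assumes "open S" "\<And>i. i \<in> A \<Longrightarrow> Ck_on n S (f i)"
  shows "Ck_on n S (\<lambda>x. \<Sum>i\<in>A. f i x)"
  using assms(2) by (induction A rule: infinite_finite_induct) (auto intro: Ck_on_const Ck_on_add assms(1))

lemma Ck_on_Pair:
  assumes "open S" "Ck_on n S f" "Ck_on n S g"
  shows "Ck_on n S (\<lambda>x. (f x, g x))"
  using assms(2,3)
proof (induction n arbitrary: f g)
  case 0
  then show ?case by (simp add: continuous_on_Pair)
next
  case (Suc n)
  show ?case
    by (rule Ck_on_SucI[OF assms(1) has_derivative_Pair[OF Ck_on_has_derivative[OF Suc.prems(1)]
          Ck_on_has_derivative[OF Suc.prems(2)]]])
       (use Suc in auto)
qed

text \<open>No restriction on the dimensions, as the directions of differentiation of the outer function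
  are constant.\<close>

lemma Ck_on_compose_affine:
  assumes "open U" "open S" "bounded_linear L" "\<And>x. x \<in> U \<Longrightarrow> a + L x \<in> S" "Ck_on n S f"
  shows "Ck_on n U (\<lambda>x. f (a + L x))"
  using assms(5)
proof (induction n arbitrary: f)
  case 0
  have "continuous_on U (\<lambda>x. a + L x)"
    by (intro continuous_intros bounded_linear.continuous_on[OF assms(3)])
  then show ?case using 0 assms(4) by (auto intro: continuous_on_compose2)
next
  case (Suc n)
  have "((\<lambda>x. f (a + L x)) has_derivative (\<lambda>v. fd f (a + L x) (L v))) (at x)"
    if "x \<in> U" for x
  proof -
    have "((\<lambda>x. a + L x) has_derivative L) (at x)"
      using has_derivative_add[OF has_derivative_const[of a] bounded_linear_imp_has_derivative[OF assms(3)]]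
      by simp
    then show ?thesis
      by (rule has_derivative_compose) (rule Ck_on_has_derivative[OF Suc.prems assms(4)[OF that]])
  qed
  then show ?case
    by (rule Ck_on_SucI[OF assms(1)]) (use Suc in auto)
qed

lemma linear_eq_sum_Basis:
  fixes L :: "'a::euclidean_space \<Rightarrow> 'b::real_vector"
  assumes "linear L"
  shows "L v = (\<Sum>b\<in>Basis. (v \<bullet> b) *\<^sub>R L b)"
proof -
  have "L (\<Sum>b\<in>Basis. (v \<bullet> b) *\<^sub>R b) = (\<Sum>b\<in>Basis. (v \<bullet> b) *\<^sub>R L b)"
    by (simp add: linear_sum[OF assms] linear_scale[OF assms])
  then show ?thesis by (simp add: euclidean_representation)
qed

text \<open>\<open>Ck_on\<close> controls derivatives in constant directions only. Expanding the
  argument w x in \<open>Basis\<close> reduces a varying direction to finitely many constant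
  ones.\<close>

lemma Ck_on_linear_family:
  fixes A :: "'a::real_normed_vector \<Rightarrow> 'b::euclidean_space \<Rightarrow> 'c::real_normed_vector"
  assumes "open S" "\<And>x. x \<in> S \<Longrightarrow> linear (A x)" "\<And>b. b \<in> Basis \<Longrightarrow> Ck_on n S (\<lambda>x. A x b)" "Ck_on n S w"
  shows "Ck_on n S (\<lambda>x. A x (w x))"
proof -
  have "Ck_on n S (\<lambda>x. \<Sum>b\<in>Basis. (w x \<bullet> b) *\<^sub>R A x b)"
    by (intro Ck_on_sum Ck_on_bilinear[OF _ bounded_bilinear_scaleR] Ck_on_bilinear[OF _ bounded_bilinear_inner]
        Ck_on_const assms)
  then show ?thesis
    by (rule Ck_on_cong[OF assms(1), rotated]) (rule linear_eq_sum_Basis[OF assms(2), symmetric])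
qed

text \<open>In the chain rule the direction \<open>fd g x v\<close> depends on x, so the induction
  passes through \<open>Ck_on_linear_family\<close>; this is why the middle space is
  Euclidean.\<close>

lemma Ck_on_compose:
  fixes g :: "'a::real_normed_vector \<Rightarrow> 'b::euclidean_space"
  assumes "open U" "open S" "\<And>x. x \<in> U \<Longrightarrow> g x \<in> S" "Ck_on n S f" "Ck_on n U g"
  shows "Ck_on n U (\<lambda>x. f (g x))"
  using assms(4,5)
proof (induction n arbitrary: f)
  case 0
  then show ?case using assms(3) by (auto intro: continuous_on_compose2)
next
  case (Suc n)
  have 1: "((\<lambda>x. f (g x)) has_derivative (\<lambda>v. fd f (g x) (fd g x v))) (at x)"
    if "x \<in> U" for x
    by (rule has_derivative_compose[OF Ck_on_has_derivative[OF Suc.prems(2) that]])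
       (rule Ck_on_has_derivative[OF Suc.prems(1) assms(3)[OF that]])
  have "Ck_on n U (\<lambda>x. fd f (g x) (fd g x v))" for v
  proof (rule Ck_on_linear_family[OF assms(1)])
    show "linear (fd f (g x))" if "x \<in> U" for x
      using Ck_on_has_derivative[OF Suc.prems(1)] assms(3)[OF that] has_derivative_linear by blast
  qed (use Suc in \<open>auto intro!: Suc.IH intro: Ck_on_SucD\<close>)
  then show ?case using Ck_on_SucI[OF assms(1) 1] by blast
qed

section \<open>Closure properties of smooth functions\<close>

lemma smooth_on_cong: "open S \<Longrightarrow> (\<And>x. x \<in> S \<Longrightarrow> f x = g x) \<Longrightarrow> smooth_on S f \<Longrightarrow> smooth_on S g"
  unfolding smooth_on_def using Ck_on_cong by blast

lemma smooth_on_subset: "smooth_on S f \<Longrightarrow> T \<subseteq> S \<Longrightarrow> smooth_on T f"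
  unfolding smooth_on_def using Ck_on_subset by blast

lemma smooth_on_const: "smooth_on S (\<lambda>_. c)"
  unfolding smooth_on_def using Ck_on_const by blast

lemma smooth_on_bounded_linear: "open S \<Longrightarrow> bounded_linear L \<Longrightarrow> smooth_on S f \<Longrightarrow> smooth_on S (\<lambda>x. L (f x))"
  by (simp add: smooth_on_def Ck_on_bounded_linear)

lemma smooth_on_add: "open S \<Longrightarrow> smooth_on S f \<Longrightarrow> smooth_on S g \<Longrightarrow> smooth_on S (\<lambda>x. f x + g x)"
  by (simp add: smooth_on_def Ck_on_add)

lemma smooth_on_bilinear:
  "open S \<Longrightarrow> bounded_bilinear B \<Longrightarrow> smooth_on S f \<Longrightarrow> smooth_on S g \<Longrightarrow> smooth_on S (\<lambda>x. B (f x) (g x))"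
  by (simp add: smooth_on_def Ck_on_bilinear)

lemmas smooth_on_scaleR = smooth_on_bilinear[OF _ bounded_bilinear_scaleR]
lemmas smooth_on_mult = smooth_on_bilinear[OF _ bounded_bilinear_mult]
lemmas smooth_on_fst = smooth_on_bounded_linear[OF _ bounded_linear_fst]
lemmas smooth_on_snd = smooth_on_bounded_linear[OF _ bounded_linear_snd]
lemmas smooth_on_minus = smooth_on_bounded_linear[OF _ bounded_linear_minus[OF bounded_linear_ident]]

lemma smooth_on_diff: "open S \<Longrightarrow> smooth_on S f \<Longrightarrow> smooth_on S g \<Longrightarrow> smooth_on S (\<lambda>x. f x - g x)"
  using smooth_on_add[of S f "\<lambda>x. - g x"] smooth_on_minus[of S g] by simp

lemma smooth_on_sum: "open S \<Longrightarrow> (\<And>i. i \<in> A \<Longrightarrow> smooth_on S (f i)) \<Longrightarrow> smooth_on S (\<lambda>x. \<Sum>i\<in>A. f i x)"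
  by (simp add: smooth_on_def Ck_on_sum)

lemma smooth_on_Pair: "open S \<Longrightarrow> smooth_on S f \<Longrightarrow> smooth_on S g \<Longrightarrow> smooth_on S (\<lambda>x. (f x, g x))"
  by (simp add: smooth_on_def Ck_on_Pair)

lemma smooth_on_compose_affine:
  "open U \<Longrightarrow> open S \<Longrightarrow> bounded_linear L \<Longrightarrow> (\<And>x. x \<in> U \<Longrightarrow> a + L x \<in> S) \<Longrightarrow> smooth_on S f \<Longrightarrow>
    smooth_on U (\<lambda>x. f (a + L x))"
  unfolding smooth_on_def by (intro allI; rule Ck_on_compose_affine[where S = S]; simp)

lemma smooth_on_compose:
  fixes g :: "'a::real_normed_vector \<Rightarrow> 'b::euclidean_space"
  shows "open U \<Longrightarrow> open S \<Longrightarrow> (\<And>x. x \<in> U \<Longrightarrow> g x \<in> S) \<Longrightarrow> smooth_on S f \<Longrightarrow> smooth_on U g \<Longrightarrow>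
    smooth_on U (\<lambda>x. f (g x))"
  unfolding smooth_on_def by (intro allI; rule Ck_on_compose[where S = S]; simp)

lemma smooth_on_has_derivative:
  "smooth_on S f \<Longrightarrow> x \<in> S \<Longrightarrow> (f has_derivative fd f x) (at x)"
  unfolding smooth_on_def using Ck_on_has_derivative by blast

lemma smooth_on_imp_continuous_on: "smooth_on S f \<Longrightarrow> continuous_on S f"
  unfolding smooth_on_def using Ck_on.simps(1)[of S f] by blast

lemma smooth_on_derivative:
  assumes "smooth_on S f"
  shows "smooth_on S (\<lambda>x. fd f x v)"
  unfolding smooth_on_def
proof
  fix n
  have "Ck_on (Suc n) S f" using assms unfolding smooth_on_def by (rule spec)
  then show "Ck_on n S (\<lambda>x. fd f x v)" by simp
qed

lemma smooth_on_ident: "open S \<Longrightarrow> smooth_on S (\<lambda>x. x)"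
  unfolding smooth_on_def
proof
  fix n :: nat assume "open S"
  then show "Ck_on n S (\<lambda>x. x)"
    by (cases n) (auto intro: Ck_on_const)
qed

lemma smooth_on_linear: "open S \<Longrightarrow> bounded_linear L \<Longrightarrow> smooth_on S L"
  by (rule smooth_on_bounded_linear[OF _ _ smooth_on_ident])

lemma smooth_on_real_deriv:
  assumes "open S" "smooth_on S (f :: real \<Rightarrow> real)" "x \<in> S"
  shows "(f has_real_derivative deriv f x) (at x)"
  using smooth_on_has_derivative[OF assms(2,3)] DERIV_deriv_iff_real_differentiable
  unfolding differentiable_def by blast

lemma smooth_on_deriv:
  assumes "open S" "smooth_on S (f :: real \<Rightarrow> real)"
  shows "smooth_on S (deriv f)"
proof (rule smooth_on_cong[OF assms(1) _ smooth_on_derivative[OF assms(2), of 1]])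
  show "fd f x 1 = deriv f x" if "x \<in> S" for x
    using frechet_derivative_eqI[OF smooth_on_real_deriv[OF assms that, unfolded has_field_derivative_def]]
    by simp
qed

section \<open>Second derivatives and inverse functions\<close>

text \<open>Two applications of the mean value theorem: to the difference of f along two parallel
  segments in direction u, then to the u-derivative of f in direction v.\<close>

lemma second_difference_mean_value:
  fixes f :: "'a::real_normed_vector \<Rightarrow> real"
  assumes "Ck_on 2 S f" "s > 0"
    and S: "\<And>a b. 0 \<le> a \<Longrightarrow> a \<le> s \<Longrightarrow> 0 \<le> b \<Longrightarrow> b \<le> s \<Longrightarrow> x + a *\<^sub>R u + b *\<^sub>R v \<in> S"
  obtains a b where "0 \<le> a" "a \<le> s" "0 \<le> b" "b \<le> s"
    "f (x + s *\<^sub>R u + s *\<^sub>R v) - f (x + s *\<^sub>R u) - (f (x + s *\<^sub>R v) - f x) =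
      s * s * fd (\<lambda>y. fd f y u) (x + a *\<^sub>R u + b *\<^sub>R v) v"
proof -
  let ?D = "\<lambda>y. fd f y u"
  have f': "(f has_derivative fd f y) (at y)"
    and D': "(?D has_derivative fd ?D y) (at y)" if "y \<in> S" for y
    using assms(1) that by (simp_all add: numeral_2_eq_2 frechet_derivative_works)
  have line: "((\<lambda>r. g (p + r *\<^sub>R w)) has_real_derivative g' w) (at r)"
    if "(g has_derivative g') (at (p + r *\<^sub>R w))" for g :: "'a \<Rightarrow> real" and g' p w r
  proof -
    have "((\<lambda>r. p + r *\<^sub>R w) has_derivative (\<lambda>h. h *\<^sub>R w)) (at r)"
      by (auto intro!: derivative_eq_intros)
    from has_derivative_compose[OF this that]
    show ?thesis
      by (simp add: has_field_derivative_def linear_scale[OF has_derivative_linear[OF that]] mult_commute_abs)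
  qed
  let ?\<phi> = "\<lambda>r. f ((x + s *\<^sub>R v) + r *\<^sub>R u) - f (x + r *\<^sub>R u)"
  have "\<exists>a>0. a < s \<and> ?\<phi> s - ?\<phi> 0 = (s - 0) * (?D ((x + s *\<^sub>R v) + a *\<^sub>R u) - ?D (x + a *\<^sub>R u))"
  proof (rule MVT2[OF assms(2)])
    fix r assume r: "0 \<le> r" "r \<le> s"
    have "x + s *\<^sub>R v + r *\<^sub>R u \<in> S" "x + r *\<^sub>R u \<in> S"
      using S[of r s] S[of r 0] r assms(2) by (simp_all add: algebra_simps)
    then show "(?\<phi> has_real_derivative ?D ((x + s *\<^sub>R v) + r *\<^sub>R u) - ?D (x + r *\<^sub>R u)) (at r)"
      by (intro DERIV_diff line f')
  qed
  then obtain a where a: "0 < a" "a < s"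
    "?\<phi> s - ?\<phi> 0 = s * (?D ((x + s *\<^sub>R v) + a *\<^sub>R u) - ?D (x + a *\<^sub>R u))" by auto
  let ?\<psi> = "\<lambda>r. ?D ((x + a *\<^sub>R u) + r *\<^sub>R v)"
  have "\<exists>b>0. b < s \<and> ?\<psi> s - ?\<psi> 0 = (s - 0) * fd ?D ((x + a *\<^sub>R u) + b *\<^sub>R v) v"
  proof (rule MVT2[OF assms(2)])
    fix r assume "0 \<le> r" "r \<le> s"
    then show "(?\<psi> has_real_derivative fd ?D ((x + a *\<^sub>R u) + r *\<^sub>R v) v) (at r)"
      using a S by (intro line D') auto
  qed
  then obtain b where b: "0 < b" "b < s"
    "?\<psi> s - ?\<psi> 0 = s * fd ?D ((x + a *\<^sub>R u) + b *\<^sub>R v) v" by auto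
  show thesis
    by (rule that[of a b]) (use a b in \<open>auto simp: algebra_simps\<close>)
qed

text \<open>The second difference over a small parallelogram is symmetric in u and v, so the two
  mixed derivatives agree at two points close to x. If they differed at x, continuity with half
  their distance as tolerance would be contradicted.\<close>

lemma symmetric_second_derivative:
  fixes f :: "'a::real_normed_vector \<Rightarrow> real"
  assumes "open S" "Ck_on 2 S f" "x \<in> S"
  shows "fd (\<lambda>y. fd f y u) x v =
    fd (\<lambda>y. fd f y v) x u"
proof (rule ccontr)
  define H where "H u v y = fd (\<lambda>y. fd f y u) y v" for u v y
  assume "\<not> ?thesis"
  then have e: "\<bar>H u v x - H v u x\<bar> / 2 > 0" (is "?e > 0") by (simp add: H_def)
  have cont: "isCont (H u v) x" for u v
    using assms unfolding H_def[abs_def]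
    by (simp add: numeral_2_eq_2 continuous_on_eq_continuous_at)
  from cont[of u v] cont[of v u] e obtain d1 d2 d3
    where d: "d1 > 0" "d2 > 0" "d3 > 0" "\<And>y. dist y x < d1 \<Longrightarrow> dist (H u v y) (H u v x) < ?e"
    "\<And>y. dist y x < d2 \<Longrightarrow> dist (H v u y) (H v u x) < ?e" "\<And>y. dist y x < d3 \<Longrightarrow> y \<in> S"
    using assms(1,3) unfolding continuous_at_eps_delta open_dist by metis
  define d where "d = min d1 (min d2 d3)"
  have "d > 0" using d by (simp add: d_def)
  \<comment> \<open>Small enough for the whole parallelogram with sides s u and s v to stay within
    distance d of x; the summand 1 covers u = v = 0.\<close>
  define s where "s = d / (2 * (norm u + norm v + 1))"
  have s: "s > 0" using \<open>d > 0\<close> norm_ge_zero[of u] norm_ge_zero[of v] unfolding s_def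
    by (intro divide_pos_pos mult_pos_pos add_nonneg_pos) auto
  have near: "dist (x + a *\<^sub>R u + b *\<^sub>R v) x < d" if "0 \<le> a" "a \<le> s" "0 \<le> b" "b \<le> s" for a b
  proof -
    have "dist (x + a *\<^sub>R u + b *\<^sub>R v) x = norm (a *\<^sub>R u + b *\<^sub>R v)" by (simp add: dist_norm)
    also have "\<dots> \<le> a * norm u + b * norm v"
      using norm_triangle_ineq[of "a *\<^sub>R u" "b *\<^sub>R v"] that by simp
    also have "\<dots> \<le> s * norm u + s * norm v"
      using that by (intro add_mono mult_right_mono) auto
    also have "\<dots> = s * (norm u + norm v)" by (simp add: algebra_simps)
    also have "\<dots> < s * (2 * (norm u + norm v + 1))"
    proof (rule mult_strict_left_mono[OF _ s])
      show "norm u + norm v < 2 * (norm u + norm v + 1)"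
        using norm_ge_zero[of u] norm_ge_zero[of v] by argo
    qed
    also have "\<dots> = d"
    proof -
      have "norm u + norm v + 1 \<noteq> 0" using norm_ge_zero[of u] norm_ge_zero[of v] by argo
      then show ?thesis by (simp add: s_def)
    qed
    finally show ?thesis .
  qed
  have near': "dist (x + b *\<^sub>R v + a *\<^sub>R u) x < d" if "0 \<le> a" "a \<le> s" "0 \<le> b" "b \<le> s" for a b
    using near[OF that] by (simp add: algebra_simps)
  obtain a b where 1: "0 \<le> a" "a \<le> s" "0 \<le> b" "b \<le> s"
    "f (x + s *\<^sub>R u + s *\<^sub>R v) - f (x + s *\<^sub>R u) - (f (x + s *\<^sub>R v) - f x) = s * s * H u v (x + a *\<^sub>R u + b *\<^sub>R v)"
    using second_difference_mean_value[OF assms(2) s, of x u v] near d(6) unfolding H_def d_def by (smt (verit))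
  obtain a' b' where 2: "0 \<le> a'" "a' \<le> s" "0 \<le> b'" "b' \<le> s"
    "f (x + s *\<^sub>R v + s *\<^sub>R u) - f (x + s *\<^sub>R v) - (f (x + s *\<^sub>R u) - f x) = s * s * H v u (x + a' *\<^sub>R v + b' *\<^sub>R u)"
    using second_difference_mean_value[OF assms(2) s, of x v u] near' d(6) unfolding H_def d_def by (smt (verit))
  have "f (x + s *\<^sub>R u + s *\<^sub>R v) = f (x + s *\<^sub>R v + s *\<^sub>R u)" by (simp add: algebra_simps)
  with 1(5) 2(5) have "s * s * H u v (x + a *\<^sub>R u + b *\<^sub>R v) = s * s * H v u (x + a' *\<^sub>R v + b' *\<^sub>R u)" by linarith
  then have "H u v (x + a *\<^sub>R u + b *\<^sub>R v) = H v u (x + a' *\<^sub>R v + b' *\<^sub>R u)" using s by simp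
  moreover have "dist (H u v (x + a *\<^sub>R u + b *\<^sub>R v)) (H u v x) < ?e"
    using near[OF 1(1-4)] d(4) by (simp add: d_def)
  moreover have "dist (H v u (x + a' *\<^sub>R v + b' *\<^sub>R u)) (H v u x) < ?e"
    using near'[OF 2(3,4,1,2)] d(5) by (simp add: d_def)
  ultimately show False
    using dist_triangle_half_r[of "H u v (x + a *\<^sub>R u + b *\<^sub>R v)" "H u v x" "2 * ?e" "H v u x"]
    by (simp add: dist_real_def)
qed

section \<open>Inverses of families of linear maps and the smooth inverse function theorem\<close>

lemma Ck_on_imp_continuous_on: "Ck_on n S f \<Longrightarrow> continuous_on S f"
proof (induction n)
  case (Suc n)
  then show ?case using Ck_on_SucD by blast
qed simp

text \<open>At a zero of q the increments of c are multiplied by something of first order, so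
  continuity of c suffices. This serves to differentiate an inverse family that is so far only known
  to be continuous.\<close>

lemma has_derivative_mult_vanishing:
  fixes c :: "'a::real_normed_vector \<Rightarrow> real" and q :: "'a \<Rightarrow> 'b::real_normed_vector"
  assumes "isCont c x" "(q has_derivative q') (at x)" "q x = 0"
  shows "((\<lambda>y. c y *\<^sub>R q y) has_derivative (\<lambda>v. c x *\<^sub>R q' v)) (at x)"
proof -
  have 1: "((\<lambda>y. norm (q y - q x - q' (y - x)) / norm (y - x)) \<longlongrightarrow> 0) (at x)"
    using assms(2) by (simp add: has_derivative_iff_norm)
  obtain K where K: "\<And>y. norm (q' y) \<le> norm y * K"
    using bounded_linear.bounded[OF has_derivative_bounded_linear[OF assms(2)]] by blast
  have c0: "((\<lambda>y. \<bar>c y - c x\<bar>) \<longlongrightarrow> 0) (at x)"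
    using assms(1) by (metis LIM_zero isCont_def tendsto_rabs_zero)
  have c1: "((\<lambda>y. \<bar>c y\<bar>) \<longlongrightarrow> \<bar>c x\<bar>) (at x)"
    using assms(1) by (metis isCont_def tendsto_rabs)
  have "((\<lambda>y. \<bar>c y\<bar> * (norm (q y - q x - q' (y - x)) / norm (y - x)) + \<bar>c y - c x\<bar> * K) \<longlongrightarrow> \<bar>c x\<bar> * 0 + 0 * K) (at x)"
    by (intro tendsto_intros c0 c1 1)
  then have lim: "((\<lambda>y. \<bar>c y\<bar> * (norm (q y - q x - q' (y - x)) / norm (y - x)) + \<bar>c y - c x\<bar> * K) \<longlongrightarrow> 0) (at x)"
    by simp
  have "((\<lambda>y. norm (c y *\<^sub>R q y - c x *\<^sub>R q x - c x *\<^sub>R q' (y - x)) / norm (y - x)) \<longlongrightarrow> 0) (at x)"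
  proof (rule Lim_null_comparison[OF _ lim])
    have "norm (c y *\<^sub>R q y - c x *\<^sub>R q x - c x *\<^sub>R q' (y - x)) / norm (y - x)
      \<le> \<bar>c y\<bar> * (norm (q y - q x - q' (y - x)) / norm (y - x)) + \<bar>c y - c x\<bar> * K" if "y \<noteq> x" for y
    proof -
      have "c y *\<^sub>R q y - c x *\<^sub>R q x - c x *\<^sub>R q' (y - x) = c y *\<^sub>R (q y - q x - q' (y - x)) + (c y - c x) *\<^sub>R q' (y - x)"
        using assms(3) by (simp add: algebra_simps)
      then have "norm (c y *\<^sub>R q y - c x *\<^sub>R q x - c x *\<^sub>R q' (y - x)) \<le>
        \<bar>c y\<bar> * norm (q y - q x - q' (y - x)) + \<bar>c y - c x\<bar> * (norm (y - x) * K)"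
        using norm_triangle_ineq[of "c y *\<^sub>R (q y - q x - q' (y - x))" "(c y - c x) *\<^sub>R q' (y - x)"]
          mult_left_mono[OF K[of "y - x"], of "\<bar>c y - c x\<bar>"] by simp
      then have "norm (c y *\<^sub>R q y - c x *\<^sub>R q x - c x *\<^sub>R q' (y - x)) / norm (y - x) \<le>
        (\<bar>c y\<bar> * norm (q y - q x - q' (y - x)) + \<bar>c y - c x\<bar> * (norm (y - x) * K)) / norm (y - x)"
        by (rule divide_right_mono) simp
      then show ?thesis using that by (simp add: add_divide_distrib)
    qed
    then show "\<forall>\<^sub>F y in at x. norm (norm (c y *\<^sub>R q y - c x *\<^sub>R q x - c x *\<^sub>R q' (y - x)) / norm (y - x))
      \<le> \<bar>c y\<bar> * (norm (q y - q x - q' (y - x)) / norm (y - x)) + \<bar>c y - c x\<bar> * K"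
      by (auto simp: eventually_at intro!: exI[of _ 1])
  qed
  then show ?thesis
    using bounded_linear_scaleR_right[THEN bounded_linear_compose, OF has_derivative_bounded_linear[OF assms(2)], of "c x"]
    by (simp add: has_derivative_iff_norm)
qed

text \<open>Everything comes from A' y - A' z = A' z (A z - A y) A' y. With a local bound for A' y
  it gives continuity; differentiated at z it gives the derivative - A' (DA) A', which is of class n
  if A is of class n + 1 and A' of class n.\<close>

lemma Ck_on_inverse_family:
  fixes A A' :: "'a::real_normed_vector \<Rightarrow> 'b::euclidean_space \<Rightarrow> 'b"
  assumes S: "open S" and lin: "\<And>x. x \<in> S \<Longrightarrow> linear (A x)" "\<And>x. x \<in> S \<Longrightarrow> linear (A' x)"
    and inv: "\<And>x w. x \<in> S \<Longrightarrow> A x (A' x w) = w" "\<And>x w. x \<in> S \<Longrightarrow> A' x (A x w) = w"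
    and "\<And>v. Ck_on n S (\<lambda>x. A x v)"
  shows "Ck_on n S (\<lambda>x. A' x w)"
  using assms(6)
proof (induction n arbitrary: w)
  case 0
  have "isCont (\<lambda>x. A' x w) z" if z: "z \<in> S" for z
  proof -
    obtain c where c: "c > 0" "\<And>y. norm (A' z y) \<le> c * norm y"
      using linear_bounded_pos[OF lin(2)[OF z]] by blast
    \<comment> \<open>Bounds the operator norm of A y - A z by means of the finitely many basis
      vectors.\<close>
    define \<rho> where "\<rho> y = (\<Sum>b\<in>Basis. norm (A y b - A z b))" for y
    have "isCont (\<lambda>y. A y b) z" for b
      using 0 S z by (simp add: continuous_on_eq_continuous_at)
    then have "((\<lambda>y. A y b - A z b) \<longlongrightarrow> 0) (at z)" for b
      by (simp add: LIM_zero isCont_def)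
    then have "(\<rho> \<longlongrightarrow> (\<Sum>b\<in>(Basis::'b set). norm (0::'b))) (at z)"
      unfolding \<rho>_def[abs_def] by (intro tendsto_intros) auto
    then have \<rho>: "(\<rho> \<longlongrightarrow> 0) (at z)" by simp
    have "norm (A y v - A z v) \<le> \<rho> y * norm v" if "y \<in> S" for y v
    proof -
      have "A y v - A z v = (\<Sum>b\<in>Basis. (v \<bullet> b) *\<^sub>R (A y b - A z b))"
        using linear_eq_sum_Basis[OF lin(1)[OF that], of v] linear_eq_sum_Basis[OF lin(1)[OF z], of v]
        by (simp add: scaleR_diff_right sum_subtractf)
      also have "norm \<dots> \<le> (\<Sum>b\<in>Basis. norm v * norm (A y b - A z b))"
        by (rule sum_norm_le) (auto intro!: mult_right_mono Basis_le_norm)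
      finally show ?thesis by (simp add: \<rho>_def sum_distrib_left mult.commute)
    qed
    then have est: "norm (A' y w - A' z w) \<le> c * (\<rho> y * norm (A' y w))" if "y \<in> S" for y
    proof -
      have "A' y w - A' z w = A' z (A z (A' y w) - A y (A' y w))"
        using that z by (simp add: linear_diff[OF lin(2)] inv)
      then have "norm (A' y w - A' z w) \<le> c * norm (A y (A' y w) - A z (A' y w))"
        using c(2) by (metis norm_minus_commute)
      also have "\<dots> \<le> c * (\<rho> y * norm (A' y w))"
        using \<open>\<And>y v. y \<in> S \<Longrightarrow> norm (A y v - A z v) \<le> \<rho> y * norm v\<close> that c(1) by (intro mult_left_mono) auto
      finally show ?thesis .
    qed
    have "\<forall>\<^sub>F y in at z. y \<in> S" using S z eventually_at_in_open' by blast
    moreover have "\<forall>\<^sub>F y in at z. \<rho> y < 1 / (2 * c)"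
      using order_tendstoD(2)[OF \<rho>] c(1) by simp
    ultimately have "\<forall>\<^sub>F y in at z. norm (A' y w - A' z w) \<le> \<rho> y * (2 * c * norm (A' z w))"
    proof eventually_elim
      case (elim y)
      have "\<rho> y \<ge> 0" by (simp add: \<rho>_def sum_nonneg)
      \<comment> \<open>The error is at most half of \<open>norm (A' y w)\<close>, so it can be
        absorbed, and near z this norm is at most twice its value at z.\<close>
      have "c * \<rho> y \<le> 1 / 2" using elim(2) c(1) by (simp add: field_simps)
      then have "c * (\<rho> y * norm (A' y w)) \<le> norm (A' y w) / 2"
        using mult_right_mono[of "c * \<rho> y" "1/2" "norm (A' y w)"] by (simp add: mult.assoc)
      then have "norm (A' y w) \<le> 2 * norm (A' z w)"
        using est[OF elim(1)] norm_triangle_ineq2[of "A' y w" "A' z w"] by linarith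
      then have "c * (\<rho> y * norm (A' y w)) \<le> c * (\<rho> y * (2 * norm (A' z w)))"
        using \<open>\<rho> y \<ge> 0\<close> c(1) by (intro mult_left_mono) auto
      then show ?case using est[OF elim(1)] by (simp add: mult_ac)
    qed
    moreover have "((\<lambda>y. \<rho> y * (2 * c * norm (A' z w))) \<longlongrightarrow> 0) (at z)"
      using tendsto_mult_left_zero[OF \<rho>] by blast
    ultimately have "((\<lambda>y. A' y w - A' z w) \<longlongrightarrow> 0) (at z)"
      by (rule Lim_null_comparison)
    then show ?thesis unfolding isCont_def by (rule LIM_zero_cancel)
  qed
  then show ?case by (simp add: continuous_at_imp_continuous_on)
next
  case (Suc n)
  have A': "Ck_on n S (\<lambda>x. A' x w)" for w
    using Suc.IH Suc.prems Ck_on_SucD by blast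
  have cont: "isCont (\<lambda>x. A' x w) z" if "z \<in> S" for z w
  proof -
    have "continuous_on S (\<lambda>x. A' x w)" by (rule Ck_on_imp_continuous_on[OF A'])
    then show ?thesis using S that by (simp add: continuous_on_eq_continuous_at)
  qed
  define DA where "DA x v b = fd (\<lambda>x. A x b) x v" for x v b
  have "((\<lambda>x. A' x w) has_derivative (\<lambda>v. - (\<Sum>b\<in>Basis. (A' z w \<bullet> b) *\<^sub>R A' z (DA z v b)))) (at z)" if z: "z \<in> S" for z
  proof -
    \<comment> \<open>\<open>q b\<close> vanishes at z, and A' y w is A' z w minus the sum of the
      \<open>q b y\<close> weighted by the coordinates of A' y w. So
      \<open>has_derivative_mult_vanishing\<close> applies, the weights being continuous.\<close>
    define q where "q b y = A' z (A y b - A z b)" for b y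
    have q: "(q b has_derivative (\<lambda>v. A' z (DA z v b))) (at z)" for b
    proof -
      have "((\<lambda>y. A y b - A z b) has_derivative (\<lambda>v. DA z v b)) (at z)"
        using Ck_on_has_derivative[OF Suc.prems[of b] z] unfolding DA_def
        by (auto intro!: derivative_eq_intros)
      then show ?thesis unfolding q_def
        using bounded_linear.has_derivative[OF linear_conv_bounded_linear[THEN iffD1, OF lin(2)[OF z]]] by blast
    qed
    have "((\<lambda>y. A' z w - (\<Sum>b\<in>Basis. (A' y w \<bullet> b) *\<^sub>R q b y)) has_derivative
      (\<lambda>v. 0 - (\<Sum>b\<in>Basis. (A' z w \<bullet> b) *\<^sub>R A' z (DA z v b)))) (at z)"
    proof (intro has_derivative_diff has_derivative_const has_derivative_sum has_derivative_mult_vanishing q)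
      show "isCont (\<lambda>y. A' y w \<bullet> b) z" for b using cont[OF z] by (intro continuous_intros)
      show "q b z = 0" for b using linear_0[OF lin(2)[OF z]] by (simp add: q_def)
    qed
    moreover have "A' z w - (\<Sum>b\<in>Basis. (A' y w \<bullet> b) *\<^sub>R q b y) = A' y w" if y: "y \<in> S" for y
    proof -
      have "(\<Sum>b\<in>Basis. (A' y w \<bullet> b) *\<^sub>R q b y) = A' z (\<Sum>b\<in>Basis. (A' y w \<bullet> b) *\<^sub>R (A y b - A z b))"
        by (simp add: q_def linear_sum[OF lin(2)[OF z]] linear_scale[OF lin(2)[OF z]])
      also have "(\<Sum>b\<in>Basis. (A' y w \<bullet> b) *\<^sub>R (A y b - A z b)) = A y (A' y w) - A z (A' y w)"
        using linear_eq_sum_Basis[OF lin(1)[OF y], of "A' y w"] linear_eq_sum_Basis[OF lin(1)[OF z], of "A' y w"]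
        by (simp add: scaleR_diff_right sum_subtractf)
      finally show ?thesis
        using y z by (simp add: linear_diff[OF lin(2)] inv)
    qed
    ultimately show ?thesis
      using has_derivative_transform_within_open[where g = "\<lambda>x. A' x w", OF _ S z] by simp
  qed
  moreover have "Ck_on n S (\<lambda>z. - (\<Sum>b\<in>Basis. (A' z w \<bullet> b) *\<^sub>R A' z (DA z v b)))" for v
    by (intro Ck_on_bounded_linear[OF S bounded_linear_minus[OF bounded_linear_ident]] Ck_on_sum S
        Ck_on_bilinear[OF S bounded_bilinear_scaleR] Ck_on_bilinear[OF S bounded_bilinear_inner] A' Ck_on_const
        Ck_on_linear_family[OF S lin(2)])
      (use Suc.prems in \<open>simp_all add: DA_def\<close>)
  ultimately show ?case by (rule Ck_on_SucI[OF S])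
qed

lemma inverse_of_linear:
  fixes L :: "'a::euclidean_space \<Rightarrow> 'a"
  assumes "linear L" "inj L"
  shows "linear (inv L)" "L (inv L w) = w" "inv L (L w) = w"
proof -
  have "surj L" using assms by (intro linear_injective_imp_surjective) auto
  then show 1: "L (inv L w) = w" for w by (rule surj_f_inv_f)
  show 2: "inv L (L w) = w" for w using assms(2) by simp
  show "linear (inv L)"
    by (rule linearI) (metis 1 2 linear_add[OF assms(1)], metis 1 2 linear_scale[OF assms(1)])
qed

text \<open>Bootstrapping: the inverse g has derivative \<open>inv (fd f (g y))\<close>, which is of
  class n as soon as g is, by \<open>Ck_on_compose\<close> and \<open>Ck_on_inverse_family\<close>.
  Hence g is of class n + 1.\<close>

theorem smooth_inverse_function:
  fixes f :: "'a::euclidean_space \<Rightarrow> 'a"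
  assumes "open U" "smooth_on U f" "x0 \<in> U" "inj (fd f x0)"
  obtains U' V g where "open U'" "U' \<subseteq> U" "x0 \<in> U'" "open V" "f x0 \<in> V" "homeomorphism U' V f g"
    "smooth_on V g" "\<And>x. x \<in> U' \<Longrightarrow> inj (fd f x)"
proof -
  let ?f' = "\<lambda>x. Blinfun (fd f x)"
  have bl: "bounded_linear (fd f x)" if "x \<in> U" for x
    using has_derivative_bounded_linear[OF smooth_on_has_derivative[OF assms(2) that]] .
  then have app: "blinfun_apply (?f' x) = fd f x" if "x \<in> U" for x
    using that by (simp add: bounded_linear_Blinfun_apply)
  have lin: "linear (fd f x)" if "x \<in> U" for x
    using bl[OF that] by (rule bounded_linear.linear)
  let ?i = "inv (fd f x0)"
  note inv0 = inverse_of_linear[OF lin[OF assms(3)] assms(4)]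
  have "Blinfun ?i o\<^sub>L ?f' x0 = id_blinfun"
    using inv0 assms(3) by (intro blinfun_eqI)
      (simp add: app bounded_linear_Blinfun_apply linear_conv_bounded_linear[symmetric])
  moreover have "continuous_on U ?f'"
  proof (rule continuous_on_blinfun_componentwise)
    show "continuous_on U (\<lambda>x. blinfun_apply (?f' x) i)" for i
      using smooth_on_imp_continuous_on[OF smooth_on_derivative[OF assms(2), of i]]
      by (rule continuous_on_eq) (simp add: app)
  qed
  moreover have "(f has_derivative blinfun_apply (?f' x)) (at x)" if "x \<in> U" for x
    using smooth_on_has_derivative[OF assms(2) that] app[OF that] by simp
  ultimately obtain U' V g g' where U': "open U'" "U' \<subseteq> U" "x0 \<in> U'" "open V" "f x0 \<in> V" "homeomorphism U' V f g"
    and g: "\<And>y. y \<in> V \<Longrightarrow> (g has_derivative (g' y)) (at y)"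
    and g': "\<And>y. y \<in> V \<Longrightarrow> g' y = inv (blinfun_apply (?f'(g y)))"
    and bij: "\<And>y. y \<in> V \<Longrightarrow> bij (blinfun_apply (?f'(g y)))"
    using inverse_function_theorem[OF assms(1) _ _ assms(3), where f = f and f' = ?f'] by metis
  have gU: "g y \<in> U" if "y \<in> V" for y
    using U'(2,6) that by (auto simp: homeomorphism_def)
  have inj: "inj (fd f (g y))" if "y \<in> V" for y
    using bij[OF that] app[OF gU[OF that]] by (simp add: bij_is_inj)
  note inv = inverse_of_linear[OF lin[OF gU] inj]
  have "Ck_on n V g" for n
  proof (induction n)
    case 0
    then show ?case using U'(6) by (simp add: homeomorphism_def)
  next
    case (Suc n)
    have "Ck_on n V (\<lambda>y. inv (fd f (g y)) w)" for w
    proof (rule Ck_on_inverse_family[where A = "\<lambda>y. fd f (g y)"])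
      show "Ck_on n V (\<lambda>y. fd f (g y) v)" for v
        by (rule Ck_on_compose[OF U'(4) assms(1) gU _ Suc])
           (use smooth_on_derivative[OF assms(2), of v] in \<open>simp_all add: smooth_on_def\<close>)
    qed (use U'(4) inv lin gU in auto)
    then show ?case
      by (rule Ck_on_SucI[OF U'(4), rotated]) (use g g' app gU in auto)
  qed
  then have "smooth_on V g" by (simp add: smooth_on_def)
  moreover have "inj (fd f x)" if "x \<in> U'" for x
    using inj[of "f x"] U'(6) that by (auto simp: homeomorphism_def)
  ultimately show thesis using that U' by blast
qed

text \<open>With a left inverse K of L y0, \<open>\<rho> y\<close> is an entrywise bound, in a basis
  C, for the distance of K (L y) from the identity. Where it is below 1, a kernel vector v of L y
  would have a sum of absolute coordinates at most \<open>\<rho> y\<close> times itself, hence zero.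
  The domain needs no norm, only a finite spanning set.\<close>

lemma inj_family_open:
  fixes B :: "'d::real_vector set" and L :: "'x::topological_space \<Rightarrow> 'd \<Rightarrow> 'w::euclidean_space"
  assumes B: "finite B" "span B = UNIV"
    and U: "open U" "y0 \<in> U" and lin: "\<And>y. y \<in> U \<Longrightarrow> linear (L y)"
    and cont: "\<And>v. continuous_on U (\<lambda>y. L y v)" and "inj (L y0)"
  obtains V where "open V" "y0 \<in> V" "V \<subseteq> U" "\<And>y. y \<in> V \<Longrightarrow> inj (L y)"
proof -
  obtain C where C: "C \<subseteq> B" "independent C" "span C = UNIV"
    using maximal_independent_subset[of B] B(2) span_mono span_span by (metis subset_antisym top_greatest)
  have "finite C" using C(1) B(1) by (rule finite_subset)
  define c where "c i v = representation C v i" for i v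
  have lin_c: "linear (c i)" for i
    using C(2,3) by (auto intro!: linearI simp: c_def representation_add representation_scale)
  have rep: "v = (\<Sum>i\<in>C. c i v *\<^sub>R i)" for v
    using sum_representation_eq[OF C(2) _ \<open>finite C\<close> subset_refl, of v] C(3) by (simp add: c_def)
  obtain K where K: "linear K" "\<And>v. K (L y0 v) = v"
    using linear_injective_left_inverse[OF lin[OF U(2)] assms(7)] by (auto simp: fun_eq_iff)
  define \<rho> where "\<rho> y = (\<Sum>j\<in>C. \<Sum>i\<in>C. \<bar>c i (K (L y j - L y0 j))\<bar>)" for y
  have "continuous_on U \<rho>" unfolding \<rho>_def[abs_def]
  proof (intro continuous_on_sum continuous_on_rabs)
    show "continuous_on U (\<lambda>y. c i (K (L y j - L y0 j)))" for i j
    proof (rule bounded_linear.continuous_on[where f = "\<lambda>w. c i (K w)"])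
      show "bounded_linear (\<lambda>w. c i (K w))"
        using linear_compose[OF K(1) lin_c] by (simp add: linear_conv_bounded_linear comp_def)
    qed (intro continuous_intros cont)
  qed
  then have "open {y \<in> U. \<rho> y < 1}"
    using continuous_open_preimage[OF _ U(1) open_lessThan, of \<rho> 1] by (simp add: vimage_def Collect_conj_eq)
  moreover have "\<rho> y0 = 0"
    by (simp add: \<rho>_def linear_0[OF K(1)] linear_0[OF lin_c])
  moreover have "inj (L y)" if "y \<in> U" "\<rho> y < 1" for y
    unfolding linear_injective_0[OF lin[OF that(1)]]
  proof (intro allI impI)
    fix v assume v: "L y v = 0"
    let ?n = "\<Sum>i\<in>C. \<bar>c i v\<bar>"
    have "v = - K (L y v - L y0 v)"
      using v K by (simp add: linear_neg)
    also have "L y v - L y0 v = (\<Sum>j\<in>C. c j v *\<^sub>R (L y j - L y0 j))"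
    proof -
      have "M v = (\<Sum>j\<in>C. c j v *\<^sub>R M j)" if "linear M" for M :: "'d \<Rightarrow> 'w"
        using rep[of v] linear_sum[OF that, of "\<lambda>i. c i v *\<^sub>R i" C] by (simp add: linear_scale[OF that])
      from this[OF lin[OF that(1)]] this[OF lin[OF U(2)]] show ?thesis
        by (simp add: scaleR_diff_right sum_subtractf)
    qed
    finally have *: "v = - (\<Sum>j\<in>C. c j v *\<^sub>R K (L y j - L y0 j))"
      by (simp add: linear_sum[OF K(1)] linear_scale[OF K(1)])
    have "\<bar>c i v\<bar> \<le> (\<Sum>j\<in>C. \<bar>c j v\<bar> * \<bar>c i (K (L y j - L y0 j))\<bar>)" for i
    proof -
      have "c i v = - (\<Sum>j\<in>C. c j v * c i (K (L y j - L y0 j)))"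
        by (subst *) (simp add: linear_neg[OF lin_c] linear_sum[OF lin_c] linear_scale[OF lin_c])
      then show ?thesis
        using sum_abs[of "\<lambda>j. c j v * c i (K (L y j - L y0 j))" C] by (simp add: abs_mult)
    qed
    then have "?n \<le> (\<Sum>i\<in>C. \<Sum>j\<in>C. \<bar>c j v\<bar> * \<bar>c i (K (L y j - L y0 j))\<bar>)"
      by (rule sum_mono)
    also have "\<dots> = (\<Sum>j\<in>C. \<bar>c j v\<bar> * (\<Sum>i\<in>C. \<bar>c i (K (L y j - L y0 j))\<bar>))"
      by (subst sum.swap) (simp add: sum_distrib_left)
    also have "\<dots> \<le> (\<Sum>j\<in>C. \<bar>c j v\<bar> * \<rho> y)"
      unfolding \<rho>_def using \<open>finite C\<close>
      by (intro sum_mono mult_left_mono member_le_sum[where f = "\<lambda>j. \<Sum>i\<in>C. \<bar>c i (K (L y j - L y0 j))\<bar>"])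
        (auto intro: sum_nonneg)
    also have "\<dots> = ?n * \<rho> y" by (simp add: sum_distrib_right)
    finally have "?n * (1 - \<rho> y) \<le> 0" by (simp add: algebra_simps)
    then have "?n \<le> 0" using that(2) by (simp add: mult_le_0_iff)
    moreover have "?n \<ge> 0" by (rule sum_nonneg) simp
    ultimately have "?n = 0" by (rule antisym)
    then have "c i v = 0" if "i \<in> C" for i
      using sum_nonneg_eq_0_iff[OF \<open>finite C\<close>, of "\<lambda>i. \<bar>c i v\<bar>"] that by simp
    then show "v = 0" using rep[of v] by simp
  qed
  ultimately show thesis using that[of "{y \<in> U. \<rho> y < 1}"] U(2) by auto
qed

text \<open>Each function is, up to a constant, the derivative of the other, so a simultaneous
  induction raises the order of both. It treats the circular, hyperbolic and affine cases at
  once.\<close>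

lemma smooth_on_harmonic_pair:
  fixes u v :: "real \<Rightarrow> real"
  assumes "\<And>s. (u has_real_derivative a * v s) (at s)" "\<And>s. (v has_real_derivative b * u s) (at s)"
  shows "smooth_on UNIV u" "smooth_on UNIV v"
proof -
  have "Ck_on n UNIV u \<and> Ck_on n UNIV v" for n
  proof (induction n)
    case 0
    then show ?case using assms by (auto intro: continuous_at_imp_continuous_on DERIV_isCont)
  next
    case (Suc n)
    have "Ck_on n UNIV (\<lambda>x. a * v x * h)" "Ck_on n UNIV (\<lambda>x. b * u x * h)" for h
      using Suc by (intro Ck_on_bilinear[OF _ bounded_bilinear_mult] Ck_on_const; simp)+
    then show ?case
      using assms unfolding has_field_derivative_def by (intro conjI Ck_on_SucI[OF open_UNIV])
  qed
  then show "smooth_on UNIV u" "smooth_on UNIV v" by (simp_all add: smooth_on_def)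
qed

section \<open>Orthogonal projections and space forms\<close>

text \<open>The form is Lorentzian on the whole space in the hyperbolic case, so positivity is asked
  on the subspace V only.\<close>

definition inner_form_on :: "('w::real_vector \<Rightarrow> 'w \<Rightarrow> real) \<Rightarrow> 'w set \<Rightarrow> bool" where
  "inner_form_on B V \<longleftrightarrow> bilinear B \<and> (\<forall>x y. B x y = B y x) \<and> subspace V \<and> (\<forall>v\<in>V. v \<noteq> 0 \<longrightarrow> B v v > 0)"

lemma inner_form_on_subset: "inner_form_on B V \<Longrightarrow> subspace U \<Longrightarrow> U \<subseteq> V \<Longrightarrow> inner_form_on B U"
  by (auto simp: inner_form_on_def)

text \<open>One Gram-Schmidt step: subtracting from a its projection to the span of S leaves a
  vector orthogonal to that span, and the projection of v is enlarged by its component along this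
  vector.\<close>

lemma span_orthogonal_projection_exists:
  assumes "inner_form_on B V" "finite S" "span S \<subseteq> V"
  shows "\<exists>w\<in>span S. \<forall>u\<in>span S. B (v - w) u = 0"
  using assms(2,3)
proof (induction S arbitrary: v rule: finite_induct)
  case empty
  have "bilinear B" using assms(1) by (simp add: inner_form_on_def)
  then show ?case by (simp add: bilinear_rzero)
next
  case (insert a S)
  have B: "bilinear B" "\<And>x y. B x y = B y x" "\<And>v. v \<in> V \<Longrightarrow> v \<noteq> 0 \<Longrightarrow> B v v > 0"
    using assms(1) by (auto simp: inner_form_on_def)
  note bl = bilinear_ladd[OF B(1)] bilinear_radd[OF B(1)] bilinear_lsub[OF B(1)] bilinear_rsub[OF B(1)]
    bilinear_lmul[OF B(1)] bilinear_rmul[OF B(1)]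
  have IH: "\<exists>w\<in>span S. \<forall>u\<in>span S. B (v - w) u = 0" for v
    using insert.IH insert.prems span_mono[of S "insert a S"] by blast
  obtain a' where a': "a' \<in> span S" "\<And>u. u \<in> span S \<Longrightarrow> B (a - a') u = 0" using IH[of a] by blast
  obtain v' where v': "v' \<in> span S" "\<And>u. u \<in> span S \<Longrightarrow> B (v - v') u = 0" using IH[of v] by blast
  let ?e = "a - a'"
  have span: "span S \<subseteq> span (insert a S)" by (rule span_mono) auto
  have e: "?e \<in> span (insert a S)"
    using a'(1) span by (intro span_diff) (auto intro: span_base)
  \<comment> \<open>If \<open>?e\<close> is zero, both sides of the next identity vanish whatever t
    is.\<close>
  define t where "t = B v ?e / B ?e ?e"
  have "t * B ?e ?e = B v ?e"
  proof (cases "?e = 0")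
    case True
    then show ?thesis by (simp only:) (simp add: bilinear_rzero[OF B(1)])
  next
    case False
    then show ?thesis using B(3)[of ?e] e insert.prems by (auto simp: t_def)
  qed
  moreover have "B v' ?e = 0" using a'(2)[OF v'(1)] B(2) by simp
  ultimately have be: "B (v - (v' + t *\<^sub>R ?e)) ?e = 0"
    by (simp add: bl algebra_simps)
  show ?case
  proof (intro bexI ballI)
    show "v' + t *\<^sub>R ?e \<in> span (insert a S)"
      using v'(1) span e by (intro span_add span_scale) auto
    fix u assume "u \<in> span (insert a S)"
    then obtain k where "u - k *\<^sub>R a \<in> span S" using span_breakdown_eq by blast
    then have "(u - k *\<^sub>R a) + k *\<^sub>R a' \<in> span S" using a'(1) by (intro span_add span_scale)
    then have u': "(u - k *\<^sub>R a) + k *\<^sub>R a' \<in> span S" (is "?u' \<in> _") .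
    let ?X = "v - (v' + t *\<^sub>R ?e)"
    have "B ?X ?u' = B (v - v') ?u' - t * B ?e ?u'"
      by (simp only: diff_diff_eq[symmetric] bilinear_lsub[OF B(1), of "v - v'"] bilinear_lmul[OF B(1)] real_scaleR_def)
    also have "\<dots> = 0" using v'(2)[OF u'] a'(2)[OF u'] by simp
    finally have "B ?X ?u' + k * B ?X ?e = 0" using be by simp
    moreover have "B ?X (?u' + k *\<^sub>R ?e) = B ?X ?u' + k * B ?X ?e"
      by (simp only: bilinear_radd[OF B(1), of ?X ?u'] bilinear_rmul[OF B(1)] real_scaleR_def)
    moreover have "?u' + k *\<^sub>R ?e = u" by (simp add: algebra_simps)
    ultimately show "B ?X u = 0" by simp
  qed
qed

text \<open>Two candidates differ by an element of V orthogonal to V, which is zero by positivity.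
  So exhibiting a candidate evaluates the description in \<open>orth_proj\<close>.\<close>

lemma orth_proj_unique:
  assumes "inner_form_on B V" "w \<in> V" "\<And>u. u \<in> V \<Longrightarrow> B (v - w) u = 0"
  shows "orth_proj B V v = w"
  unfolding orth_proj_def
proof (rule the_equality)
  fix z assume z: "z \<in> V \<and> (\<forall>u\<in>V. B (v - z) u = 0)"
  have B: "bilinear B" "subspace V" "\<And>v. v \<in> V \<Longrightarrow> v \<noteq> 0 \<Longrightarrow> B v v > 0"
    using assms(1) by (auto simp: inner_form_on_def)
  have "z - w \<in> V" using B(2) z assms(2) by (simp add: subspace_diff)
  moreover have "B (z - w) (z - w) = B (v - w) (z - w) - B (v - z) (z - w)"
    by (simp add: bilinear_lsub[OF B(1)])
  ultimately have "B (z - w) (z - w) = 0" using z assms(3) by simp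
  then show "z = w" using B(3)[OF \<open>z - w \<in> V\<close>] by force
qed (use assms in auto)

lemma orth_proj_mem:
  fixes v :: "'w::euclidean_space"
  assumes "inner_form_on B V"
  shows "orth_proj B V v \<in> V" "u \<in> V \<Longrightarrow> B (v - orth_proj B V v) u = 0"
proof -
  have "subspace V" using assms by (simp add: inner_form_on_def)
  then obtain S where S: "finite S" "span S = V"
    using basis_subspace_exists by metis
  obtain w where w: "w \<in> V" "\<And>u. u \<in> V \<Longrightarrow> B (v - w) u = 0"
    using span_orthogonal_projection_exists[OF assms S(1)] S(2) by blast
  show "orth_proj B V v \<in> V" "u \<in> V \<Longrightarrow> B (v - orth_proj B V v) u = 0"
    using orth_proj_unique[OF assms w] w by auto
qed

lemma orth_proj_form:
  fixes v :: "'w::euclidean_space"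
  assumes "inner_form_on B V" "u \<in> V"
  shows "B (orth_proj B V v) u = B v u"
proof -
  have "bilinear B" using assms(1) by (simp add: inner_form_on_def)
  then show ?thesis using orth_proj_mem(2)[OF assms, of v] by (simp add: bilinear_lsub)
qed

lemma orth_proj_eq_0_iff:
  fixes v :: "'w::euclidean_space"
  assumes "inner_form_on B V"
  shows "orth_proj B V v = 0 \<longleftrightarrow> (\<forall>u\<in>V. B v u = 0)"
proof
  have "bilinear B" using assms by (simp add: inner_form_on_def)
  then show "orth_proj B V v = 0 \<Longrightarrow> \<forall>u\<in>V. B v u = 0"
    using orth_proj_form[OF assms] by (metis bilinear_lzero)
  show "\<forall>u\<in>V. B v u = 0 \<Longrightarrow> orth_proj B V v = 0"
    using assms by (intro orth_proj_unique) (auto simp: inner_form_on_def subspace_0)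
qed

section \<open>Forms and tangent spaces of the space forms and cylinders\<close>

lemma form_space_form: "form (space_form \<epsilon>) x y = \<epsilon> * fst x * fst y + snd x \<bullet> snd y"
  by (simp add: space_form_def Let_def)

lemma points_space_form: "points (space_form \<epsilon>) =
    (if \<epsilon> = 0 then {x. fst x = 0} else {x. form (space_form \<epsilon>) x x = \<epsilon> \<and> (\<epsilon> = -1 \<longrightarrow> fst x > 0)})"
  by (simp add: space_form_def Let_def)

lemma tspace_space_form: "tspace (space_form \<epsilon>) p =
    (if \<epsilon> = 0 then {v. fst v = 0} else {v. form (space_form \<epsilon>) p v = 0})"
  by (simp add: space_form_def Let_def)

lemma form_cylinder: "form (cylinder \<epsilon>) x y = form (space_form \<epsilon>) (fst x) (fst y) + snd x * snd y"
  by (simp add: cylinder_def)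

lemma points_cylinder: "points (cylinder \<epsilon>) = points (space_form \<epsilon>) \<times> UNIV"
  by (simp add: cylinder_def)

lemma tspace_cylinder: "tspace (cylinder \<epsilon>) p = tspace (space_form \<epsilon>) (fst p) \<times> UNIV"
  by (simp add: cylinder_def)

lemma bounded_bilinear_space_form: "bounded_bilinear (form (space_form \<epsilon> :: (real \<times> 'v::euclidean_space) ambient))"
proof -
  have "bilinear (form (space_form \<epsilon> :: (real \<times> 'v) ambient))"
    unfolding bilinear_def by (auto intro!: linearI simp: form_space_form algebra_simps inner_add_left inner_add_right)
  then show ?thesis by (simp add: bilinear_conv_bounded_bilinear)
qed

lemma bounded_bilinear_cylinder: "bounded_bilinear (form (cylinder \<epsilon> :: ((real \<times> 'v::euclidean_space) \<times> real) ambient))"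
proof -
  have "bilinear (form (cylinder \<epsilon> :: ((real \<times> 'v) \<times> real) ambient))"
    unfolding bilinear_def
    by (auto intro!: linearI simp: form_cylinder form_space_form algebra_simps inner_add_left inner_add_right)
  then show ?thesis by (simp add: bilinear_conv_bounded_bilinear)
qed

lemmas space_form_simps =
  bounded_bilinear.add_left[OF bounded_bilinear_space_form]
  bounded_bilinear.add_right[OF bounded_bilinear_space_form]
  bounded_bilinear.scaleR_left[OF bounded_bilinear_space_form]
  bounded_bilinear.scaleR_right[OF bounded_bilinear_space_form]
  bounded_bilinear.sum_left[OF bounded_bilinear_space_form]
  bounded_bilinear.sum_right[OF bounded_bilinear_space_form]
  bounded_bilinear.zero_left[OF bounded_bilinear_space_form]
  bounded_bilinear.zero_right[OF bounded_bilinear_space_form]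
  bounded_bilinear.minus_left[OF bounded_bilinear_space_form]
  bounded_bilinear.minus_right[OF bounded_bilinear_space_form]
  bounded_bilinear.diff_left[OF bounded_bilinear_space_form]
  bounded_bilinear.diff_right[OF bounded_bilinear_space_form]

lemmas cylinder_simps =
  bounded_bilinear.add_left[OF bounded_bilinear_cylinder]
  bounded_bilinear.add_right[OF bounded_bilinear_cylinder]
  bounded_bilinear.scaleR_left[OF bounded_bilinear_cylinder]
  bounded_bilinear.scaleR_right[OF bounded_bilinear_cylinder]
  bounded_bilinear.zero_left[OF bounded_bilinear_cylinder]
  bounded_bilinear.zero_right[OF bounded_bilinear_cylinder]
  bounded_bilinear.minus_left[OF bounded_bilinear_cylinder]
  bounded_bilinear.minus_right[OF bounded_bilinear_cylinder]
  bounded_bilinear.diff_left[OF bounded_bilinear_cylinder]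
  bounded_bilinear.diff_right[OF bounded_bilinear_cylinder]

lemma form_space_form_commute: "form (space_form \<epsilon>) x y = form (space_form \<epsilon>) y x"
  by (simp add: form_space_form inner_commute)

lemma form_cylinder_commute: "form (cylinder \<epsilon>) x y = form (cylinder \<epsilon>) y x"
  by (simp add: form_cylinder form_space_form_commute)

text \<open>Only \<epsilon> = -1 needs an argument: vectors orthogonal to a timelike vector are
  spacelike.\<close>

lemma inner_form_on_space_form:
  fixes p :: "real \<times> 'v::euclidean_space"
  assumes "\<epsilon> \<in> {-1, 0, 1}" "p \<in> points (space_form \<epsilon>)"
  shows "inner_form_on (form (space_form \<epsilon>)) (tspace (space_form \<epsilon>) p)"
proof -
  have bil: "bilinear (form (space_form \<epsilon> :: (real \<times> 'v) ambient))"
    using bounded_bilinear_space_form bilinear_conv_bounded_bilinear by blast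
  have "form (space_form \<epsilon>) v v > 0" if v: "v \<in> tspace (space_form \<epsilon>) p" "v \<noteq> 0" for v :: "real \<times> 'v"
  proof -
    consider "\<epsilon> = 0" | "\<epsilon> = 1" | "\<epsilon> = -1" using assms(1) by auto
    then show ?thesis
    proof cases
      case 1
      then show ?thesis using v by (auto simp: form_space_form tspace_space_form prod_eq_iff)
    next
      case 2
      then show ?thesis using v by (cases v) (auto simp: form_space_form zero_prod_def add_pos_nonneg add_nonneg_pos
            simp flip: power2_eq_square)
    next
      case 3
      \<comment> \<open>With timelike coordinates a and b, Cauchy-Schwarz for a b = P \<bullet> V
        and a a = 1 + P \<bullet> P bounds the square of b strictly by V \<bullet> V.\<close>
      obtain a P b V where pv: "p = (a, P)" "v = (b, V)" by (cases p, cases v) auto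
      have a: "a * a = 1 + P \<bullet> P" and ab: "a * b = P \<bullet> V"
        using v assms(2) 3 by (auto simp: pv points_space_form tspace_space_form form_space_form)
      have "(a * b)\<^sup>2 \<le> (P \<bullet> P) * (V \<bullet> V)"
        using Cauchy_Schwarz_ineq[of P V] by (simp add: ab)
      moreover have "(a * b)\<^sup>2 = (1 + P \<bullet> P) * b\<^sup>2"
        by (simp add: power_mult_distrib a[symmetric] power2_eq_square)
      ultimately have le: "(1 + P \<bullet> P) * b\<^sup>2 \<le> (P \<bullet> P) * (V \<bullet> V)" by simp
      have "V \<noteq> 0"
      proof
        assume "V = 0"
        with le have "(1 + P \<bullet> P) * b\<^sup>2 \<le> 0" by simp
        moreover have "1 + P \<bullet> P > 0" by (simp add: add_pos_nonneg)
        ultimately have "b = 0" by (simp add: mult_le_0_iff)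
        with \<open>V = 0\<close> v(2) show False by (simp add: pv zero_prod_def)
      qed
      then have "(P \<bullet> P) * (V \<bullet> V) < (1 + P \<bullet> P) * (V \<bullet> V)" by simp
      with le have "(1 + P \<bullet> P) * b\<^sup>2 < (1 + P \<bullet> P) * (V \<bullet> V)" by simp
      then have "b\<^sup>2 < V \<bullet> V"
        by (rule mult_left_less_imp_less) simp
      then show ?thesis by (simp add: pv 3 form_space_form power2_eq_square)
    qed
  qed
  moreover have "subspace (tspace (space_form \<epsilon>) p)"
    unfolding subspace_def tspace_space_form
    using bilinear_radd[OF bil] bilinear_rmul[OF bil] bilinear_rzero[OF bil] by auto
  ultimately show ?thesis
    unfolding inner_form_on_def using bil by (intro conjI allI form_space_form_commute) auto
qed

lemma inner_form_on_cylinder: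
  fixes p :: "(real \<times> 'v::euclidean_space) \<times> real"
  assumes "\<epsilon> \<in> {-1, 0, 1}" "p \<in> points (cylinder \<epsilon>)"
  shows "inner_form_on (form (cylinder \<epsilon>)) (tspace (cylinder \<epsilon>) p)"
proof -
  have bil: "bilinear (form (cylinder \<epsilon> :: ((real \<times> 'v) \<times> real) ambient))"
    using bounded_bilinear_cylinder bilinear_conv_bounded_bilinear by blast
  have 1: "inner_form_on (form (space_form \<epsilon>)) (tspace (space_form \<epsilon>) (fst p))"
    using assms by (intro inner_form_on_space_form) (auto simp: points_cylinder)
  then have "bilinear (form (space_form \<epsilon> :: (real \<times> 'v) ambient))" by (simp add: inner_form_on_def)
  have "form (cylinder \<epsilon>) v v > 0" if v: "v \<in> tspace (cylinder \<epsilon>) p" "v \<noteq> 0" for v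
  proof (cases "fst v = 0")
    case True
    then have "snd v \<noteq> 0" using v(2) by (auto simp: prod_eq_iff)
    then show ?thesis
      using bilinear_rzero[OF \<open>bilinear (form (space_form \<epsilon>))\<close>, of 0]
      by (simp add: form_cylinder True flip: power2_eq_square)
  next
    case False
    then have "form (space_form \<epsilon>) (fst v) (fst v) > 0"
      using 1 v(1) by (auto simp: inner_form_on_def tspace_cylinder)
    then show ?thesis by (simp add: form_cylinder add_pos_nonneg)
  qed
  moreover have "subspace (tspace (cylinder \<epsilon>) p)"
    using 1 unfolding tspace_cylinder inner_form_on_def by (auto intro: subspace_Times)
  ultimately show ?thesis
    unfolding inner_form_on_def using bil by (intro conjI allI form_cylinder_commute) auto
qed

lemma normal_space_inner_form_on:
  assumes "inner_form_on (form A) (tspace A (f p))"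
  shows "inner_form_on (form A) (normal_space A M f p)"
proof (rule inner_form_on_subset[OF assms])
  have "bilinear (form A)" "subspace (tspace A (f p))" using assms by (simp_all add: inner_form_on_def)
  then show "subspace (normal_space A M f p)"
    unfolding normal_space_def subspace_def by (auto simp: bilinear_ladd bilinear_lmul bilinear_lzero)
qed (auto simp: normal_space_def)

text \<open>Normal vectors are tangent to the ambient space, so pairing with them is unaffected by
  both projections. The normal connection can thus be tested on the derivative in the surrounding
  vector space.\<close>

lemma normal_connection_eq_0_iff:
  fixes f :: "'p \<Rightarrow> 'w::euclidean_space" and M :: "('p, 'e::real_normed_vector) manifold"
  assumes "inner_form_on (form A) (tspace A (f p))"
  shows "normal_connection A M c f \<xi> p u = 0 \<longleftrightarrow> (\<forall>\<nu>\<in>normal_space A M f p. form A (dmap c \<xi> p u) \<nu> = 0)"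
proof -
  have "form A (orth_proj (form A) (tspace A (f p)) w) \<nu> = form A w \<nu>" if "\<nu> \<in> normal_space A M f p" for \<nu> w
    by (rule orth_proj_form[OF assms]) (use that in \<open>auto simp: normal_space_def\<close>)
  then show ?thesis
    unfolding normal_connection_def ambient_connection_def
      orth_proj_eq_0_iff[OF normal_space_inner_form_on[where f = f and M = M, OF assms]] by simp
qed

section \<open>Tangential projections in the coordinates of the curve\<close>

lemma form_coord_cylinder: "form (coord_cylinder \<epsilon> k) a b =
    \<epsilon> * a 0 * b 0 + (\<Sum>i=1..k. a i * b i) + a (k+1) * b (k+1)"
  by (simp add: coord_cylinder_def Let_def)

lemma points_coord_cylinder: "a \<in> points (coord_cylinder \<epsilon> k) \<longleftrightarrow> (\<forall>i>k+1. a i = 0) \<and>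
    (if \<epsilon> = 0 then a 0 = 0 else \<epsilon> * a 0 * a 0 + (\<Sum>i=1..k. a i * a i) = \<epsilon> \<and> (\<epsilon> = -1 \<longrightarrow> a 0 > 0))"
  by (simp add: coord_cylinder_def Let_def)

lemma tspace_coord_cylinder: "b \<in> tspace (coord_cylinder \<epsilon> k) a \<longleftrightarrow> (\<forall>i>k+1. b i = 0) \<and>
    (if \<epsilon> = 0 then b 0 = 0 else \<epsilon> * a 0 * b 0 + (\<Sum>i=1..k. a i * b i) = 0)"
  by (simp add: coord_cylinder_def Let_def)

text \<open>The argument of \<open>inner_form_on_space_form\<close> for finite sums. For \<epsilon>
  = -1, Cauchy-Schwarz gives (1 + A)(d0^2 - D) \<le> - D, where A and D are the sums of squares of
  the spatial parts; so d0^2 \<le> D, and equality forces D = 0.\<close>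

lemma coord_form_nonneg:
  assumes "\<epsilon> \<in> {-1, 0, 1}" "a \<in> points (coord_cylinder \<epsilon> k)" "d \<in> tspace (coord_cylinder \<epsilon> k) a"
  shows "\<epsilon> * d 0 * d 0 + (\<Sum>i=1..k. d i * d i) \<ge> 0"
    and "\<epsilon> * d 0 * d 0 + (\<Sum>i=1..k. d i * d i) = 0 \<Longrightarrow> i \<le> k \<Longrightarrow> d i = 0"
proof -
  let ?D = "\<Sum>i=1..k. d i * d i" and ?A = "\<Sum>i=1..k. a i * a i"
  have D0: "?D \<ge> 0" and A0: "?A \<ge> 0" by (simp_all add: sum_nonneg)
  have Dz: "d i = 0" if "?D = 0" "1 \<le> i" "i \<le> k" for i
    using that sum_nonneg_eq_0_iff[of "{1..k}" "\<lambda>i. d i * d i"] by auto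
  have *: "\<epsilon> * d 0 * d 0 + ?D \<ge> 0 \<and> (\<epsilon> * d 0 * d 0 + ?D = 0 \<longrightarrow> d 0 = 0 \<and> ?D = 0)"
  proof -
    consider "\<epsilon> = 0" | "\<epsilon> = 1" | "\<epsilon> = -1" using assms(1) by auto
    then show ?thesis
    proof cases
      case 1
      then show ?thesis using assms(3) D0 by (auto simp: tspace_coord_cylinder)
    next
      case 2
      then show ?thesis using D0 by (auto simp: add_nonneg_eq_0_iff)
    next
      case 3
      have a: "a 0 * a 0 = 1 + ?A" and ad: "a 0 * d 0 = (\<Sum>i=1..k. a i * d i)"
        using assms(2,3) 3 by (auto simp: points_coord_cylinder tspace_coord_cylinder)
      have "(a 0 * d 0)\<^sup>2 \<le> ?A * ?D"
        using Cauchy_Schwarz_ineq_sum[of a d "{1..k}"] by (simp add: ad power2_eq_square)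
      moreover have "(a 0 * d 0)\<^sup>2 = (1 + ?A) * (d 0)\<^sup>2"
        unfolding power_mult_distrib a[symmetric] by (simp add: power2_eq_square)
      ultimately have le: "(1 + ?A) * (d 0)\<^sup>2 \<le> ?A * ?D" by simp
      have "?A * ((d 0)\<^sup>2 - ?D) \<le> - (d 0)\<^sup>2" using le by (simp add: algebra_simps)
      then have *: "(1 + ?A) * ((d 0)\<^sup>2 - ?D) \<le> - ?D" by (simp add: algebra_simps)
      have "(d 0)\<^sup>2 - ?D \<le> 0"
      proof (rule ccontr)
        assume "\<not> ?thesis"
        then have "(1 + ?A) * ((d 0)\<^sup>2 - ?D) > 0" using A0 by (intro mult_pos_pos) auto
        then show False using * D0 by linarith
      qed
      moreover have "?D = 0" "d 0 = 0" if "(d 0)\<^sup>2 - ?D = 0"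
      proof -
        show "?D = 0" using * D0 that by simp
        then show "d 0 = 0" using that by simp
      qed
      ultimately show ?thesis using 3 by (auto simp: power2_eq_square)
    qed
  qed
  from * show "\<epsilon> * d 0 * d 0 + ?D \<ge> 0" by (rule conjunct1)
  show "d i = 0" if "\<epsilon> * d 0 * d 0 + ?D = 0" "i \<le> k"
  proof -
    have "d 0 = 0" "?D = 0" using * that(1) by simp_all
    then show ?thesis using Dz[of i] that(2) by (cases "i = 0") simp_all
  qed
qed

text \<open>The counterpart of \<open>orth_proj_unique\<close> for sequences: the difference of two
  candidates is a tangent vector of length zero, whose entries vanish up to k by
  \<open>coord_form_nonneg\<close>, at k + 1 by the last summand, and beyond by the definition of
  \<open>tspace\<close>.\<close>

lemma coord_orth_proj:
  assumes "\<epsilon> \<in> {-1, 0, 1}" "a \<in> points (coord_cylinder \<epsilon> k)" "w \<in> tspace (coord_cylinder \<epsilon> k) a"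
    "\<And>u. u \<in> tspace (coord_cylinder \<epsilon> k) a \<Longrightarrow> form (coord_cylinder \<epsilon> k) (v - w) u = 0"
  shows "orth_proj (form (coord_cylinder \<epsilon> k)) (tspace (coord_cylinder \<epsilon> k) a) v = w"
  unfolding orth_proj_def
proof (rule the_equality)
  let ?B = "form (coord_cylinder \<epsilon> k)" and ?V = "tspace (coord_cylinder \<epsilon> k) a"
  fix z assume z: "z \<in> ?V \<and> (\<forall>u\<in>?V. ?B (v - z) u = 0)"
  have d: "z - w \<in> ?V"
    using z assms(3) by (auto simp: tspace_coord_cylinder algebra_simps sum_subtractf split: if_splits)
  have "(\<Sum>i=1..k. (z - w) i * (z - w) i) = (\<Sum>i=1..k. (v - w) i * (z - w) i) - (\<Sum>i=1..k. (v - z) i * (z - w) i)"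
    unfolding sum_subtractf[symmetric] by (rule sum.cong) (auto simp: algebra_simps)
  then have "?B (z - w) (z - w) = ?B (v - w) (z - w) - ?B (v - z) (z - w)"
    unfolding form_coord_cylinder by (simp add: algebra_simps)
  then have 0: "?B (z - w) (z - w) = 0" using z assms(4)[OF d] d by simp
  note nonneg = coord_form_nonneg[OF assms(1,2) d]
  have last: "(z - w) (k+1) = 0" and "\<epsilon> * (z - w) 0 * (z - w) 0 + (\<Sum>i=1..k. (z - w) i * (z - w) i) = 0"
    using 0 nonneg(1) zero_le_square[of "(z - w) (k+1)"] unfolding form_coord_cylinder
    by (smt (verit) mult_eq_0_iff)+
  then have "(z - w) i = 0" for i
    using nonneg(2)[of i] d by (cases "i \<le> k"; cases "i = k + 1") (auto simp: tspace_coord_cylinder)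
  then show "z = w" by (auto simp: fun_eq_iff)
qed (use assms in auto)

text \<open>The normal line of the cylinder at a is spanned by the entries 0 to k of a; in the flat
  case there is no normal direction, whence l = 0, and the entry 0 is not controlled.\<close>

lemma coord_orth_proj_eq_0D:
  assumes "\<epsilon> \<in> {-1, 0, 1}" "a \<in> points (coord_cylinder \<epsilon> k)"
    "orth_proj (form (coord_cylinder \<epsilon> k)) (tspace (coord_cylinder \<epsilon> k) a) v = (\<lambda>_. 0)"
  obtains l where "\<epsilon> = 0 \<Longrightarrow> l = 0" "\<And>i. i \<le> k \<Longrightarrow> i \<noteq> 0 \<or> \<epsilon> \<noteq> 0 \<Longrightarrow> v i = l * a i" "v (k+1) = 0"
proof -
  \<comment> \<open>Without its last entry, a has square \<epsilon>, and \<epsilon> * \<epsilon> = 1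
    unless \<epsilon> = 0; so this is the coefficient of the projection of v to the normal
    line.\<close>
  define l where "l = \<epsilon> * (\<epsilon> * a 0 * v 0 + (\<Sum>i=1..k. a i * v i))"
  define w where "w = (\<lambda>i. if i = 0 \<and> \<epsilon> = 0 then 0 else if i \<le> k then v i - l * a i else if i = k + 1 then v i else 0)"
  have sum: "(\<Sum>i=1..k. c i * w i) = (\<Sum>i=1..k. c i * v i) - l * (\<Sum>i=1..k. c i * a i)" for c
    by (simp add: w_def algebra_simps sum_subtractf sum_distrib_left)
  have w: "w \<in> tspace (coord_cylinder \<epsilon> k) a"
  proof (cases "\<epsilon> = 0")
    case True
    then show ?thesis by (simp add: tspace_coord_cylinder w_def)
  next
    case False
    have "\<epsilon> * a 0 * w 0 + (\<Sum>i=1..k. a i * w i) =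
      (\<epsilon> * a 0 * v 0 + (\<Sum>i=1..k. a i * v i)) - l * (\<epsilon> * a 0 * a 0 + (\<Sum>i=1..k. a i * a i))"
      unfolding sum using False by (simp add: w_def algebra_simps)
    also have "\<dots> = 0" using assms(1,2) False by (auto simp: points_coord_cylinder l_def)
    finally show ?thesis using False by (simp add: tspace_coord_cylinder w_def)
  qed
  have "orth_proj (form (coord_cylinder \<epsilon> k)) (tspace (coord_cylinder \<epsilon> k) a) v = w"
  proof (rule coord_orth_proj[OF assms(1,2) w])
    fix u assume u: "u \<in> tspace (coord_cylinder \<epsilon> k) a"
    have "form (coord_cylinder \<epsilon> k) (v - w) u = l * (\<epsilon> * a 0 * u 0 + (\<Sum>i=1..k. a i * u i))"
    proof -
      have "(\<Sum>i=1..k. (v - w) i * u i) = l * (\<Sum>i=1..k. a i * u i)"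
        by (simp add: w_def sum_distrib_left mult.assoc)
      then show ?thesis by (simp add: form_coord_cylinder w_def algebra_simps)
    qed
    then show "form (coord_cylinder \<epsilon> k) (v - w) u = 0"
      using u by (cases "\<epsilon> = 0") (auto simp: tspace_coord_cylinder l_def)
  qed
  then have w0: "w i = 0" for i using assms(3) by (auto simp: fun_eq_iff)
  show thesis
  proof (rule that[of l])
    show "\<epsilon> = 0 \<Longrightarrow> l = 0" by (simp add: l_def)
    show "v i = l * a i" if "i \<le> k" "i \<noteq> 0 \<or> \<epsilon> \<noteq> 0" for i
      using w0[of i] that by (auto simp: w_def)
    show "v (k+1) = 0" using w0[of "k+1"] by (simp add: w_def)
  qed
qed

lemma coord_orth_proj_eq_0I:
  assumes "\<epsilon> \<in> {-1, 0, 1}" "a \<in> points (coord_cylinder \<epsilon> k)"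
    "\<epsilon> = 0 \<Longrightarrow> l = 0" "\<And>i. i \<le> k \<Longrightarrow> v i = l * a i" "v (k+1) = 0"
  shows "orth_proj (form (coord_cylinder \<epsilon> k)) (tspace (coord_cylinder \<epsilon> k) a) v = (\<lambda>_. 0)"
proof (rule coord_orth_proj[OF assms(1,2)])
  fix u assume u: "u \<in> tspace (coord_cylinder \<epsilon> k) a"
  have "form (coord_cylinder \<epsilon> k) (v - (\<lambda>_. 0)) u = l * (\<epsilon> * a 0 * u 0 + (\<Sum>i=1..k. a i * u i))"
    using assms(4)[of 0] assms(4,5) by (simp add: form_coord_cylinder algebra_simps sum_distrib_left)
  then show "form (coord_cylinder \<epsilon> k) (v - (\<lambda>_. 0)) u = 0"
    using u assms(3) by (cases "\<epsilon> = 0") (auto simp: tspace_coord_cylinder)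
qed (simp add: tspace_coord_cylinder)

section \<open>Charts\<close>

text \<open>Differentiability is not assumed: f and g have the same derivatives in the sense of
  \<open>has_derivative\<close>, so the choice made by \<open>frechet_derivative\<close> is the same
  as well.\<close>

lemma frechet_derivative_cong_open:
  assumes "open U" "x \<in> U" "\<And>y. y \<in> U \<Longrightarrow> f y = g y"
  shows "fd f x = fd g x"
proof -
  have "(f has_derivative f') (at x) \<longleftrightarrow> (g has_derivative f') (at x)" for f'
    using assms has_derivative_transform_within_open[of f f' x UNIV U g]
      has_derivative_transform_within_open[of g f' x UNIV U f] by auto
  then show ?thesis unfolding frechet_derivative_def by simp
qed

text \<open>What computations with \<open>dmap\<close> require of the charts, without reference to a
  topology. In this form it passes to products with an interval and to restrictions.\<close>

definition atlas :: "('p set \<times> ('p \<Rightarrow> 'e::real_normed_vector)) set \<Rightarrow> bool" where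
  "atlas C \<longleftrightarrow> (\<forall>c\<in>C. inj_on (snd c) (fst c)) \<and>
    (\<forall>c\<in>C. \<forall>d\<in>C. open (snd c ` (fst c \<inter> fst d)) \<and> smooth_on (snd c ` (fst c \<inter> fst d)) (snd d \<circ> cinv c))"

lemma atlas_open_image: "atlas C \<Longrightarrow> c \<in> C \<Longrightarrow> open (cimage c)"
  unfolding atlas_def by (metis Int_absorb)

lemma atlas_cinv: "atlas C \<Longrightarrow> c \<in> C \<Longrightarrow> p \<in> fst c \<Longrightarrow> cinv c (snd c p) = p"
  unfolding atlas_def by (simp add: inv_into_f_f)

lemma cinv_mem: "y \<in> cimage c \<Longrightarrow> cinv c y \<in> fst c" "y \<in> cimage c \<Longrightarrow> snd c (cinv c y) = y"
  by (auto simp: inv_into_into f_inv_into_f)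

lemma dmap_eqI:
  assumes "open U" "snd c p \<in> U" "\<And>y. y \<in> U \<Longrightarrow> f (cinv c y) = F y" "(F has_derivative F') (at (snd c p))"
  shows "dmap c f p = F'"
proof -
  have "fd (f \<circ> cinv c) (snd c p) = fd F (snd c p)"
    using assms by (intro frechet_derivative_cong_open) auto
  then show ?thesis using frechet_derivative_eqI[OF assms(4)] by (auto simp: dmap_def)
qed

lemma has_derivative_dmap:
  assumes "smooth_on (cimage c) (f \<circ> cinv c)" "p \<in> fst c"
  shows "((f \<circ> cinv c) has_derivative dmap c f p) (at (snd c p))"
  using smooth_on_has_derivative[OF assms(1), of "snd c p"] assms(2) by (simp add: dmap_def[abs_def])

text \<open>Chain rule for the factorization of f in the chart c through the transition to d; the
  equality of the two maps holds on the overlap only.\<close>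

lemma dmap_change:
  assumes C: "atlas C" "c \<in> C" "d \<in> C" "p \<in> fst c" "p \<in> fst d"
    and f: "smooth_on (cimage d) (f \<circ> cinv d)"
  shows "dmap c f p u = dmap d f p (dmap c (snd d) p u)"
proof -
  let ?U = "snd c ` (fst c \<inter> fst d)"
  have U: "open ?U" "smooth_on ?U (snd d \<circ> cinv c)" "snd c p \<in> ?U"
    using C by (auto simp: atlas_def)
  have 1: "((snd d \<circ> cinv c) has_derivative dmap c (snd d) p) (at (snd c p))"
    using smooth_on_has_derivative[OF U(2,3)] by (simp add: dmap_def[abs_def])
  have "((f \<circ> cinv d) has_derivative dmap d f p) (at ((snd d \<circ> cinv c) (snd c p)))"
    using has_derivative_dmap[OF f C(5)] atlas_cinv[OF C(1,2,4)] by simp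
  from diff_chain_at[OF 1 this] have "dmap c f p = dmap d f p \<circ> dmap c (snd d) p"
    by (intro dmap_eqI[OF U(1,3)]) (auto simp: atlas_cinv[OF C(1,2)] atlas_cinv[OF C(1,3)])
  then show ?thesis by simp
qed

lemma dmap_chart_self:
  assumes C: "atlas C" "c \<in> C" "p \<in> fst c"
  shows "dmap c (snd c) p u = u"
proof -
  have "dmap c (snd c) p = (\<lambda>u. u)"
    by (rule dmap_eqI[OF atlas_open_image[OF C(1,2)], where F = "\<lambda>u. u"])
      (use C(3) in \<open>auto simp: atlas_cinv[OF C(1,2)]\<close>)
  then show ?thesis by simp
qed

lemma dmap_transition_inverse:
  assumes C: "atlas C" "c \<in> C" "d \<in> C" "p \<in> fst c" "p \<in> fst d"
  shows "dmap d (snd c) p (dmap c (snd d) p u) = u"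
proof -
  let ?U = "snd c ` (fst c \<inter> fst d)" and ?V = "snd d ` (fst d \<inter> fst c)"
  have U: "open ?U" "smooth_on ?U (snd d \<circ> cinv c)" "snd c p \<in> ?U"
    and V: "open ?V" "smooth_on ?V (snd c \<circ> cinv d)" "snd d p \<in> ?V"
    using C by (auto simp: atlas_def)
  have 1: "((snd d \<circ> cinv c) has_derivative dmap c (snd d) p) (at (snd c p))"
    using smooth_on_has_derivative[OF U(2,3)] by (simp add: dmap_def[abs_def])
  have "((snd c \<circ> cinv d) has_derivative dmap d (snd c) p) (at ((snd d \<circ> cinv c) (snd c p)))"
    using smooth_on_has_derivative[OF V(2,3)] atlas_cinv[OF C(1,2,4)] by (simp add: dmap_def[abs_def])
  from diff_chain_at[OF 1 this] have "dmap c (snd c) p = dmap d (snd c) p \<circ> dmap c (snd d) p"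
    by (intro dmap_eqI[OF U(1,3)]) (auto simp: atlas_cinv[OF C(1,2)] atlas_cinv[OF C(1,3)])
  then show ?thesis using dmap_chart_self[OF C(1,2,4), of u] by (simp add: fun_eq_iff)
qed

text \<open>The definition quantifies over all charts at p, but their differentials factor through
  each other by \<open>dmap_change\<close>, so one chart suffices.\<close>

lemma normal_space_chart:
  assumes C: "atlas (charts M)" "c \<in> charts M" "p \<in> fst c" and f: "smooth_map M f"
  shows "normal_space A M f p = {w \<in> tspace A (f p). \<forall>u. form A w (dmap c f p u) = 0}"
proof -
  have *: "dmap d f p u = dmap c f p (dmap d (snd c) p u)" if "d \<in> charts M" "p \<in> fst d" for d u
    using f C(2) by (intro dmap_change[OF C(1) that(1) C(2) that(2) C(3)]) (simp add: smooth_map_def)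
  show ?thesis
  proof (intro set_eqI iffI)
    fix w assume w: "w \<in> {w \<in> tspace A (f p). \<forall>u. form A w (dmap c f p u) = 0}"
    have "form A w (dmap d f p u) = 0" if "d \<in> charts M" "p \<in> fst d" for d u
      using w unfolding *[OF that, of u] by simp
    with w show "w \<in> normal_space A M f p" by (simp add: normal_space_def)
  qed (use C(2,3) in \<open>simp add: normal_space_def\<close>)
qed

text \<open>Transition differentials are injective by \<open>dmap_transition_inverse\<close>, so
  injectivity need only be checked in one chart.\<close>

lemma regular_points_chart:
  assumes C: "atlas (charts M)" "c \<in> charts M" "p \<in> fst c" and f: "smooth_map M f"
  shows "p \<in> regular_points M f \<longleftrightarrow> p \<in> topspace (topo M) \<and> inj (dmap c f p)"
proof -
  have "inj (dmap d f p)" if "inj (dmap c f p)" "d \<in> charts M" "p \<in> fst d" for d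
  proof (rule injI)
    fix u v assume *: "dmap d f p u = dmap d f p v"
    have "smooth_on (cimage c) (f \<circ> cinv c)" using f C(2) by (simp add: smooth_map_def)
    note change = dmap_change[OF C(1) that(2) C(2) that(3) C(3) this]
    have "dmap d (snd c) p u = dmap d (snd c) p v"
      using * unfolding change[of u] change[of v] by (rule injD[OF that(1)])
    from arg_cong[where f = "dmap c (snd d) p", OF this] show "u = v"
      unfolding dmap_transition_inverse[OF C(1) that(2) C(2) that(3) C(3)] .
  qed
  then show ?thesis using C(2,3) by (auto simp: regular_points_def)
qed

lemma manifold_chart:
  assumes "is_manifold M" "c \<in> charts M"
  shows "openin (topo M) (fst c)" "open (cimage c)" "inj_on (snd c) (fst c)"
    "openin (topo M) V \<Longrightarrow> V \<subseteq> fst c \<Longrightarrow> open (snd c ` V)"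
    "open A \<Longrightarrow> openin (topo M) {p \<in> fst c. snd c p \<in> A}"
proof -
  have 1: "openin (topo M) (fst c)" "open (cimage c)"
    and h: "homeomorphic_map (subtopology (topo M) (fst c)) (top_of_set (cimage c)) (snd c)"
    using assms unfolding is_manifold_def by auto
  show "openin (topo M) (fst c)" "open (cimage c)" by (fact 1)+
  have top: "topspace (subtopology (topo M) (fst c)) = fst c"
    using openin_subset[OF 1(1)] by auto
  show "inj_on (snd c) (fst c)"
    using homeomorphic_imp_injective_map[OF h] top by simp
  show "open (snd c ` V)" if "openin (topo M) V" "V \<subseteq> fst c"
  proof -
    have "openin (subtopology (topo M) (fst c)) V"
      using that by (simp add: openin_open_subtopology[OF 1(1)])
    then have "openin (top_of_set (cimage c)) (snd c ` V)"
      using homeomorphic_imp_open_map[OF h] by (simp add: open_map_def)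
    then show ?thesis using 1(2) openin_open_eq by blast
  qed
  show "openin (topo M) {p \<in> fst c. snd c p \<in> A}" if "open A"
  proof -
    have "openin (top_of_set (cimage c)) (cimage c \<inter> A)" using that by (simp add: openin_open_Int)
    then have "openin (subtopology (topo M) (fst c)) {p \<in> topspace (subtopology (topo M) (fst c)). snd c p \<in> cimage c \<inter> A}"
      using homeomorphic_imp_continuous_map[OF h] openin_continuous_map_preimage by fastforce
    then have "openin (topo M) {p \<in> topspace (subtopology (topo M) (fst c)). snd c p \<in> cimage c \<inter> A}"
      by (simp add: openin_open_subtopology[OF 1(1)])
    moreover have "{p \<in> topspace (subtopology (topo M) (fst c)). snd c p \<in> cimage c \<inter> A} = {p \<in> fst c. snd c p \<in> A}"
      unfolding top by auto
    ultimately show ?thesis by simp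
  qed
qed

lemma manifold_atlas:
  assumes "is_manifold M"
  shows "atlas (charts M)"
  unfolding atlas_def
proof (intro conjI ballI)
  fix c d assume c: "c \<in> charts M" and d: "d \<in> charts M"
  show "open (snd c ` (fst c \<inter> fst d))"
    using manifold_chart[OF assms c] manifold_chart(1)[OF assms d] by auto
  show "smooth_on (snd c ` (fst c \<inter> fst d)) (snd d \<circ> cinv c)"
    using assms c d by (simp add: is_manifold_def)
qed (use manifold_chart(3)[OF assms] in auto)

section \<open>Charts of products with an interval and of restrictions\<close>

abbreviation times_chart :: "'p set \<times> ('p \<Rightarrow> 'e) \<Rightarrow> real set \<Rightarrow> ('p \<times> real) set \<times> ('p \<times> real \<Rightarrow> 'e \<times> real)" where
  "times_chart c I \<equiv> (fst c \<times> I, \<lambda>(x, s). (snd c x, s))"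

abbreviation restrict_chart :: "'p set \<times> ('p \<Rightarrow> 'e) \<Rightarrow> 'p set \<Rightarrow> 'p set \<times> ('p \<Rightarrow> 'e)" where
  "restrict_chart c W \<equiv> (fst c \<inter> W, snd c)"

lemma charts_times_interval: "charts (times_interval N I) = (\<lambda>c. times_chart c I) ` charts N"
  by (simp add: times_interval_def)

lemma charts_restrict_manifold: "charts (restrict_manifold M W) = (\<lambda>c. restrict_chart c W) ` charts M"
  by (simp add: restrict_manifold_def)

lemma cimage_times_chart: "cimage (times_chart c I) = cimage c \<times> I"
  by force

lemma cinv_times_chart:
  assumes "inj_on (snd c) (fst c)" "y \<in> cimage c" "s \<in> I"
  shows "cinv (times_chart c I) (y, s) = (cinv c y, s)"
proof (rule inv_into_f_eq)
  show "inj_on (snd (times_chart c I)) (fst (times_chart c I))"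
    using assms(1) by (auto simp: inj_on_def)
qed (use assms in \<open>auto simp: inv_into_into f_inv_into_f\<close>)

lemma times_interval_atlas:
  assumes "atlas (charts N)" "open I"
  shows "atlas (charts (times_interval N I))"
  unfolding atlas_def
proof (intro conjI ballI)
  have inj: "inj_on (snd c) (fst c)" if "c \<in> charts N" for c
    using assms(1) that by (simp add: atlas_def)
  show "inj_on (snd c) (fst c)" if "c \<in> charts (times_interval N I)" for c
    using that inj by (fastforce simp: charts_times_interval inj_on_def)
  fix c' d' assume "c' \<in> charts (times_interval N I)" "d' \<in> charts (times_interval N I)"
  then obtain c d where c: "c \<in> charts N" "c' = times_chart c I" and d: "d \<in> charts N" "d' = times_chart d I"
    by (auto simp: charts_times_interval)
  let ?U = "snd c ` (fst c \<inter> fst d)"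
  have U: "open ?U" "smooth_on ?U (snd d \<circ> cinv c)" using assms(1) c(1) d(1) by (auto simp: atlas_def)
  have im: "snd c' ` (fst c' \<inter> fst d') = ?U \<times> I" unfolding c d by force
  show "open (snd c' ` (fst c' \<inter> fst d'))" unfolding im using U(1) assms(2) by (rule open_Times)
  have o: "open (?U \<times> I)" using U(1) assms(2) by (rule open_Times)
  have "smooth_on (?U \<times> I) (\<lambda>z. ((snd d \<circ> cinv c) (0 + fst z), snd z))"
    by (intro smooth_on_Pair smooth_on_compose_affine[OF _ U(1) bounded_linear_fst] smooth_on_linear
        o U bounded_linear_snd) auto
  then show "smooth_on (snd c' ` (fst c' \<inter> fst d')) (snd d' \<circ> cinv c')"
    unfolding im
  proof (rule smooth_on_cong[OF o, rotated])
    fix z assume z: "z \<in> ?U \<times> I"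
    then have "cinv c' z = (cinv c (fst z), snd z)"
      using cinv_times_chart[OF inj[OF c(1)], of "fst z" "snd z" I] by (auto simp: c)
    then show "((snd d \<circ> cinv c) (0 + fst z), snd z) = (snd d' \<circ> cinv c') z" by (simp add: d)
  qed
qed

text \<open>As \<open>atlas\<close> knows no topology, openness of W enters through the images of
  its intersections with the chart domains.\<close>

lemma restrict_manifold_atlas:
  assumes "atlas (charts M)" "\<And>c d. c \<in> charts M \<Longrightarrow> d \<in> charts M \<Longrightarrow> open (snd c ` (fst c \<inter> fst d \<inter> W))"
  shows "atlas (charts (restrict_manifold M W))"
  unfolding atlas_def
proof (intro conjI ballI)
  have inj: "inj_on (snd c) (fst c)" if "c \<in> charts M" for c
    using assms(1) that by (simp add: atlas_def)
  show "inj_on (snd c) (fst c)" if "c \<in> charts (restrict_manifold M W)" for c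
    using that inj_on_subset[OF inj] by (fastforce simp: charts_restrict_manifold)
  fix c' d' assume "c' \<in> charts (restrict_manifold M W)" "d' \<in> charts (restrict_manifold M W)"
  then obtain c d where c: "c \<in> charts M" "c' = restrict_chart c W" and d: "d \<in> charts M" "d' = restrict_chart d W"
    by (auto simp: charts_restrict_manifold)
  have im: "snd c' ` (fst c' \<inter> fst d') = snd c ` (fst c \<inter> fst d \<inter> W)"
    unfolding c d by (auto simp: Int_ac)
  show o: "open (snd c' ` (fst c' \<inter> fst d'))"
    unfolding im by (rule assms(2)[OF c(1) d(1)])
  have "smooth_on (snd c ` (fst c \<inter> fst d)) (snd d \<circ> cinv c)"
    using assms(1) c(1) d(1) by (auto simp: atlas_def)
  then have "smooth_on (snd c' ` (fst c' \<inter> fst d')) (snd d \<circ> cinv c)"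
    unfolding im by (rule smooth_on_subset) auto
  then show "smooth_on (snd c' ` (fst c' \<inter> fst d')) (snd d' \<circ> cinv c')"
    by (rule smooth_on_cong[OF o, rotated])
       (auto simp: c d inv_into_f_f[OF inj[OF c(1)]] inv_into_f_f[OF inj_on_subset[OF inj[OF c(1)]]])
qed

lemma dmap_restrict_chart:
  assumes "inj_on (snd c) (fst c)" "open (cimage (restrict_chart c W))" "p \<in> fst c" "p \<in> W"
  shows "dmap (restrict_chart c W) f p = dmap c f p"
proof -
  have "fd (f \<circ> cinv (restrict_chart c W)) (snd c p) = fd (f \<circ> cinv c) (snd c p)"
    using assms by (intro frechet_derivative_cong_open[OF assms(2)])
      (auto simp: inv_into_f_f[OF assms(1)] inv_into_f_f[OF inj_on_subset[OF assms(1)]])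
  then show ?thesis by (simp add: dmap_def fun_eq_iff)
qed

lemma smooth_map_restrict_manifold:
  assumes "smooth_map M f" "atlas (charts M)" "\<And>c. c \<in> charts M \<Longrightarrow> open (cimage (restrict_chart c W))"
  shows "smooth_map (restrict_manifold M W) f"
  unfolding smooth_map_def
proof
  fix c' assume "c' \<in> charts (restrict_manifold M W)"
  then obtain c where c: "c \<in> charts M" "c' = restrict_chart c W" by (auto simp: charts_restrict_manifold)
  have inj: "inj_on (snd c) (fst c)" using assms(2) c(1) by (simp add: atlas_def)
  have "smooth_on (cimage c) (f \<circ> cinv c)" using assms(1) c(1) by (simp add: smooth_map_def)
  then have "smooth_on (cimage c') (f \<circ> cinv c)" by (rule smooth_on_subset) (auto simp: c)
  then show "smooth_on (cimage c') (f \<circ> cinv c')"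
    using assms(3)[OF c(1)] unfolding c(2)
    by (rule smooth_on_cong[rotated 2]) (auto simp: inv_into_f_f[OF inj] inv_into_f_f[OF inj_on_subset[OF inj]])
qed

lemma finite_span_times_real:
  fixes B :: "'d::real_vector set"
  assumes "finite B" "span B = UNIV"
  obtains B' :: "('d \<times> real) set" where "finite B'" "span B' = UNIV"
proof
  let ?B' = "(\<lambda>b. (b, 0::real)) ` B \<union> {(0, 1)}"
  show "finite ?B'" using assms(1) by simp
  have "(v, t) \<in> span ?B'" for v :: 'd and t
  proof -
    have "linear (\<lambda>b::'d. (b, 0::real))" by (auto intro!: linearI)
    from span_linear_image[OF this, of B]
    have "(v, 0) \<in> span ((\<lambda>b. (b, 0::real)) ` B)"
      unfolding assms(2) by simp
    then have "(v, 0) \<in> span ?B'" by (rule rev_subsetD) (rule span_mono, auto)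
    moreover have "t *\<^sub>R (0, 1) \<in> span ?B'" by (intro span_scale span_base) auto
    ultimately have "(v, 0) + t *\<^sub>R (0, 1) \<in> span ?B'" by (rule span_add)
    then show ?thesis by simp
  qed
  then show "span ?B' = UNIV" by auto
qed

section \<open>Differentiating constant relations; tangent vectors as ranges of the
  differential\<close>

lemma dmap_bilinear_const:
  assumes C: "atlas (charts M)" "c \<in> charts M" "p \<in> fst c" and f: "smooth_map M f" "smooth_map M h"
    and B: "bounded_bilinear B" "\<And>q. q \<in> fst c \<Longrightarrow> B (f q) (h q) = r"
  shows "B (f p) (dmap c h p v) + B (dmap c f p v) (h p) = 0"
proof -
  have o: "open (cimage c)" using C by (simp add: atlas_open_image)
  have "((\<lambda>y. B ((f \<circ> cinv c) y) ((h \<circ> cinv c) y)) has_derivative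
    (\<lambda>v. B ((f \<circ> cinv c) (snd c p)) (dmap c h p v) + B (dmap c f p v) ((h \<circ> cinv c) (snd c p)))) (at (snd c p))"
    using f C(2,3) by (intro bounded_bilinear.FDERIV[OF B(1)] has_derivative_dmap) (simp_all add: smooth_map_def)
  moreover have "((\<lambda>y. B ((f \<circ> cinv c) y) ((h \<circ> cinv c) y)) has_derivative (\<lambda>v. 0)) (at (snd c p))"
    by (rule has_derivative_transform_within_open[OF has_derivative_const[of r] o])
      (use C(3) B(2) in \<open>auto simp: atlas_cinv[OF C(1,2)]\<close>)
  ultimately have "(\<lambda>v. B ((f \<circ> cinv c) (snd c p)) (dmap c h p v) + B (dmap c f p v) ((h \<circ> cinv c) (snd c p))) = (\<lambda>v. 0)"
    by (rule has_derivative_unique)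
  from fun_cong[OF this, of v] show ?thesis using atlas_cinv[OF C] by simp
qed

lemma dmap_bounded_linear:
  assumes C: "atlas (charts M)" "c \<in> charts M" "p \<in> fst c" and f: "smooth_map M f" and L: "bounded_linear L"
  shows "dmap c (\<lambda>q. L (f q)) p v = L (dmap c f p v)"
proof -
  have "((\<lambda>y. L ((f \<circ> cinv c) y)) has_derivative (\<lambda>v. L (dmap c f p v))) (at (snd c p))"
    using f C(2,3) by (intro bounded_linear.has_derivative[OF L] has_derivative_dmap) (simp_all add: smooth_map_def)
  then have "dmap c (\<lambda>q. L (f q)) p = (\<lambda>v. L (dmap c f p v))"
    using C by (intro dmap_eqI[OF atlas_open_image[OF C(1,2)]]) auto
  then show ?thesis by simp
qed

lemma dmap_linear_const:
  assumes C: "atlas (charts M)" "c \<in> charts M" "p \<in> fst c" and f: "smooth_map M f" and L: "bounded_linear L"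
    and "\<And>q. q \<in> fst c \<Longrightarrow> L (f q) = r"
  shows "L (dmap c f p v) = 0"
proof -
  have "dmap c (\<lambda>q. L (f q)) p = (\<lambda>v. 0)"
    by (rule dmap_eqI[OF atlas_open_image[OF C(1,2)], where F = "\<lambda>_. r"])
      (use C(3) assms(6) in \<open>auto simp: atlas_cinv[OF C(1,2)]\<close>)
  then show ?thesis using dmap_bounded_linear[OF C f L, of v] by simp
qed

lemma linear_dmap:
  assumes "c \<in> charts M" "p \<in> fst c" "smooth_map M f"
  shows "linear (dmap c f p)"
  using has_derivative_dmap[of c f p] assms has_derivative_linear by (auto simp: smooth_map_def)

text \<open>Subtracting from w its projection to the range of the differential leaves a normal
  vector. It is orthogonal to w by hypothesis and to the projection by construction, hence to
  itself.\<close>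

lemma mem_range_dmap:
  fixes f :: "'p \<Rightarrow> 'w::euclidean_space"
  assumes C: "atlas (charts M)" "c \<in> charts M" "p \<in> fst c" and f: "smooth_map M f"
    and A: "inner_form_on (form A) (tspace A (f p))"
    and tangent: "\<And>u. dmap c f p u \<in> tspace A (f p)" and w: "w \<in> tspace A (f p)"
    and orth: "\<And>\<nu>. \<nu> \<in> normal_space A M f p \<Longrightarrow> form A w \<nu> = 0"
  shows "w \<in> range (dmap c f p)"
proof -
  let ?V = "range (dmap c f p)"
  have B: "bilinear (form A)" "\<And>x y. form A x y = form A y x" "subspace (tspace A (f p))"
    "\<And>v. v \<in> tspace A (f p) \<Longrightarrow> v \<noteq> 0 \<Longrightarrow> form A v v > 0"
    using A by (auto simp: inner_form_on_def)
  have V: "inner_form_on (form A) ?V"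
  proof (rule inner_form_on_subset[OF A])
    show "subspace ?V" using linear_dmap[OF C(2,3) f] by (intro linear_subspace_image subspace_UNIV)
    show "?V \<subseteq> tspace A (f p)" using tangent by (rule image_subsetI)
  qed
  define w' where "w' = w - orth_proj (form A) ?V w"
  have P: "orth_proj (form A) ?V w \<in> ?V" by (rule orth_proj_mem(1)[OF V])
  have w't: "w' \<in> tspace A (f p)" unfolding w'_def using tangent P by (intro subspace_diff[OF B(3) w]) auto
  have w'V: "form A w' u = 0" if "u \<in> ?V" for u unfolding w'_def using orth_proj_mem(2)[OF V that] .
  then have "w' \<in> normal_space A M f p"
    unfolding normal_space_chart[OF C f] using w't by simp
  then have "form A w w' = 0" by (rule orth)
  moreover have "form A (orth_proj (form A) ?V w) w' = 0" using w'V[OF P] B(2) by simp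
  moreover have "form A w' w' = form A w w' - form A (orth_proj (form A) ?V w) w'"
    unfolding w'_def by (rule bilinear_lsub[OF B(1)])
  ultimately have "w' = 0" using B(4)[OF w't] by fastforce
  then show ?thesis using P by (simp add: w'_def)
qed

section \<open>The construction\<close>

lemma sum_frame_field:
  "(\<Sum>i=0..k+1. u i *\<^sub>R frame_field k g \<xi> i x) = (u 0 *\<^sub>R g x + (\<Sum>i=1..k. u i *\<^sub>R \<xi> i x), u (k+1))"
proof -
  have "(\<Sum>i=0..k+1. u i *\<^sub>R frame_field k g \<xi> i x) =
    u 0 *\<^sub>R frame_field k g \<xi> 0 x + (\<Sum>i=1..k. u i *\<^sub>R frame_field k g \<xi> i x) + u (k+1) *\<^sub>R frame_field k g \<xi> (k+1) x"
    by (simp add: sum.atLeast_Suc_atMost[of 0])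
  also have "(\<Sum>i=1..k. u i *\<^sub>R frame_field k g \<xi> i x) = (\<Sum>i=1..k. (u i *\<^sub>R \<xi> i x, 0))"
    by (rule sum.cong) (auto simp: frame_field_def)
  also have "\<dots> = ((\<Sum>i=1..k. u i *\<^sub>R \<xi> i x), 0)" by (simp add: sum_prod)
  finally show ?thesis by (simp add: frame_field_def dt_def)
qed

locale immersion_construction =
  fixes \<epsilon> :: real and N :: "('q, 'd::real_normed_vector) manifold" and hN :: "('q, 'd) metric"
    and I :: "real set" and k :: nat and g :: "'q \<Rightarrow> real \<times> 'v::euclidean_space"
    and \<xi> :: "nat \<Rightarrow> 'q \<Rightarrow> real \<times> 'v" and \<alpha> :: "real \<Rightarrow> nat \<Rightarrow> real"
  assumes eps: "\<epsilon> \<in> {-1, 0, 1}"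
    and data: "construction_data \<epsilon> N hN I k g \<xi> \<alpha>"
    and geodesic: "geodesic_on (coord_cylinder \<epsilon> k) I \<alpha>"
begin

abbreviation "ip \<equiv> form (space_form \<epsilon> :: (real \<times> 'v) ambient)"
abbreviation "tsp x \<equiv> tspace (space_form \<epsilon>) (g x)"

definition a :: "nat \<Rightarrow> real \<Rightarrow> real" where "a i s = (if \<epsilon> = 0 \<and> i = 0 then 1 else \<alpha> s i)"

definition lin_comb :: "(nat \<Rightarrow> real) \<Rightarrow> 'q \<Rightarrow> real \<times> 'v" where
  "lin_comb u x = u 0 *\<^sub>R g x + (\<Sum>i=1..k. u i *\<^sub>R \<xi> i x)"

lemma N: "is_manifold N" and I: "open I" "is_interval I" "I \<noteq> {}"
  and immersion_g: "immersion (space_form \<epsilon>) N g"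
  and normal_\<xi>: "i \<in> {1..k} \<Longrightarrow> parallel_normal_field (space_form \<epsilon>) N g (\<xi> i)"
  and orthonormal_\<xi>: "x \<in> topspace (topo N) \<Longrightarrow> i \<in> {1..k} \<Longrightarrow> j \<in> {1..k} \<Longrightarrow> ip (\<xi> i x) (\<xi> j x) = (if i = j then 1 else 0)"
  and smooth_\<alpha>: "smooth_on I (\<lambda>s. \<alpha> s i)"
  and \<alpha>_points: "s \<in> I \<Longrightarrow> \<alpha> s \<in> points (coord_cylinder \<epsilon> k)"
  and \<alpha>_last: "s \<in> I \<Longrightarrow> deriv (\<lambda>r. \<alpha> r (k+1)) s \<noteq> 0"
  using data by (auto simp: construction_data_def isometric_immersion_def)

lemma smooth_g: "smooth_map N g" and g_points: "x \<in> topspace (topo N) \<Longrightarrow> g x \<in> points (space_form \<epsilon>)"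
  and smooth_\<xi>: "i \<in> {1..k} \<Longrightarrow> smooth_map N (\<xi> i)"
  using immersion_g normal_\<xi> by (auto simp: immersion_def parallel_normal_field_def normal_field_def)

lemma atlas_N: "atlas (charts N)" using N by (rule manifold_atlas)

lemma chart_topspace: "c \<in> charts N \<Longrightarrow> x \<in> fst c \<Longrightarrow> x \<in> topspace (topo N)"
  using N by (auto simp: is_manifold_def)

lemma bil: "bounded_bilinear ip" by (rule bounded_bilinear_space_form)

lemma smooth_a: "smooth_on I (a i)"
  unfolding a_def[abs_def] using smooth_\<alpha>[of i] smooth_on_const[of I 1] by (cases "\<epsilon> = 0 \<and> i = 0") auto

lemma deriv_a: "s \<in> I \<Longrightarrow> (a i has_real_derivative deriv (a i) s) (at s)"
  by (rule smooth_on_real_deriv[OF I(1) smooth_a])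

lemma smooth_deriv_a: "smooth_on I (deriv (a i))"
  by (rule smooth_on_deriv[OF I(1) smooth_a])

lemma deriv_deriv_a: "s \<in> I \<Longrightarrow> (deriv (a i) has_real_derivative deriv (deriv (a i)) s) (at s)"
  by (rule smooth_on_real_deriv[OF I(1) smooth_deriv_a])

lemma a_eq: "\<not> (\<epsilon> = 0 \<and> i = 0) \<Longrightarrow> a i = (\<lambda>s. \<alpha> s i)"
  by (auto simp: a_def)

lemma deriv_a_0: "\<epsilon> = 0 \<Longrightarrow> deriv (a 0) s = 0" "\<epsilon> = 0 \<Longrightarrow> deriv (deriv (a 0)) s = 0"
proof -
  assume "\<epsilon> = 0"
  then have "a 0 = (\<lambda>_. 1)" unfolding a_def[abs_def] by simp
  then have "deriv (a 0) = (\<lambda>_. 0)" by auto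
  then show "deriv (a 0) s = 0" "deriv (deriv (a 0)) s = 0" by simp_all
qed

lemma a_norm: "s \<in> I \<Longrightarrow> \<epsilon> \<noteq> 0 \<Longrightarrow> \<epsilon> * a 0 s * a 0 s + (\<Sum>i=1..k. a i s * a i s) = \<epsilon>"
  using \<alpha>_points[of s] by (simp add: points_coord_cylinder a_eq)

lemma a_deriv_orth:
  assumes "s \<in> I"
  shows "\<epsilon> * a 0 s * deriv (a 0) s + (\<Sum>i=1..k. a i s * deriv (a i) s) = 0 \<or> \<epsilon> = 0"
proof (rule disjCI)
  assume e: "\<epsilon> \<noteq> 0"
  let ?f = "\<lambda>s. \<epsilon> * (a 0 s * a 0 s) + (\<Sum>i=1..k. a i s * a i s)"
  have "(?f has_real_derivative \<epsilon> * (deriv (a 0) s * a 0 s + deriv (a 0) s * a 0 s) +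
      (\<Sum>i=1..k. deriv (a i) s * a i s + deriv (a i) s * a i s)) (at s)"
    using deriv_a[OF assms] by (intro DERIV_add DERIV_cmult DERIV_mult DERIV_sum)
  moreover have "(?f has_real_derivative 0) (at s)"
    by (rule has_field_derivative_transform_within_open[OF DERIV_const[of \<epsilon>] I(1) assms])
       (use a_norm e in \<open>simp add: mult.assoc\<close>)
  ultimately have "\<epsilon> * (deriv (a 0) s * a 0 s + deriv (a 0) s * a 0 s) +
      (\<Sum>i=1..k. deriv (a i) s * a i s + deriv (a i) s * a i s) = 0"
    by (rule DERIV_unique)
  moreover have "(\<Sum>i=1..k. deriv (a i) s * a i s + deriv (a i) s * a i s) = 2 * (\<Sum>i=1..k. a i s * deriv (a i) s)"
    unfolding sum_distrib_left by (rule sum.cong) auto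
  ultimately show "\<epsilon> * a 0 s * deriv (a 0) s + (\<Sum>i=1..k. a i s * deriv (a i) s) = 0"
    by (simp add: algebra_simps)
qed

lemma geodesic_equation:
  assumes "s \<in> I"
  obtains l where "\<epsilon> = 0 \<Longrightarrow> l = 0" "\<And>i. i \<le> k \<Longrightarrow> deriv (deriv (a i)) s = l * a i s"
    "deriv (deriv (a (k+1))) s = 0"
proof -
  have "orth_proj (form (coord_cylinder \<epsilon> k)) (tspace (coord_cylinder \<epsilon> k) (\<alpha> s)) (\<lambda>i. deriv (deriv (\<lambda>r. \<alpha> r i)) s) = (\<lambda>_. 0)"
    using geodesic assms by (simp add: geodesic_on_def)
  from coord_orth_proj_eq_0D[OF eps \<alpha>_points[OF assms] this] obtain l where
    l: "\<epsilon> = 0 \<Longrightarrow> l = 0" "\<And>i. i \<le> k \<Longrightarrow> i \<noteq> 0 \<or> \<epsilon> \<noteq> 0 \<Longrightarrow> deriv (deriv (\<lambda>r. \<alpha> r i)) s = l * \<alpha> s i"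
      "deriv (deriv (\<lambda>r. \<alpha> r (k+1))) s = 0" by blast
  show thesis
  proof (rule that[of l])
    \<comment> \<open>In the flat case \<open>a 0\<close> is constantly 1 rather than a component of
      the curve, but then l = 0 and both sides vanish.\<close>
    show "deriv (deriv (a i)) s = l * a i s" if "i \<le> k" for i
      using l(2)[OF that] l(1) deriv_a_0(2)[of s] by (cases "\<epsilon> = 0 \<and> i = 0") (auto simp: a_eq)
  qed (use l in \<open>simp_all add: a_eq\<close>)
qed

text \<open>The squared speed of the curve in the cylinder. Having \<open>a 0\<close> in place of
  the component 0 is harmless, as that term carries the factor \<epsilon>.\<close>

definition speed2 :: "real \<Rightarrow> real" where
  "speed2 s = \<epsilon> * deriv (a 0) s * deriv (a 0) s + (\<Sum>i=1..k. deriv (a i) s * deriv (a i) s)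
     + deriv (a (k+1)) s * deriv (a (k+1)) s"

lemma speed_pos:
  assumes "s \<in> I"
  shows "speed2 s > 0"
proof -
  \<comment> \<open>Cut off beyond k + 1, as membership in \<open>tspace\<close> demands.\<close>
  let ?d = "\<lambda>i. if i \<le> k + 1 then deriv (a i) s else 0"
  have "?d \<in> tspace (coord_cylinder \<epsilon> k) (\<alpha> s)"
    using a_deriv_orth[OF assms] deriv_a_0[of s] by (auto simp: tspace_coord_cylinder a_eq)
  from coord_form_nonneg(1)[OF eps \<alpha>_points[OF assms] this]
  have "0 \<le> \<epsilon> * deriv (a 0) s * deriv (a 0) s + (\<Sum>i=1..k. deriv (a i) s * deriv (a i) s)" by simp
  moreover have "deriv (a (k+1)) s * deriv (a (k+1)) s > 0"
    using \<alpha>_last[OF assms] by (simp add: a_eq flip: power2_eq_square)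
  ultimately show ?thesis unfolding speed2_def by linarith
qed

lemma constant_on_I:
  assumes "\<And>s. s \<in> I \<Longrightarrow> (f has_real_derivative 0) (at s)"
  obtains c where "\<And>s. s \<in> I \<Longrightarrow> f s = c"
proof -
  have "convex I" using I(2) by (simp add: is_interval_convex)
  moreover have "(f has_real_derivative 0) (at s within I)" if "s \<in> I" for s
    using assms[OF that] by (rule has_field_derivative_at_within)
  ultimately show thesis
    using has_field_derivative_zero_constant[of I f] that by blast
qed

text \<open>The acceleration is a multiple of the horizontal position vector, which is orthogonal to
  the velocity and has no vertical part. So the speed and the vertical velocity are both constant,
  and \<kappa> is the quotient of the latter by the squared speed: the coefficient that makes
  \<partial>/\<partial>t - \<kappa> f_* \<partial>/\<partial>s normal.\<close>

lemma constant_ratio: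
  obtains \<kappa> where "\<And>s. s \<in> I \<Longrightarrow> \<kappa> * speed2 s = deriv (a (k+1)) s"
proof -
  have "(speed2 has_real_derivative 0) (at s)" if s: "s \<in> I" for s
  proof -
    let ?b = "\<lambda>i. deriv (a i)"
    obtain l where l: "\<epsilon> = 0 \<Longrightarrow> l = 0" "\<And>i. i \<le> k \<Longrightarrow> deriv (?b i) s = l * a i s" "deriv (?b (k+1)) s = 0"
      using geodesic_equation[OF s] by blast
    have "((\<lambda>s. \<epsilon> * (?b 0 s * ?b 0 s) + (\<Sum>i=1..k. ?b i s * ?b i s) + ?b (k+1) s * ?b (k+1) s) has_real_derivative
      \<epsilon> * (deriv (?b 0) s * ?b 0 s + deriv (?b 0) s * ?b 0 s) +
      (\<Sum>i=1..k. deriv (?b i) s * ?b i s + deriv (?b i) s * ?b i s) +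
      (deriv (?b (k+1)) s * ?b (k+1) s + deriv (?b (k+1)) s * ?b (k+1) s)) (at s)"
      using deriv_deriv_a[OF s] by (intro DERIV_add DERIV_cmult DERIV_mult DERIV_sum)
    moreover have "\<epsilon> * (deriv (?b 0) s * ?b 0 s + deriv (?b 0) s * ?b 0 s) +
      (\<Sum>i=1..k. deriv (?b i) s * ?b i s + deriv (?b i) s * ?b i s) +
      (deriv (?b (k+1)) s * ?b (k+1) s + deriv (?b (k+1)) s * ?b (k+1) s) =
      2 * l * (\<epsilon> * a 0 s * ?b 0 s + (\<Sum>i=1..k. a i s * ?b i s))"
    proof -
      have "(\<Sum>i=1..k. deriv (?b i) s * ?b i s + deriv (?b i) s * ?b i s) = (\<Sum>i=1..k. 2 * l * (a i s * ?b i s))"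
        by (rule sum.cong) (auto simp: l(2))
      then show ?thesis by (simp add: l(2)[of 0] l(3)[simplified] sum_distrib_left algebra_simps)
    qed
    moreover have "2 * l * (\<epsilon> * a 0 s * ?b 0 s + (\<Sum>i=1..k. a i s * ?b i s)) = 0"
      using a_deriv_orth[OF s] l(1) by auto
    ultimately show ?thesis unfolding speed2_def[abs_def] by (simp only: mult.assoc)
  qed
  then obtain q where q: "\<And>s. s \<in> I \<Longrightarrow> speed2 s = q" using constant_on_I[of speed2] by blast
  have "(deriv (a (k+1)) has_real_derivative 0) (at s)" if "s \<in> I" for s
    using deriv_deriv_a[OF that, of "k+1"] geodesic_equation[OF that] by metis
  then obtain b where b: "\<And>s. s \<in> I \<Longrightarrow> deriv (a (k+1)) s = b" using constant_on_I[of "deriv (a (k+1))"] by blast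
  obtain s0 where "s0 \<in> I" using I(3) by blast
  then have "q \<noteq> 0" using speed_pos[of s0] q[of s0] by simp
  then show thesis using q b by (intro that[of "b / q"]) simp
qed

section \<open>Linear combinations of the frame and their differentials\<close>

lemma construction_eq: "construction \<epsilon> k g \<xi> \<alpha> (x, s) = (lin_comb (\<lambda>i. a i s) x, a (k+1) s)"
  unfolding construction_def case_prod_conv a_def[symmetric] lin_comb_def by (rule sum_frame_field)

lemma lin_comb_smooth: "smooth_map N (lin_comb u)"
  unfolding smooth_map_def
proof
  fix c assume c: "c \<in> charts N"
  have "smooth_on (cimage c) (\<lambda>y. u 0 *\<^sub>R (g \<circ> cinv c) y + (\<Sum>i=1..k. u i *\<^sub>R (\<xi> i \<circ> cinv c) y))"
    using smooth_g smooth_\<xi> c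
    by (intro smooth_on_add smooth_on_sum smooth_on_scaleR smooth_on_const atlas_open_image[OF atlas_N c])
      (simp_all only: smooth_map_def)
  then show "smooth_on (cimage c) (lin_comb u \<circ> cinv c)" by (simp add: lin_comb_def[abs_def] comp_def)
qed

lemma lin_comb_dmap:
  assumes "c \<in> charts N" "x \<in> fst c"
  shows "dmap c (lin_comb u) x v = u 0 *\<^sub>R dmap c g x v + (\<Sum>i=1..k. u i *\<^sub>R dmap c (\<xi> i) x v)"
proof -
  have "((\<lambda>y. u 0 *\<^sub>R (g \<circ> cinv c) y + (\<Sum>i=1..k. u i *\<^sub>R (\<xi> i \<circ> cinv c) y)) has_derivative
    (\<lambda>v. u 0 *\<^sub>R dmap c g x v + (\<Sum>i=1..k. u i *\<^sub>R dmap c (\<xi> i) x v))) (at (snd c x))"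
    using smooth_g smooth_\<xi> assms
    by (intro has_derivative_add has_derivative_sum has_derivative_scaleR_right has_derivative_dmap)
      (auto simp: smooth_map_def)
  then have "dmap c (lin_comb u) x = (\<lambda>v. u 0 *\<^sub>R dmap c g x v + (\<Sum>i=1..k. u i *\<^sub>R dmap c (\<xi> i) x v))"
    using assms by (intro dmap_eqI[OF atlas_open_image[OF atlas_N assms(1)]]) (auto simp: lin_comb_def)
  then show ?thesis by simp
qed

lemma tangent_\<xi>:
  assumes "x \<in> topspace (topo N)" "i \<in> {1..k}"
  shows "\<xi> i x \<in> normal_space (space_form \<epsilon>) N g x" "\<xi> i x \<in> tsp x"
  using normal_\<xi>[OF assms(2)] assms(1)
  by (auto simp: parallel_normal_field_def normal_field_def normal_space_def)

lemma ip_g: "x \<in> topspace (topo N) \<Longrightarrow> \<epsilon> \<noteq> 0 \<Longrightarrow> ip (g x) (g x) = \<epsilon>"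
  "x \<in> topspace (topo N) \<Longrightarrow> \<epsilon> \<noteq> 0 \<Longrightarrow> i \<in> {1..k} \<Longrightarrow> ip (g x) (\<xi> i x) = 0"
  using g_points tangent_\<xi>(2) by (auto simp: points_space_form tspace_space_form split: if_splits)

text \<open>The fields \<open>\<xi> i\<close> are orthonormal and, for \<epsilon> \<noteq> 0,
  orthogonal to g, whose square is \<epsilon>. In the flat case g is an arbitrary position vector
  and must not occur.\<close>

lemma ip_lin_comb:
  assumes x: "x \<in> topspace (topo N)" and "\<epsilon> \<noteq> 0 \<or> u 0 = 0 \<and> v 0 = 0"
  shows "ip (lin_comb u x) (lin_comb v x) = \<epsilon> * u 0 * v 0 + (\<Sum>i=1..k. u i * v i)"
proof -
  have "ip (\<Sum>i=1..k. u i *\<^sub>R \<xi> i x) (\<Sum>i=1..k. v i *\<^sub>R \<xi> i x) = (\<Sum>i=1..k. u i * (\<Sum>j=1..k. v j * ip (\<xi> i x) (\<xi> j x)))"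
    by (simp only: bounded_bilinear.sum_left[OF bil] bounded_bilinear.scaleR_left[OF bil])
      (simp only: bounded_bilinear.sum_right[OF bil] bounded_bilinear.scaleR_right[OF bil] real_scaleR_def)
  also have "\<dots> = (\<Sum>i=1..k. u i * (\<Sum>j=1..k. v j * (if i = j then 1 else 0)))"
    by (intro sum.cong refl arg_cong2[where f = "(*)"]) (simp add: orthonormal_\<xi>[OF x])
  also have "\<dots> = (\<Sum>i=1..k. u i * v i)" by (rule sum.cong) (auto simp: if_distrib cong: if_cong)
  finally have 1: "ip (\<Sum>i=1..k. u i *\<^sub>R \<xi> i x) (\<Sum>i=1..k. v i *\<^sub>R \<xi> i x) = (\<Sum>i=1..k. u i * v i)" .
  show ?thesis
  proof (cases "\<epsilon> = 0")
    case True
    then show ?thesis using 1 assms(2) by (simp add: lin_comb_def)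
  next
    case False
    have "ip (g x) (\<Sum>i=1..k. t i *\<^sub>R \<xi> i x) = 0" for t
      unfolding space_form_simps by (rule sum.neutral) (simp add: ip_g(2)[OF x False])
    moreover from this have "ip (\<Sum>i=1..k. t i *\<^sub>R \<xi> i x) (g x) = 0" for t
      by (subst form_space_form_commute)
    ultimately show ?thesis
      using 1 ip_g(1)[OF x False] unfolding lin_comb_def
      by (simp only: bounded_bilinear.add_left[OF bil] bounded_bilinear.add_right[OF bil]
          bounded_bilinear.scaleR_left[OF bil] bounded_bilinear.scaleR_right[OF bil]) simp
  qed
qed

lemma fst_flat: "\<epsilon> = 0 \<Longrightarrow> x \<in> topspace (topo N) \<Longrightarrow> fst (g x) = 0"
  "\<epsilon> = 0 \<Longrightarrow> x \<in> topspace (topo N) \<Longrightarrow> i \<in> {1..k} \<Longrightarrow> fst (\<xi> i x) = 0"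
  using g_points tangent_\<xi>(2) by (auto simp: points_space_form tspace_space_form split: if_splits)

lemma fst_lin_comb_flat: "\<epsilon> = 0 \<Longrightarrow> x \<in> topspace (topo N) \<Longrightarrow> fst (lin_comb u x) = 0"
  by (simp add: lin_comb_def fst_sum fst_flat)

lemma inner_form_tsp: "x \<in> topspace (topo N) \<Longrightarrow> inner_form_on ip (tsp x)"
  using inner_form_on_space_form[OF eps g_points] .

lemma tangent_dmap_g:
  assumes c: "c \<in> charts N" "x \<in> fst c"
  shows "dmap c g x v \<in> tsp x"
proof (cases "\<epsilon> = 0")
  case True
  then have "fst (dmap c g x v) = 0"
    using fst_flat(1)[OF True chart_topspace[OF c(1)]]
    by (intro dmap_linear_const[OF atlas_N c smooth_g bounded_linear_fst])
  then show ?thesis using True by (simp add: tspace_space_form)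
next
  case False
  have "ip (g x) (dmap c g x v) + ip (dmap c g x v) (g x) = 0"
    using ip_g(1)[OF chart_topspace[OF c(1)] False]
    by (intro dmap_bilinear_const[OF atlas_N c smooth_g smooth_g bil])
  then show ?thesis using False form_space_form_commute[of \<epsilon> "dmap c g x v" "g x"] by (simp add: tspace_space_form)
qed

text \<open>For \<epsilon> \<noteq> 0, differentiate the orthogonality of g and
  \<open>\<xi> i\<close>; the term with the derivative of g vanishes because \<open>\<xi> i\<close>
  is normal.\<close>

lemma tangent_dmap_\<xi>:
  assumes c: "c \<in> charts N" "x \<in> fst c" and i: "i \<in> {1..k}"
  shows "dmap c (\<xi> i) x v \<in> tsp x"
proof (cases "\<epsilon> = 0")
  case True
  then have "fst (dmap c (\<xi> i) x v) = 0"
    using fst_flat(2)[OF True chart_topspace[OF c(1)] i]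
    by (intro dmap_linear_const[OF atlas_N c smooth_\<xi>[OF i] bounded_linear_fst])
  then show ?thesis using True by (simp add: tspace_space_form)
next
  case False
  have "ip (g x) (dmap c (\<xi> i) x v) + ip (dmap c g x v) (\<xi> i x) = 0"
    using ip_g(2)[OF chart_topspace[OF c(1)] False i]
    by (intro dmap_bilinear_const[OF atlas_N c smooth_g smooth_\<xi>[OF i] bil])
  moreover have "ip (\<xi> i x) (dmap c g x v) = 0"
    using tangent_\<xi>(1)[OF chart_topspace[OF c] i] c by (auto simp: normal_space_def)
  ultimately show ?thesis
    using False form_space_form_commute[of \<epsilon> "dmap c g x v" "\<xi> i x"] by (simp add: tspace_space_form)
qed

text \<open>Being parallel, \<open>\<xi> i\<close> has a derivative without normal component, which
  \<open>mem_range_dmap\<close> converts into tangency to g.\<close>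

lemma weingarten:
  assumes c: "c \<in> charts N" "x \<in> fst c" and i: "i \<in> {1..k}"
  shows "dmap c (\<xi> i) x v \<in> range (dmap c g x)"
proof (rule mem_range_dmap[OF atlas_N c smooth_g inner_form_tsp[OF chart_topspace[OF c]]])
  fix \<nu> assume \<nu>: "\<nu> \<in> normal_space (space_form \<epsilon>) N g x"
  have "normal_connection (space_form \<epsilon>) N c g (\<xi> i) x v = 0"
    using normal_\<xi>[OF i] c by (simp add: parallel_normal_field_def)
  then show "ip (dmap c (\<xi> i) x v) \<nu> = 0"
    using \<nu> normal_connection_eq_0_iff[where f = g and p = x, OF inner_form_tsp[OF chart_topspace[OF c]], of N c "\<xi> i" v] by simp
qed (use tangent_dmap_g[OF c] tangent_dmap_\<xi>[OF c i] in auto)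

lemma dmap_lin_comb_range:
  assumes c: "c \<in> charts N" "x \<in> fst c"
  shows "dmap c (lin_comb u) x v \<in> range (dmap c g x)"
proof -
  have "subspace (range (dmap c g x))"
    using linear_dmap[OF c smooth_g] by (intro linear_subspace_image subspace_UNIV)
  then show ?thesis
    unfolding lin_comb_dmap[OF c] using weingarten[OF c]
    by (intro subspace_add subspace_scale subspace_sum) auto
qed

lemma ip_range_lin_comb:
  assumes c: "c \<in> charts N" "x \<in> fst c" and w: "w \<in> range (dmap c g x)" and "\<epsilon> \<noteq> 0 \<or> u 0 = 0"
  shows "ip w (lin_comb u x) = 0"
proof -
  obtain v where v: "w = dmap c g x v" using w by blast
  have "ip (\<xi> i x) w = 0" if "i \<in> {1..k}" for i
    using tangent_\<xi>(1)[OF chart_topspace[OF c] that] c by (auto simp: normal_space_def v)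
  then have "ip w (\<xi> i x) = 0" if "i \<in> {1..k}" for i using that by (subst form_space_form_commute)
  then have "ip w (\<Sum>i=1..k. u i *\<^sub>R \<xi> i x) = 0"
    unfolding space_form_simps by (intro sum.neutral) simp
  moreover have "\<epsilon> \<noteq> 0 \<Longrightarrow> ip w (g x) = 0"
    using tangent_dmap_g[OF c, of v] form_space_form_commute[of \<epsilon> w "g x"] by (auto simp: tspace_space_form v)
  ultimately show ?thesis using assms(4) by (auto simp: lin_comb_def space_form_simps)
qed

text \<open>One format for the construction, its velocity along the curve and the field \<eta>, so
  that smoothness and differentials are computed once for all three.\<close>

definition comb_curve :: "(nat \<Rightarrow> real \<Rightarrow> real) \<Rightarrow> 'q \<times> real \<Rightarrow> (real \<times> 'v) \<times> real" where
  "comb_curve u = (\<lambda>(x, s). (lin_comb (\<lambda>i. u i s) x, u (k+1) s))"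

lemma construction_comb_curve: "construction \<epsilon> k g \<xi> \<alpha> = comb_curve a"
  by (auto simp: fun_eq_iff construction_eq comb_curve_def)

lemma chart_N: "c \<in> charts N \<Longrightarrow> inj_on (snd c) (fst c)"
  using atlas_N by (simp add: atlas_def)

lemma comb_curve_chart:
  assumes c: "c \<in> charts N" and z: "z \<in> cimage c \<times> I"
  shows "comb_curve u (cinv (times_chart c I) z) =
    (u 0 (snd z) *\<^sub>R (g \<circ> cinv c) (fst z) + (\<Sum>i=1..k. u i (snd z) *\<^sub>R (\<xi> i \<circ> cinv c) (fst z)), u (k+1) (snd z))"
  using cinv_times_chart[OF chart_N[OF c], of "fst z" "snd z" I] z by (auto simp: comb_curve_def lin_comb_def)

lemma open_times_chart: "c \<in> charts N \<Longrightarrow> open (cimage c \<times> I)"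
  using atlas_open_image[OF atlas_N] I(1) by (simp add: open_Times)

lemma smooth_comb_curve:
  assumes u: "\<And>i. smooth_on I (u i)"
  shows "smooth_map (times_interval N I) (comb_curve u)"
  unfolding smooth_map_def
proof
  fix c' assume "c' \<in> charts (times_interval N I)"
  then obtain c where c: "c \<in> charts N" "c' = times_chart c I" by (auto simp: charts_times_interval)
  have o: "open (cimage c \<times> I)" by (rule open_times_chart[OF c(1)])
  have U: "smooth_on (cimage c \<times> I) (\<lambda>z. u i (snd z))" for i
    using smooth_on_compose_affine[OF o I(1) bounded_linear_snd, of 0 "u i"] u by auto
  have G: "smooth_on (cimage c \<times> I) (\<lambda>z. (f \<circ> cinv c) (fst z))" if "smooth_map N f" for f :: "'q \<Rightarrow> real \<times> 'v"
    using smooth_on_compose_affine[OF o atlas_open_image[OF atlas_N c(1)] bounded_linear_fst, of 0 "f \<circ> cinv c"] that c(1)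
    by (auto simp: smooth_map_def)
  have "smooth_on (cimage c \<times> I) (\<lambda>z. (u 0 (snd z) *\<^sub>R (g \<circ> cinv c) (fst z) +
    (\<Sum>i=1..k. u i (snd z) *\<^sub>R (\<xi> i \<circ> cinv c) (fst z)), u (k+1) (snd z)))"
    by (intro smooth_on_Pair smooth_on_add smooth_on_sum smooth_on_scaleR o U G smooth_g smooth_\<xi>)
  then show "smooth_on (cimage c') (comb_curve u \<circ> cinv c')"
    unfolding c(2) cimage_times_chart
    by (rule smooth_on_cong[OF o, rotated]) (simp only: comb_curve_chart[OF c(1)] comp_apply[of "comb_curve u"])
qed

lemma dmap_comb_curve:
  assumes u: "\<And>i. smooth_on I (u i)" and c: "c \<in> charts N" "x \<in> fst c" and s: "s \<in> I"
  shows "dmap (times_chart c I) (comb_curve u) (x, s) (v, \<tau>) =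
    (dmap c (lin_comb (\<lambda>i. u i s)) x v + \<tau> *\<^sub>R lin_comb (\<lambda>i. deriv (u i) s) x, \<tau> * deriv (u (k+1)) s)"
proof -
  have o: "open (cimage c \<times> I)" by (rule open_times_chart[OF c(1)])
  let ?z = "(snd c x, s)"
  have U: "((\<lambda>z. u i (snd z)) has_derivative (\<lambda>z. snd z * deriv (u i) s)) (at ?z)" for i
  proof -
    have "(u i has_derivative (\<lambda>h. h * deriv (u i) s)) (at (snd ?z))"
      using smooth_on_real_deriv[OF I(1) u s, of i] by (simp add: has_field_derivative_def mult_commute_abs)
    from has_derivative_compose[OF has_derivative_snd[OF has_derivative_ident] this] show ?thesis .
  qed
  have G: "((\<lambda>z. (f \<circ> cinv c) (fst z)) has_derivative (\<lambda>z. dmap c f x (fst z))) (at ?z)"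
    if "smooth_map N f" for f :: "'q \<Rightarrow> real \<times> 'v"
  proof -
    have "((f \<circ> cinv c) has_derivative dmap c f x) (at (fst ?z))"
      using that c by (simp add: smooth_map_def has_derivative_dmap)
    from has_derivative_compose[OF has_derivative_fst[OF has_derivative_ident] this] show ?thesis .
  qed
  let ?H = "\<lambda>z. (u 0 (snd z) *\<^sub>R (g \<circ> cinv c) (fst z) +
    (\<Sum>i=1..k. u i (snd z) *\<^sub>R (\<xi> i \<circ> cinv c) (fst z)), u (k+1) (snd z))"
  let ?H' = "\<lambda>z. (u 0 (snd ?z) *\<^sub>R dmap c g x (fst z) + (snd z * deriv (u 0) s) *\<^sub>R (g \<circ> cinv c) (fst ?z) +
      (\<Sum>i=1..k. u i (snd ?z) *\<^sub>R dmap c (\<xi> i) x (fst z) + (snd z * deriv (u i) s) *\<^sub>R (\<xi> i \<circ> cinv c) (fst ?z)),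
      snd z * deriv (u (k+1)) s)"
  have H: "(?H has_derivative ?H') (at ?z)"
    by (intro has_derivative_Pair has_derivative_add has_derivative_sum has_derivative_scaleR U G smooth_g smooth_\<xi>)
  have z: "snd (times_chart c I) (x, s) = ?z" by simp
  have "dmap (times_chart c I) (comb_curve u) (x, s) = ?H'"
  proof (rule dmap_eqI[OF o])
    show "snd (times_chart c I) (x, s) \<in> cimage c \<times> I" using c(2) s by simp
    show "(?H has_derivative ?H') (at (snd (times_chart c I) (x, s)))" unfolding z by (rule H)
  qed (rule comb_curve_chart[OF c(1)])
  then show ?thesis
    using atlas_cinv[OF atlas_N c]
    by (simp add: lin_comb_dmap[OF c] lin_comb_def[of "\<lambda>i. deriv (u i) s"] scaleR_add_right scaleR_sum_right sum.distrib)
qed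

end

section \<open>Regular points of the construction\<close>

text \<open>Dimension count: L maps a basis of the domain to an independent subset of
  \<open>range M\<close>, whose dimension is at most the size of that basis.\<close>

lemma range_eq_of_inj:
  fixes B :: "'d::real_vector set" and L M :: "'d \<Rightarrow> 'w::euclidean_space"
  assumes B: "finite B" "span B = UNIV" and L: "linear L" "inj L" and M: "linear M" and sub: "range L \<subseteq> range M"
  shows "range L = range M"
proof -
  obtain C where C: "C \<subseteq> B" "independent C" "B \<subseteq> span C"
    using maximal_independent_subset by metis
  have span: "span C = UNIV" using span_minimal[OF C(3) subspace_span] B(2) by auto
  have "finite C" using C(1) B(1) by (rule finite_subset)
  have "range M = span (M ` C)" using span_linear_image[OF M, of C] span by simp
  then have "dim (range M) \<le> card (M ` C)"
    using dim_le_card[of "range M" "M ` C"] \<open>finite C\<close> by simp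
  also have "\<dots> \<le> card C" using \<open>finite C\<close> by (rule card_image_le)
  also have "\<dots> = card (L ` C)" using L(2) by (metis card_image inj_on_subset subset_UNIV)
  finally have "range M \<subseteq> span (L ` C)"
    using sub linear_independent_injective_image[OF L(1) C(2)] inj_on_subset[OF L(2)] by (intro card_ge_dim_independent) auto
  also have "\<dots> = range L" using span_linear_image[OF L(1), of C] span by simp
  finally show ?thesis using sub by blast
qed

text \<open>For first coordinates of opposite sign the negative form would make
  \<open>snd x \<bullet> snd y\<close> smaller than a nonpositive \<open>fst x * fst y\<close>,
  hence larger in absolute value, against Cauchy-Schwarz.\<close>

lemma same_sheet:
  fixes x y :: "real \<times> 'v::euclidean_space"
  assumes "form (space_form (-1)) x x = -1" "form (space_form (-1)) y y = -1" "form (space_form (-1)) x y < 0" "fst y > 0"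
  shows "fst x > 0"
proof (rule ccontr)
  assume "\<not> fst x > 0"
  then have neg: "fst x * fst y \<le> 0" using assms(4) by (simp add: mult_nonpos_nonneg)
  have *: "fst x * fst x = 1 + snd x \<bullet> snd x" "fst y * fst y = 1 + snd y \<bullet> snd y" "snd x \<bullet> snd y < fst x * fst y"
    using assms(1-3) by (simp_all add: form_space_form)
  have "(snd x \<bullet> snd y)\<^sup>2 \<le> (snd x \<bullet> snd x) * (snd y \<bullet> snd y)" by (rule Cauchy_Schwarz_ineq)
  also have "\<dots> \<le> (fst x * fst x) * (fst y * fst y)" unfolding * by (intro mult_mono) auto
  also have "\<dots> = (fst x * fst y)\<^sup>2" by (simp add: power2_eq_square)
  finally have "\<bar>snd x \<bullet> snd y\<bar> \<le> \<bar>fst x * fst y\<bar>" by (simp add: abs_le_square_iff)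
  then show False using neg *(3) by linarith
qed

context immersion_construction
begin

abbreviation "P \<equiv> times_interval N I"
abbreviation "F \<equiv> comb_curve a"
abbreviation "Fs \<equiv> comb_curve (\<lambda>i. deriv (a i))"
abbreviation "R \<equiv> regular_points P F"
abbreviation "PR \<equiv> restrict_manifold P R"
abbreviation "ipc \<equiv> form (cylinder \<epsilon> :: ((real \<times> 'v) \<times> real) ambient)"

lemma smooth_F: "smooth_map P F" by (rule smooth_comb_curve[OF smooth_a])

lemma atlas_P: "atlas (charts P)" by (rule times_interval_atlas[OF atlas_N I(1)])

lemma topspace_P: "topspace (topo P) = topspace (topo N) \<times> I"
  by (simp add: times_interval_def)

lemma lin_comb_scale: "lin_comb (\<lambda>i. r * u i) x = r *\<^sub>R lin_comb u x"
  by (simp add: lin_comb_def scaleR_add_right scaleR_sum_right)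

lemma lin_comb_cong: "(\<And>i. i \<le> k \<Longrightarrow> u i = v i) \<Longrightarrow> lin_comb u x = lin_comb v x"
  by (simp add: lin_comb_def)

lemma dmap_F:
  assumes "c \<in> charts N" "x \<in> fst c" "s \<in> I"
  shows "dmap (times_chart c I) F (x, s) (v, \<tau>) = (dmap c (lin_comb (\<lambda>i. a i s)) x v, 0) + \<tau> *\<^sub>R Fs (x, s)"
  unfolding dmap_comb_curve[OF smooth_a assms] by (simp add: comb_curve_def)

lemma F_points:
  assumes x: "x \<in> topspace (topo N)" and s: "s \<in> I"
  shows "F (x, s) \<in> points (cylinder \<epsilon>)"
proof -
  let ?p = "lin_comb (\<lambda>i. a i s) x"
  have "?p \<in> points (space_form \<epsilon>)"
  proof (cases "\<epsilon> = 0")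
    case True
    then show ?thesis using fst_lin_comb_flat[OF True x] by (simp add: points_space_form)
  next
    case False
    have 1: "ip ?p ?p = \<epsilon>" using ip_lin_comb[OF x, of "\<lambda>i. a i s" "\<lambda>i. a i s"] a_norm[OF s] False by simp
    have "fst ?p > 0" if "\<epsilon> = -1"
    proof (rule same_sheet[where y = "g x"])
      \<comment> \<open>g has the coefficients (1, 0, ..., 0), so its product with \<open>?p\<close>
        is \<epsilon> times \<open>a 0 s\<close>, negative as the curve lies on the chosen
        sheet.\<close>
      have "g x = lin_comb (\<lambda>i. if i = 0 then 1 else 0) x" by (simp add: lin_comb_def)
      then have "ip ?p (g x) = ip ?p (lin_comb (\<lambda>i. if i = 0 then 1 else 0) x)" by simp
      also have "\<dots> = \<epsilon> * a 0 s"
        using False by (subst ip_lin_comb[OF x]) auto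
      also have "\<dots> < 0"
      proof (rule mult_neg_pos)
        have "\<alpha> s 0 > 0" using \<alpha>_points[OF s] that by (simp add: points_coord_cylinder)
        then show "a 0 s > 0" using False by (simp add: a_eq)
      qed (use that in simp)
      finally show "form (space_form (- 1)) ?p (g x) < 0" using that by simp
    qed (use 1 that g_points[OF x] in \<open>auto simp: points_space_form\<close>)
    with 1 False show ?thesis by (simp add: points_space_form)
  qed
  then show ?thesis by (simp add: points_cylinder comb_curve_def)
qed

lemma inner_form_F: "x \<in> topspace (topo N) \<Longrightarrow> s \<in> I \<Longrightarrow> inner_form_on ipc (tspace (cylinder \<epsilon>) (F (x, s)))"
  using inner_form_on_cylinder[OF eps F_points] .

lemma Fs_tangent:
  assumes x: "x \<in> topspace (topo N)" and s: "s \<in> I"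
  shows "Fs (x, s) \<in> tspace (cylinder \<epsilon>) (F (x, s))"
proof (cases "\<epsilon> = 0")
  case True
  then show ?thesis using fst_lin_comb_flat[OF True x] by (simp add: tspace_cylinder tspace_space_form comb_curve_def)
next
  case False
  then have "ip (lin_comb (\<lambda>i. a i s) x) (lin_comb (\<lambda>i. deriv (a i) s) x) = 0"
    using ip_lin_comb[OF x, of "\<lambda>i. a i s" "\<lambda>i. deriv (a i) s"] a_deriv_orth[OF s] by simp
  then show ?thesis using False by (simp add: tspace_cylinder tspace_space_form comb_curve_def)
qed

lemma Fs_speed:
  assumes x: "x \<in> topspace (topo N)"
  shows "ipc (Fs (x, s)) (Fs (x, s)) = speed2 s"
  using ip_lin_comb[OF x, of "\<lambda>i. deriv (a i) s" "\<lambda>i. deriv (a i) s"] deriv_a_0[of s]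
  by (auto simp: form_cylinder comb_curve_def speed2_def)

section \<open>The open set of regular points and its charts\<close>

lemma R_iff:
  assumes "c \<in> charts N" "x \<in> fst c" "s \<in> I"
  shows "(x, s) \<in> R \<longleftrightarrow> inj (dmap (times_chart c I) F (x, s))"
  using regular_points_chart[OF atlas_P _ _ smooth_F, of "times_chart c I" "(x, s)"] assms
    chart_topspace[OF assms(1,2)] by (simp add: charts_times_interval topspace_P)

lemma R_subset: "R \<subseteq> topspace (topo P)"
  by (auto simp: regular_points_def)

text \<open>Read in the chart, regularity is injectivity of a continuous family of linear maps, an
  open condition by \<open>inj_family_open\<close>.\<close>

lemma open_chart_R:
  assumes c: "c \<in> charts N"
  shows "open (snd (times_chart c I) ` (fst (times_chart c I) \<inter> R))"
proof (subst open_subopen, intro ballI)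
  let ?c = "times_chart c I"
  have c': "?c \<in> charts P" using c by (auto simp: charts_times_interval)
  have o: "open (cimage ?c)" by (rule atlas_open_image[OF atlas_P c'])
  fix z assume "z \<in> snd ?c ` (fst ?c \<inter> R)"
  then obtain x s where z: "z = (snd c x, s)" "x \<in> fst c" "s \<in> I" "(x, s) \<in> R" by auto
  let ?L = "\<lambda>z. fd (F \<circ> cinv ?c) z"
  have smooth: "smooth_on (cimage ?c) (F \<circ> cinv ?c)" using smooth_F c' unfolding smooth_map_def by (rule bspec)
  have L: "?L (snd ?c p) = dmap ?c F p" for p by (simp add: dmap_def fun_eq_iff)
  obtain B :: "'d set" where B: "finite B" "span B = UNIV" using N by (auto simp: is_manifold_def)
  obtain B' :: "('d \<times> real) set" where B': "finite B'" "span B' = UNIV"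
    using finite_span_times_real[OF B] .
  have z_in: "z \<in> cimage ?c" using z by force
  have "inj (?L z)" using L[of "(x, s)"] R_iff[OF c z(2,3)] z by simp
  from inj_family_open[where L = ?L, OF B' o z_in _ _ this]
  obtain V where V: "open V" "z \<in> V" "V \<subseteq> cimage ?c" "\<And>y. y \<in> V \<Longrightarrow> inj (?L y)"
    using smooth_on_has_derivative[OF smooth] has_derivative_linear
      smooth_on_imp_continuous_on[OF smooth_on_derivative[OF smooth]] by (metis (no_types, lifting))
  have "V \<subseteq> snd ?c ` (fst ?c \<inter> R)"
  proof
    fix y assume y: "y \<in> V"
    then obtain x' s' where y': "y = snd ?c (x', s')" "x' \<in> fst c" "s' \<in> I" using V(3) by fastforce
    then have "(x', s') \<in> R" using V(4)[OF y] L[of "(x', s')"] R_iff[OF c y'(2,3)] by simp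
    then show "y \<in> snd ?c ` (fst ?c \<inter> R)" using y' by (intro image_eqI[of _ _ "(x', s')"]) auto
  qed
  with V show "\<exists>T. open T \<and> z \<in> T \<and> T \<subseteq> snd ?c ` (fst ?c \<inter> R)" by blast
qed

lemma openin_R: "openin (topo P) R"
proof (subst openin_subopen, intro ballI)
  fix p assume p: "p \<in> R"
  obtain x s where xs: "p = (x, s)" by force
  have "x \<in> topspace (topo N)" "s \<in> I" using p R_subset by (auto simp: xs topspace_P)
  then obtain c where c: "c \<in> charts N" "x \<in> fst c" using N by (auto simp: is_manifold_def)
  let ?O = "snd (times_chart c I) ` (fst (times_chart c I) \<inter> R)"
  have "(snd c x, s) \<in> ?O" using p c \<open>s \<in> I\<close> xs by force
  from open_prod_elim[OF open_chart_R[OF c(1)] this]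
  \<comment> \<open>\<open>manifold_chart\<close> is available for N, so a box in the chart image is
    pulled back factor by factor.\<close>
  obtain A J where AJ: "open A" "open J" "snd c x \<in> A" "s \<in> J" "A \<times> J \<subseteq> ?O"
    by (metis mem_Sigma_iff)
  let ?T = "{x \<in> fst c. snd c x \<in> A} \<times> (J \<inter> I)"
  have "openin (topo P) ?T"
    using manifold_chart(5)[OF N c(1) AJ(1)] AJ(2)
    by (simp add: times_interval_def openin_prod_Times_iff openin_open_Int Int_commute)
  moreover have "p \<in> ?T" using xs c(2) AJ \<open>s \<in> I\<close> by simp
  moreover have "?T \<subseteq> R"
  proof
    fix q assume q: "q \<in> ?T"
    then obtain y r where yr: "q = (y, r)" "y \<in> fst c" "snd c y \<in> A" "r \<in> J" by auto
    then have "(snd c y, r) \<in> ?O" using AJ(5) by auto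
    then obtain y' r' where "(y', r') \<in> R" "y' \<in> fst c" "snd c y' = snd c y" "r' = r" by auto
    then show "q \<in> R" using yr inj_onD[OF chart_N[OF c(1)]] by metis
  qed
  ultimately show "\<exists>T. openin (topo P) T \<and> p \<in> T \<and> T \<subseteq> R" by blast
qed

lemma charts_PR: "C \<in> charts PR \<longleftrightarrow> (\<exists>c\<in>charts N. C = restrict_chart (times_chart c I) R)"
  unfolding charts_restrict_manifold charts_times_interval image_image by (simp only: image_iff)

lemma topspace_PR: "topspace (topo PR) = R"
  using R_subset by (auto simp: restrict_manifold_def)

lemma open_PR_chart: "C \<in> charts P \<Longrightarrow> open (cimage (restrict_chart C R))"
  using open_chart_R by (auto simp only: charts_times_interval fst_conv snd_conv)

lemma atlas_PR: "atlas (charts PR)"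
proof (rule restrict_manifold_atlas[OF atlas_P])
  fix c d assume c: "c \<in> charts P" and d: "d \<in> charts P"
  have inj: "inj_on (snd c) (fst c)" using atlas_P c by (simp add: atlas_def)
  have "snd c ` (fst c \<inter> fst d \<inter> R) = snd c ` (fst c \<inter> fst d) \<inter> snd c ` (fst c \<inter> R)"
    using inj_on_image_Int[OF inj, of "fst c \<inter> fst d" "fst c \<inter> R"] by (auto simp: Int_ac)
  moreover have "open (snd c ` (fst c \<inter> fst d))" using atlas_P c d by (simp add: atlas_def)
  ultimately show "open (snd c ` (fst c \<inter> fst d \<inter> R))"
    using open_PR_chart[OF c] by (simp add: open_Int)
qed

lemma smooth_map_PR: "smooth_map P f \<Longrightarrow> smooth_map PR f"
  by (rule smooth_map_restrict_manifold[OF _ atlas_P open_PR_chart])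

lemma dmap_PR:
  assumes "c \<in> charts N" "x \<in> fst c" "s \<in> I" "(x, s) \<in> R"
  shows "dmap (restrict_chart (times_chart c I) R) f (x, s) = dmap (times_chart c I) f (x, s)"
proof (rule dmap_restrict_chart)
  have "times_chart c I \<in> charts P" using assms(1) by (auto simp: charts_times_interval)
  then show "inj_on (snd (times_chart c I)) (fst (times_chart c I))"
    "open (cimage (restrict_chart (times_chart c I) R))"
    using atlas_P open_PR_chart by (auto simp only: atlas_def)
qed (use assms in auto)

lemma normal_space_PR:
  assumes c: "c \<in> charts N" "x \<in> fst c" "s \<in> I" "(x, s) \<in> R"
  shows "normal_space (cylinder \<epsilon>) PR F (x, s) =
    {w \<in> tspace (cylinder \<epsilon>) (F (x, s)). \<forall>u. ipc w (dmap (times_chart c I) F (x, s) u) = 0}"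
proof -
  have "restrict_chart (times_chart c I) R \<in> charts PR" using c(1) charts_PR by blast
  moreover have "(x, s) \<in> fst (restrict_chart (times_chart c I) R)" using c by simp
  ultimately show ?thesis
    by (simp only: normal_space_chart[OF atlas_PR _ _ smooth_map_PR[OF smooth_F]] dmap_PR[OF c])
qed

lemma immersion_PR: "immersion (cylinder \<epsilon>) PR F"
  unfolding immersion_def
proof (intro conjI)
  show "smooth_map PR F" by (rule smooth_map_PR[OF smooth_F])
  show "F ` topspace (topo PR) \<subseteq> points (cylinder \<epsilon>)"
    unfolding topspace_PR using R_subset F_points by (fastforce simp: topspace_P)
  have "p \<in> regular_points PR F" if p: "p \<in> R" for p
  proof -
    obtain x s where xs: "p = (x, s)" by force
    have x: "x \<in> topspace (topo N)" "s \<in> I" using p R_subset by (auto simp: xs topspace_P)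
    then obtain c where c: "c \<in> charts N" "x \<in> fst c" using N by (auto simp: is_manifold_def)
    have C: "restrict_chart (times_chart c I) R \<in> charts PR" using c(1) charts_PR by blast
    have "inj (dmap (restrict_chart (times_chart c I) R) F (x, s))"
      using R_iff[OF c x(2)] dmap_PR[OF c x(2), of F] p xs by simp
    then show ?thesis
      using regular_points_chart[OF atlas_PR C _ smooth_map_PR[OF smooth_F], of p] p xs c x(2) topspace_PR by simp
  qed
  then show "regular_points PR F = topspace (topo PR)"
    unfolding topspace_PR by (auto simp: regular_points_def[of PR] topspace_PR)
qed

text \<open>Regularity restricts to injectivity along the slice of constant s, and a dimension count
  turns the inclusion \<open>dmap_lin_comb_range\<close> into an equality.\<close>

lemma range_lin_comb:
  assumes c: "c \<in> charts N" "x \<in> fst c" "s \<in> I" "(x, s) \<in> R"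
  shows "range (dmap c (lin_comb (\<lambda>i. a i s)) x) = range (dmap c g x)"
proof -
  obtain B :: "'d set" where B: "finite B" "span B = UNIV" using N by (auto simp: is_manifold_def)
  show ?thesis
  proof (rule range_eq_of_inj[OF B linear_dmap[OF c(1,2) lin_comb_smooth] _ linear_dmap[OF c(1,2) smooth_g]])
    show "inj (dmap c (lin_comb (\<lambda>i. a i s)) x)"
    proof (rule injI)
      fix u v assume "dmap c (lin_comb (\<lambda>i. a i s)) x u = dmap c (lin_comb (\<lambda>i. a i s)) x v"
      then have "dmap (times_chart c I) F (x, s) (u, 0) = dmap (times_chart c I) F (x, s) (v, 0)"
        by (simp add: dmap_F[OF c(1-3)])
      then show "u = v" using R_iff[OF c(1-3)] c(4) by (auto dest: injD)
    qed
    show "range (dmap c (lin_comb (\<lambda>i. a i s)) x) \<subseteq> range (dmap c g x)"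
      using dmap_lin_comb_range[OF c(1,2)] by auto
  qed
qed

theorem regular_part:
  "\<exists>T' \<eta>'. dt_decomposition \<epsilon> PR F T' \<eta>' \<and> parallel_normal_field (cylinder \<epsilon>) PR F \<eta>'"
proof -
  obtain \<kappa> where \<kappa>: "\<And>s. s \<in> I \<Longrightarrow> \<kappa> * speed2 s = deriv (a (k+1)) s" using constant_ratio by blast
  \<comment> \<open>The coefficients of \<partial>/\<partial>t - \<kappa> f_*
    \<partial>/\<partial>s; the frame field with index k + 1 is \<open>dt\<close>.\<close>
  define u where "u i s = (if i = k + 1 then 1 else 0) - \<kappa> * deriv (a i) s" for i s
  define \<eta>' where "\<eta>' = comb_curve u"
  \<comment> \<open>The field \<kappa> \<partial>/\<partial>s has the same components in every
    product chart, as transitions leave the second factor unchanged.\<close>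
  define T' :: "('q \<times> real, 'd \<times> real) vfield" where "T' = (\<lambda>_ _. (0, \<kappa>))"
  have u: "smooth_on I (u i)" for i
    unfolding u_def[abs_def] by (intro smooth_on_diff smooth_on_mult smooth_on_const smooth_deriv_a I)
  have du: "deriv (u i) s = - \<kappa> * deriv (deriv (a i)) s" if "s \<in> I" for i s
    unfolding u_def[abs_def]
    by (rule DERIV_imp_deriv) (use deriv_deriv_a[OF that] in \<open>auto intro!: derivative_eq_intros\<close>)
  have \<eta>': "\<eta>' p = dt - \<kappa> *\<^sub>R Fs p" for p
  proof -
    obtain x s where "p = (x, s)" by force
    moreover have "lin_comb (\<lambda>i. u i s) x = lin_comb (\<lambda>i. (- \<kappa>) * deriv (a i) s) x"
      by (rule lin_comb_cong) (simp add: u_def)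
    ultimately show ?thesis unfolding lin_comb_scale
      by (simp add: \<eta>'_def comb_curve_def dt_def u_def)
  qed
  have smooth_\<eta>': "smooth_map PR \<eta>'" unfolding \<eta>'_def by (rule smooth_map_PR[OF smooth_comb_curve[OF u]])
  have pt: "\<exists>x s. p = (x, s) \<and> x \<in> topspace (topo N) \<and> s \<in> I" if "p \<in> R" for p
    using that R_subset by (auto simp: topspace_P)
  have bilc: "bilinear ipc" using bounded_bilinear_cylinder bilinear_conv_bounded_bilinear by blast
  note ipc = bilinear_ladd[OF bilc] bilinear_radd[OF bilc] bilinear_lmul[OF bilc] bilinear_rmul[OF bilc] bilinear_lsub[OF bilc]
  have normal: "\<eta>' (x, s) \<in> normal_space (cylinder \<epsilon>) PR F (x, s)"
    if c: "c \<in> charts N" "x \<in> fst c" "s \<in> I" "(x, s) \<in> R" for c x s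
    unfolding normal_space_PR[OF c]
  proof (intro CollectI conjI allI)
    have x: "x \<in> topspace (topo N)" by (rule chart_topspace[OF c(1,2)])
    have sub: "subspace (tspace (cylinder \<epsilon>) (F (x, s)))"
      using inner_form_F[OF x c(3)] by (simp add: inner_form_on_def)
    have "dt \<in> tspace (cylinder \<epsilon>) (F (x, s))"
      by (simp add: dt_def tspace_cylinder tspace_space_form form_space_form)
    then show "\<eta>' (x, s) \<in> tspace (cylinder \<epsilon>) (F (x, s))"
      unfolding \<eta>' using Fs_tangent[OF x c(3)] by (intro subspace_diff subspace_scale sub)
    fix w :: "'d \<times> real"
    obtain v \<tau> where w: "w = (v, \<tau>)" by force
    let ?X = "dmap c (lin_comb (\<lambda>i. a i s)) x v"
    have X: "?X \<in> range (dmap c g x)" by (rule dmap_lin_comb_range[OF c(1,2)])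
    have 1: "ipc (Fs (x, s)) (?X, 0) = 0"
      using ip_range_lin_comb[OF c(1,2) X, of "\<lambda>i. deriv (a i) s"] deriv_a_0[of s]
      by (subst form_cylinder_commute) (auto simp: form_cylinder comb_curve_def)
    have 2: "ipc dt (?X, 0) = 0" by (simp add: form_cylinder dt_def form_space_form)
    \<comment> \<open>In the direction of the curve the pairing is
      \<open>deriv (a (k+1)) s - \<kappa> * speed2 s\<close>, zero by the choice of
      \<kappa>.\<close>
    have 3: "ipc dt (Fs (x, s)) = deriv (a (k+1)) s"
      by (simp add: form_cylinder dt_def form_space_form comb_curve_def)
    show "ipc (\<eta>' (x, s)) (dmap (times_chart c I) F (x, s) w) = 0"
      unfolding \<eta>' w dmap_F[OF c(1-3)] ipc 1 2 3 Fs_speed[OF x] using \<kappa>[OF c(3)] by simp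
  qed
  have parallel: "normal_connection (cylinder \<epsilon>) PR (restrict_chart (times_chart c I) R) F \<eta>' (x, s) w = 0"
    if c: "c \<in> charts N" "x \<in> fst c" "s \<in> I" "(x, s) \<in> R" for c x s w
  proof -
    have x: "x \<in> topspace (topo N)" by (rule chart_topspace[OF c(1,2)])
    obtain v \<tau> where w: "w = (v, \<tau>)" by force
    obtain l where l: "\<epsilon> = 0 \<Longrightarrow> l = 0" "\<And>i. i \<le> k \<Longrightarrow> deriv (deriv (a i)) s = l * a i s" "deriv (deriv (a (k+1))) s = 0"
      using geodesic_equation[OF c(3)] by blast
    \<comment> \<open>By the geodesic equation the derivative of \<eta>' along the curve is a
      multiple of the position vector, which is normal to the space form if \<epsilon> \<noteq> 0;
      if \<epsilon> = 0 the factor l vanishes.\<close>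
    have "lin_comb (\<lambda>i. deriv (u i) s) x = lin_comb (\<lambda>i. (- \<kappa> * l) * a i s) x"
      by (rule lin_comb_cong) (simp add: du[OF c(3)] l(2))
    then have acc: "lin_comb (\<lambda>i. deriv (u i) s) x = (- \<kappa> * l) *\<^sub>R lin_comb (\<lambda>i. a i s) x"
      by (simp only: lin_comb_scale)
    \<comment> \<open>Regularity enters here: a derivative of \<eta>' along N is also a derivative
      of F along N, in another direction v'.\<close>
    have "dmap c (lin_comb (\<lambda>i. u i s)) x v \<in> range (dmap c (lin_comb (\<lambda>i. a i s)) x)"
      unfolding range_lin_comb[OF c] by (rule dmap_lin_comb_range[OF c(1,2)])
    then obtain v' where v': "dmap c (lin_comb (\<lambda>i. u i s)) x v = dmap c (lin_comb (\<lambda>i. a i s)) x v'" by blast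
    have "dmap (restrict_chart (times_chart c I) R) \<eta>' (x, s) w =
      dmap (times_chart c I) F (x, s) (v', 0) + (- \<tau> * \<kappa> * l) *\<^sub>R (lin_comb (\<lambda>i. a i s) x, 0)"
      unfolding dmap_PR[OF c] \<eta>'_def w dmap_comb_curve[OF u c(1-3)] dmap_F[OF c(1-3)] v' acc
      using du[OF c(3), of "k+1"] l(3) by simp
    moreover have "ipc (dmap (times_chart c I) F (x, s) (v', 0) + (- \<tau> * \<kappa> * l) *\<^sub>R (lin_comb (\<lambda>i. a i s) x, 0)) \<nu> = 0"
      if \<nu>: "\<nu> \<in> normal_space (cylinder \<epsilon>) PR F (x, s)" for \<nu>
    proof -
      have "ipc (dmap (times_chart c I) F (x, s) (v', 0)) \<nu> = 0"
        using \<nu> unfolding normal_space_PR[OF c] by (subst form_cylinder_commute) simp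
      moreover have "l * ipc (lin_comb (\<lambda>i. a i s) x, 0) \<nu> = 0"
        using \<nu> l(1) unfolding normal_space_PR[OF c]
        by (cases "\<epsilon> = 0") (auto simp: tspace_cylinder tspace_space_form comb_curve_def form_cylinder)
      ultimately show ?thesis unfolding ipc by auto
    qed
    ultimately show ?thesis
      using normal_connection_eq_0_iff[where f = F and p = "(x, s)" and M = PR, OF inner_form_F[OF x c(3)]] by simp
  qed
  have normal_field: "normal_field (cylinder \<epsilon>) PR F \<eta>'"
    unfolding normal_field_def
  proof (intro conjI smooth_\<eta>' ballI)
    fix p assume "p \<in> topspace (topo PR)"
    then have "p \<in> R" by (simp only: topspace_PR)
    with pt obtain x s where xs: "p = (x, s)" "x \<in> topspace (topo N)" "s \<in> I" by blast
    then obtain c where "c \<in> charts N" "x \<in> fst c" using N by (auto simp: is_manifold_def)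
    then show "\<eta>' p \<in> normal_space (cylinder \<epsilon>) PR F p" using normal \<open>p \<in> R\<close> xs by simp
  qed
  have tangent_field: "tangent_field PR T'"
    unfolding tangent_field_def
  proof (intro conjI ballI)
    show "smooth_on (cimage C) (T' (snd C) \<circ> cinv C)" for C
      by (simp add: T'_def comp_def smooth_on_const)
    fix C D p assume "C \<in> charts PR" "D \<in> charts PR" and p: "p \<in> fst C \<inter> fst D"
    then obtain c d where c: "c \<in> charts N" "C = restrict_chart (times_chart c I) R"
      and d: "d \<in> charts N" "D = restrict_chart (times_chart d I) R" using charts_PR by blast
    obtain x s where xs: "p = (x, s)" "x \<in> fst c" "x \<in> fst d" "s \<in> I" "(x, s) \<in> R" using p c d by auto
    let ?U = "snd c ` (fst c \<inter> fst d)"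
    have U: "open ?U" "smooth_on ?U (snd d \<circ> cinv c)" using atlas_N c d by (auto simp: atlas_def)
    have "((snd d \<circ> cinv c) has_derivative dmap c (snd d) x) (at (fst (snd c x, s)))"
      using smooth_on_has_derivative[OF U(2)] xs(2,3) by (simp add: dmap_def[abs_def])
    from has_derivative_compose[OF has_derivative_fst[OF has_derivative_ident] this]
    have "((\<lambda>z. ((snd d \<circ> cinv c) (fst z), snd z)) has_derivative (\<lambda>z. (dmap c (snd d) x (fst z), snd z))) (at (snd c x, s))"
      by (intro has_derivative_Pair has_derivative_snd has_derivative_ident)
    then have 1: "dmap (times_chart c I) (snd (times_chart d I)) (x, s) = (\<lambda>z. (dmap c (snd d) x (fst z), snd z))"
    proof (intro dmap_eqI)
      show "open (?U \<times> I)" using U(1) I(1) by (rule open_Times)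
      show "snd (times_chart d I) (cinv (times_chart c I) z) = ((snd d \<circ> cinv c) (fst z), snd z)" if z: "z \<in> ?U \<times> I" for z
        using cinv_times_chart[OF chart_N[OF c(1)], of "fst z" "snd z" I] z by auto
    qed (use xs in auto)
    have 2: "dmap c (snd d) x 0 = 0"
      using has_derivative_linear[OF smooth_on_has_derivative[OF U(2), of "snd c x"]] xs(2,3)
      by (auto simp: dmap_def linear_0)
    have 3: "snd D = snd (times_chart d I)" by (simp add: d)
    show "T' (snd D) p = dmap C (snd D) p (T' (snd C) p)"
      unfolding T'_def xs(1) c(2) 3 dmap_PR[OF c(1) xs(2,4,5)] 1 by (simp add: 2)
  qed
  have decomposition: "dt = dmap C F p (T' (snd C) p) + \<eta>' p" if C: "C \<in> charts PR" "p \<in> fst C" for C p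
  proof -
    obtain c where c: "c \<in> charts N" "C = restrict_chart (times_chart c I) R" using C charts_PR by blast
    obtain x s where xs: "p = (x, s)" "x \<in> fst c" "s \<in> I" "(x, s) \<in> R" using C c by auto
    have "dmap c (lin_comb (\<lambda>i. a i s)) x 0 = 0"
      by (rule linear_0[OF linear_dmap[OF c(1) xs(2) lin_comb_smooth]])
    then show ?thesis
      unfolding c(2) xs(1) dmap_PR[OF c(1) xs(2-4)] T'_def dmap_F[OF c(1) xs(2,3)] \<eta>' by (simp flip: zero_prod_def)
  qed
  have parallel': "normal_connection (cylinder \<epsilon>) PR C F \<eta>' p w = 0" if C: "C \<in> charts PR" "p \<in> fst C" for C p w
  proof -
    obtain c where c: "c \<in> charts N" "C = restrict_chart (times_chart c I) R" using C charts_PR by blast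
    obtain x s where xs: "p = (x, s)" "x \<in> fst c" "s \<in> I" "(x, s) \<in> R" using C c by auto
    show ?thesis unfolding c(2) xs(1) by (rule parallel[OF c(1) xs(2-4)])
  qed
  show ?thesis
    unfolding dt_decomposition_def parallel_normal_field_def
    by (intro exI[of _ T'] exI[of _ \<eta>'] conjI ballI allI tangent_field normal_field decomposition parallel')
qed

end

section \<open>Immersions with parallel normal part of the height field\<close>

text \<open>The coordinates of a geodesic of speed \<open>\<omega>\<close> of the one-dimensional space form.\<close>

definition gcos :: "real \<Rightarrow> real \<Rightarrow> real \<Rightarrow> real" where
  "gcos \<epsilon> \<omega> s = (if \<epsilon> = 1 then cos (\<omega> * s) else if \<epsilon> = -1 then cosh (\<omega> * s) else 1)"

definition gsin :: "real \<Rightarrow> real \<Rightarrow> real \<Rightarrow> real" where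
  "gsin \<epsilon> \<omega> s = (if \<epsilon> = 1 then sin (\<omega> * s) else if \<epsilon> = -1 then sinh (\<omega> * s) else \<omega> * s)"

lemma gcos_gsin:
  assumes "\<epsilon> \<in> {-1, 0, 1}"
  shows "(gcos \<epsilon> \<omega> has_real_derivative (- \<epsilon> * \<omega>) * gsin \<epsilon> \<omega> s) (at s)"
    and "(gsin \<epsilon> \<omega> has_real_derivative \<omega> * gcos \<epsilon> \<omega> s) (at s)"
    and "gcos \<epsilon> \<omega> s * gcos \<epsilon> \<omega> s + \<epsilon> * gsin \<epsilon> \<omega> s * gsin \<epsilon> \<omega> s = 1"
    and "gcos \<epsilon> \<omega> 0 = 1" "gsin \<epsilon> \<omega> 0 = 0" "\<epsilon> = -1 \<Longrightarrow> gcos \<epsilon> \<omega> s > 0" "\<epsilon> = 0 \<Longrightarrow> gcos \<epsilon> \<omega> s = 1"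
    and "gcos \<epsilon> 0 s = 1" "gsin \<epsilon> 0 s = 0"
proof -
  consider "\<epsilon> = 0" | "\<epsilon> = 1" | "\<epsilon> = -1" using assms by auto
  then show "(gcos \<epsilon> \<omega> has_real_derivative (- \<epsilon> * \<omega>) * gsin \<epsilon> \<omega> s) (at s)"
    "(gsin \<epsilon> \<omega> has_real_derivative \<omega> * gcos \<epsilon> \<omega> s) (at s)"
    "gcos \<epsilon> \<omega> s * gcos \<epsilon> \<omega> s + \<epsilon> * gsin \<epsilon> \<omega> s * gsin \<epsilon> \<omega> s = 1"
    by (cases; auto simp: gcos_def[abs_def] gsin_def[abs_def] cosh_square_eq intro!: derivative_eq_intros
        simp flip: power2_eq_square)+
qed (auto simp: gcos_def gsin_def)

lemma smooth_gcos_gsin: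
  assumes "\<epsilon> \<in> {-1, 0, 1}" "open I"
  shows "smooth_on I (gcos \<epsilon> \<omega>)" "smooth_on I (gsin \<epsilon> \<omega>)"
  using smooth_on_harmonic_pair[OF gcos_gsin(1,2)[OF assms(1)]] smooth_on_subset[of UNIV _ I] by blast+

text \<open>The converse read in one chart, F and H being f and \<eta> in coordinates. Convexity of
  U makes functions with zero derivative constant; the last assumption is parallelism in the tested
  form of \<open>normal_connection_eq_0_iff\<close>.\<close>

locale parallel_chart =
  fixes \<epsilon> :: real and U :: "('e::euclidean_space \<times> real) set"
    and F H :: "'e \<times> real \<Rightarrow> (real \<times> 'v::euclidean_space) \<times> real" and T :: "'e \<times> real \<Rightarrow> 'e \<times> real"
    and y0 :: "'e \<times> real"
  assumes eps: "\<epsilon> \<in> {-1, 0, 1}" and U: "open U" "convex U" "y0 \<in> U"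
    and smooth_F: "smooth_on U F" and smooth_H: "smooth_on U H"
    and F_points: "\<And>y. y \<in> U \<Longrightarrow> F y \<in> points (cylinder \<epsilon>)"
    and inj_F: "\<And>y. y \<in> U \<Longrightarrow> inj (fd F y)"
    and H_tangent: "\<And>y. y \<in> U \<Longrightarrow> H y \<in> tspace (cylinder \<epsilon>) (F y)"
    and H_normal: "\<And>y u. y \<in> U \<Longrightarrow> form (cylinder \<epsilon>) (H y) (fd F y u) = 0"
    and dt_eq: "\<And>y. y \<in> U \<Longrightarrow> dt = fd F y (T y) + H y"
    and T_nonzero: "\<And>y. y \<in> U \<Longrightarrow> T y \<noteq> 0"
    and parallel: "\<And>y u \<nu>. y \<in> U \<Longrightarrow> \<nu> \<in> tspace (cylinder \<epsilon>) (F y) \<Longrightarrow>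
      (\<And>w. form (cylinder \<epsilon>) \<nu> (fd F y w) = 0) \<Longrightarrow>
      form (cylinder \<epsilon>) (fd H y u) \<nu> = 0"
begin

abbreviation "ip \<equiv> form (space_form \<epsilon> :: (real \<times> 'v) ambient)"
abbreviation "ipc \<equiv> form (cylinder \<epsilon> :: ((real \<times> 'v) \<times> real) ambient)"
abbreviation "DF y \<equiv> fd F y"
abbreviation "DH y \<equiv> fd H y"

lemma bil: "bounded_bilinear ip" and bilc: "bounded_bilinear ipc"
  by (rule bounded_bilinear_space_form, rule bounded_bilinear_cylinder)

lemma DF: "y \<in> U \<Longrightarrow> (F has_derivative DF y) (at y)"
  and DH: "y \<in> U \<Longrightarrow> (H has_derivative DH y) (at y)"
  using smooth_on_has_derivative smooth_F smooth_H by blast+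

lemma linear_DF: "y \<in> U \<Longrightarrow> linear (DF y)"
  using DF has_derivative_linear by blast

lemma posdef: "y \<in> U \<Longrightarrow> inner_form_on ipc (tspace (cylinder \<epsilon>) (F y))"
  by (rule inner_form_on_cylinder[OF eps F_points])

lemma posdef_ip: "y \<in> U \<Longrightarrow> inner_form_on ip (tspace (space_form \<epsilon>) (fst (F y)))"
  using F_points[of y] by (intro inner_form_on_space_form[OF eps]) (simp add: points_cylinder mem_Times_iff)

lemma derivative_const:
  assumes "(f has_derivative f') (at y)" "\<And>z. z \<in> U \<Longrightarrow> f z = c" "y \<in> U"
  shows "f' v = 0"
proof -
  have "(f has_derivative (\<lambda>v. 0)) (at y)"
    by (rule has_derivative_transform_within_open[OF has_derivative_const[of c] U(1) assms(3)]) (simp add: assms(2))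
  with assms(1) have "f' = (\<lambda>v. 0)" by (rule has_derivative_unique)
  then show ?thesis by simp
qed

lemma constant_on_U:
  assumes "\<And>y. y \<in> U \<Longrightarrow> (f has_derivative (\<lambda>v. 0)) (at y)" "y \<in> U"
  shows "f y = f y0"
proof -
  have "\<exists>c. \<forall>x\<in>U. f x = c"
    by (rule has_derivative_zero_constant[OF U(2)]) (rule has_derivative_at_withinI[OF assms(1)])
  then show ?thesis using assms(2) U(3) by auto
qed

text \<open>Pairing H with \<open>dt\<close> picks out its height; in \<open>dt\<close> = dF(T) + H
  the tangent part drops out.\<close>

lemma snd_H_eq: "y \<in> U \<Longrightarrow> snd (H y) = ipc (H y) (H y)"
proof -
  assume y: "y \<in> U"
  have "snd (H y) = ipc (H y) dt" by (simp add: dt_def form_cylinder form_space_form)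
  also have "\<dots> = ipc (H y) (DF y (T y)) + ipc (H y) (H y)"
    by (subst dt_eq[OF y]) (simp only: cylinder_simps)
  finally show ?thesis using H_normal[OF y] by simp
qed

text \<open>The constant squared length of \<eta>, introduced through its height component.\<close>

definition c2 :: real where "c2 = snd (H y0)"

lemma norm_H: "y \<in> U \<Longrightarrow> ipc (H y) (H y) = c2"
proof -
  assume y: "y \<in> U"
  have "ipc (H y) (H y) = ipc (H y0) (H y0)"
  proof (rule constant_on_U[OF _ y])
    fix y assume y: "y \<in> U"
    have "((\<lambda>y. ipc (H y) (H y)) has_derivative (\<lambda>v. ipc (H y) (DH y v) + ipc (DH y v) (H y))) (at y)"
      by (rule bounded_bilinear.FDERIV[OF bilc DH[OF y] DH[OF y]])
    moreover have "ipc (DH y v) (H y) = 0" for v by (rule parallel[OF y H_tangent[OF y] H_normal[OF y]])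
    moreover from this have "ipc (H y) (DH y v) = 0" for v by (subst form_cylinder_commute)
    ultimately show "((\<lambda>y. ipc (H y) (H y)) has_derivative (\<lambda>v. 0)) (at y)" by simp
  qed
  then show ?thesis using snd_H_eq[OF U(3)] by (simp add: c2_def)
qed

lemma snd_H: "y \<in> U \<Longrightarrow> snd (H y) = c2"
  using snd_H_eq norm_H by simp

lemma snd_DH: "y \<in> U \<Longrightarrow> snd (DH y v) = 0"
  by (rule derivative_const[OF has_derivative_snd[OF DH] snd_H])

lemma DF_T: "y \<in> U \<Longrightarrow> DF y (T y) = dt - H y"
  using dt_eq[of y] by (simp add: algebra_simps)

text \<open>1 - \<open>c2\<close> is the squared length of dF(T) = \<open>dt\<close> - H, which is
  nonzero because T is nonzero and dF injective.\<close>

lemma c2_bounds: "0 \<le> c2" "c2 < 1"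
proof -
  have 1: "\<And>v. v \<in> tspace (cylinder \<epsilon>) (F y0) \<Longrightarrow> v \<noteq> 0 \<Longrightarrow> ipc v v > 0" and sub: "subspace (tspace (cylinder \<epsilon>) (F y0))"
    using posdef[OF U(3)] by (auto simp: inner_form_on_def)
  show "0 \<le> c2"
  proof (cases "H y0 = 0")
    case True
    then show ?thesis by (simp add: c2_def)
  next
    case False
    then show ?thesis using 1[OF H_tangent[OF U(3)]] norm_H[OF U(3)] by simp
  qed
  have "dt \<in> tspace (cylinder \<epsilon>) (F y0)" by (simp add: dt_def tspace_cylinder tspace_space_form form_space_form)
  then have "dt - H y0 \<in> tspace (cylinder \<epsilon>) (F y0)" using H_tangent[OF U(3)] by (rule subspace_diff[OF sub])
  moreover have "dt - H y0 \<noteq> 0"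
    using DF_T[OF U(3)] T_nonzero[OF U(3)] inj_F[OF U(3)] linear_injective_0[OF linear_DF[OF U(3)]] by metis
  ultimately have "ipc (dt - H y0) (dt - H y0) > 0" by (rule 1)
  moreover have "ipc dt (H y0) = c2" "ipc (H y0) dt = c2" "ipc dt dt = 1"
    by (simp_all add: dt_def form_cylinder form_space_form c2_def)
  ultimately show "c2 < 1" using norm_H[OF U(3)] by (simp add: cylinder_simps)
qed

text \<open>Differentiating the orthogonality of \<open>H\<close> to the immersion gives the symmetry of its shape
  operator, hence \<open>A\<^sub>\<eta> T = 0\<close> as \<open>\<eta>\<close> is of constant length.\<close>

lemma shape_symmetric:
  assumes y: "y \<in> U"
  shows "ipc (DH y u) (DF y v) = ipc (DH y v) (DF y u)"
proof -
  have *: "ipc (DH y u) (DF y v) = - ipc (H y) (fd (\<lambda>z. DF z v) y u)" for u v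
  proof -
    have "((\<lambda>z. DF z v) has_derivative fd (\<lambda>z. DF z v) y) (at y)"
      using smooth_on_has_derivative[OF smooth_on_derivative[OF smooth_F] y] .
    from bounded_bilinear.FDERIV[OF bilc DH[OF y] this]
    have "ipc (H y) (fd (\<lambda>z. DF z v) y u) + ipc (DH y u) (DF y v) = 0"
      by (rule derivative_const[OF _ H_normal y])
    then show ?thesis by linarith
  qed
  \<comment> \<open>The symmetry of second derivatives is stated for real functions; it is applied
    to F paired with the fixed vector \<open>H y\<close>.\<close>
  let ?L = "ipc (H y)"
  have L: "bounded_linear ?L" by (rule bounded_bilinear.bounded_linear_right[OF bilc])
  have LF: "fd (\<lambda>z. ?L (F z)) z v = ?L (DF z v)" if "z \<in> U" for z v
    using frechet_derivative_eqI[OF bounded_linear.has_derivative[OF L DF[OF that]]] by simp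
  have "fd (\<lambda>z. fd (\<lambda>z. ?L (F z)) z v) y u = ?L (fd (\<lambda>z. DF z v) y u)"
    for u v
  proof -
    have "((\<lambda>z. ?L (DF z v)) has_derivative (\<lambda>u. ?L (fd (\<lambda>z. DF z v) y u))) (at y)"
      by (rule bounded_linear.has_derivative[OF L smooth_on_has_derivative[OF smooth_on_derivative[OF smooth_F] y]])
    then have "((\<lambda>z. fd (\<lambda>z. ?L (F z)) z v) has_derivative (\<lambda>u. ?L (fd (\<lambda>z. DF z v) y u))) (at y)"
      by (rule has_derivative_transform_within_open[OF _ U(1) y]) (simp add: LF)
    from frechet_derivative_eqI[OF this] show ?thesis by simp
  qed
  moreover have "Ck_on 2 U (\<lambda>z. ?L (F z))"
    using smooth_on_bounded_linear[OF U(1) L smooth_F] by (simp add: smooth_on_def)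
  ultimately show ?thesis using symmetric_second_derivative[OF U(1) _ y] unfolding * by metis
qed

text \<open>By symmetry T can be moved to the other factor, where dF(T) = \<open>dt\<close> - H. The
  derivatives of H are orthogonal to \<open>dt\<close> and to H, both its height and its length
  being constant.\<close>

lemma DH_T_orth: "y \<in> U \<Longrightarrow> ipc (DH y (T y)) (DF y u) = 0"
proof -
  assume y: "y \<in> U"
  have "ipc (DH y u) (H y) = 0" by (rule parallel[OF y H_tangent[OF y] H_normal[OF y]])
  moreover have "ipc (DH y u) dt = 0"
    using snd_DH[OF y] by (simp add: dt_def form_cylinder form_space_form)
  ultimately show ?thesis
    unfolding shape_symmetric[OF y, of "T y"] DF_T[OF y] by (simp add: cylinder_simps)
qed

text \<open>The length of the horizontal part of dF(T): its total squared length is 1 -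
  \<open>c2\<close>, of which the vertical component takes (1 - \<open>c2\<close>)^2.\<close>

definition \<omega> :: real where "\<omega> = sqrt (c2 * (1 - c2))"

lemma \<omega>: "\<omega> \<ge> 0" "\<omega> * \<omega> = c2 * (1 - c2)"
  using c2_bounds by (simp_all add: \<omega>_def)

abbreviation "\<phi> y \<equiv> fst (F y)"
text \<open>The horizontal part of dF(T), by \<open>DF_T\<close>.\<close>

definition "\<zeta> y = - fst (H y)"

lemma \<zeta>_norm: "y \<in> U \<Longrightarrow> ip (\<zeta> y) (\<zeta> y) = \<omega> * \<omega>"
  using norm_H[of y] snd_H[of y] by (simp add: form_cylinder \<zeta>_def space_form_simps \<omega> algebra_simps)

lemma \<zeta>_tangent: "y \<in> U \<Longrightarrow> \<zeta> y \<in> tspace (space_form \<epsilon>) (\<phi> y)"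
  using H_tangent[of y] posdef_ip[of y] unfolding \<zeta>_def inner_form_on_def
  by (intro subspace_neg) (simp_all add: tspace_cylinder mem_Times_iff)

lemma D\<zeta>: "y \<in> U \<Longrightarrow> (\<zeta> has_derivative (\<lambda>v. - fst (DH y v))) (at y)"
  unfolding \<zeta>_def[abs_def] by (intro has_derivative_minus has_derivative_fst DH)

lemma D\<phi>: "y \<in> U \<Longrightarrow> (\<phi> has_derivative (\<lambda>v. fst (DF y v))) (at y)"
  by (intro has_derivative_fst DF)

lemma D\<phi>_T: "y \<in> U \<Longrightarrow> fst (DF y (T y)) = \<zeta> y"
  by (simp add: DF_T \<zeta>_def dt_def)

lemma \<phi>_norm: "y \<in> U \<Longrightarrow> \<epsilon> \<noteq> 0 \<Longrightarrow> ip (\<phi> y) (\<phi> y) = \<epsilon>"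
  using F_points[of y] by (auto simp: points_cylinder points_space_form split: if_splits)

lemma \<phi>_D\<phi>:
  assumes "y \<in> U" "\<epsilon> \<noteq> 0"
  shows "ip (\<phi> y) (fst (DF y v)) = 0"
proof -
  have "ip (\<phi> y) (fst (DF y v)) + ip (fst (DF y v)) (\<phi> y) = 0"
    by (rule derivative_const[OF bounded_bilinear.FDERIV[OF bil D\<phi>[OF assms(1)] D\<phi>[OF assms(1)]] _ assms(1)])
      (use \<phi>_norm assms(2) in auto)
  then show ?thesis using form_space_form_commute[of \<epsilon> "\<phi> y" "fst (DF y v)"] by simp
qed

text \<open>The geodesic equation for \<phi> along T. The difference \<open>?X\<close> of the two
  sides is tangent to the space form and orthogonal to the immersion, hence a normal vector on which
  parallelism can be tested. The outcome is that \<open>?X\<close> has length zero.\<close>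

lemma D\<zeta>_T:
  assumes y: "y \<in> U"
  shows "- fst (DH y (T y)) = (- \<epsilon> * \<omega> * \<omega>) *\<^sub>R \<phi> y"
proof -
  let ?X = "- fst (DH y (T y)) + (\<epsilon> * \<omega> * \<omega>) *\<^sub>R \<phi> y"
  have orth: "ip (fst (DH y (T y))) (fst (DF y v)) = 0" for v
    using DH_T_orth[OF y, of v] snd_DH[OF y] by (simp add: form_cylinder)
  have 1: "\<epsilon> * ip (\<phi> y) ?X = 0"
  proof (cases "\<epsilon> = 0")
    case False
    have "ip (\<phi> z) (\<zeta> z) = 0" if "z \<in> U" for z
      using \<zeta>_tangent[OF that] False by (simp add: tspace_space_form)
    from derivative_const[OF bounded_bilinear.FDERIV[OF bil D\<phi>[OF y] D\<zeta>[OF y]] this y, of "T y"]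
    have "ip (\<phi> y) (- fst (DH y (T y))) + ip (\<zeta> y) (\<zeta> y) = 0" by (simp only: D\<phi>_T[OF y])
    then have "ip (\<phi> y) ?X = - \<omega> * \<omega> + \<epsilon> * \<omega> * \<omega> * \<epsilon>"
      using \<zeta>_norm[OF y] \<phi>_norm[OF y False] by (simp add: space_form_simps)
    also have "\<dots> = 0" using eps False by auto
    finally show ?thesis by simp
  qed simp
  have X: "?X \<in> tspace (space_form \<epsilon>) (\<phi> y)"
  proof (cases "\<epsilon> = 0")
    case True
    have "fst (\<zeta> z) = 0" if "z \<in> U" for z
      using \<zeta>_tangent[OF that] True by (simp add: tspace_space_form)
    from derivative_const[OF has_derivative_fst[OF D\<zeta>[OF y]] this y, of "T y"]
    show ?thesis using True by (simp add: tspace_space_form)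
  next
    case False
    then show ?thesis using 1 by (simp add: tspace_space_form)
  qed
  have "ipc (DH y (T y)) (?X, 0) = 0"
  proof (rule parallel[OF y])
    show "(?X, 0) \<in> tspace (cylinder \<epsilon>) (F y)" using X by (simp add: tspace_cylinder)
    fix v
    have "\<epsilon> * ip (\<phi> y) (fst (DF y v)) = 0" using \<phi>_D\<phi>[OF y] by (cases "\<epsilon> = 0") auto
    moreover have "ip ?X (fst (DF y v)) = - ip (fst (DH y (T y))) (fst (DF y v)) + \<omega> * \<omega> * (\<epsilon> * ip (\<phi> y) (fst (DF y v)))"
      by (simp add: space_form_simps)
    ultimately show "ipc (?X, 0) (DF y v) = 0" using orth[of v] by (simp add: form_cylinder)
  qed
  then have "ip (fst (DH y (T y))) ?X = 0" by (simp add: form_cylinder)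
  moreover have "ip ?X ?X = - ip (fst (DH y (T y))) ?X + \<omega> * \<omega> * (\<epsilon> * ip (\<phi> y) ?X)"
    by (simp only: bounded_bilinear.add_left[OF bil] bounded_bilinear.minus_left[OF bil] bounded_bilinear.scaleR_left[OF bil]) simp
  ultimately have "ip ?X ?X = 0" using 1 by simp
  then have "?X = 0" using posdef_ip[OF y] X unfolding inner_form_on_def by force
  then show ?thesis by (simp add: add_eq_0_iff2)
qed

text \<open>If \<open>\<omega> = 0\<close>, both \<open>\<zeta>\<close> and \<open>\<xi>\<close> vanish.\<close>

definition "\<xi> y = (1 / \<omega>) *\<^sub>R \<zeta> y"

lemma \<zeta>_eq: "y \<in> U \<Longrightarrow> \<zeta> y = \<omega> *\<^sub>R \<xi> y"
proof (cases "\<omega> = 0")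
  case True
  assume y: "y \<in> U"
  have "\<zeta> y = 0"
    using \<zeta>_norm[OF y] \<zeta>_tangent[OF y] posdef_ip[OF y] True unfolding inner_form_on_def by force
  then show ?thesis using True by simp
qed (simp add: \<xi>_def)

lemma D\<xi>: "y \<in> U \<Longrightarrow> (\<xi> has_derivative (\<lambda>v. (1 / \<omega>) *\<^sub>R - fst (DH y v))) (at y)"
  unfolding \<xi>_def[abs_def] by (intro has_derivative_scaleR_right D\<zeta>)

lemma D\<xi>_T: "y \<in> U \<Longrightarrow> (1 / \<omega>) *\<^sub>R - fst (DH y (T y)) = (- \<epsilon> * \<omega>) *\<^sub>R \<phi> y"
  by (simp only: D\<zeta>_T) simp

section \<open>Flow time and backward flow\<close>

lemma smooth_\<phi>: "smooth_on U \<phi>"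
  by (rule smooth_on_fst[OF U(1) smooth_F])

lemma smooth_\<xi>: "smooth_on U \<xi>"
  unfolding \<xi>_def[abs_def] \<zeta>_def by (intro smooth_on_scaleR smooth_on_const smooth_on_minus smooth_on_fst smooth_H U)

text \<open>The height relative to y0, divided by the vertical rate 1 - \<open>c2\<close> of dF(T),
  so that its derivative along T is 1.\<close>

definition "\<sigma> y = (snd (F y) - snd (F y0)) / (1 - c2)"

lemma smooth_\<sigma>: "smooth_on U \<sigma>"
  unfolding \<sigma>_def[abs_def] divide_inverse by (intro smooth_on_mult smooth_on_diff smooth_on_const smooth_on_snd smooth_F U)

lemma D\<sigma>: "y \<in> U \<Longrightarrow> (\<sigma> has_derivative (\<lambda>v. snd (DF y v) / (1 - c2))) (at y)"
  unfolding \<sigma>_def[abs_def] divide_inverse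
  using has_derivative_mult_left[OF has_derivative_diff[OF has_derivative_snd[OF DF] has_derivative_const]] by fastforce

lemma D\<sigma>_T: "y \<in> U \<Longrightarrow> snd (DF y (T y)) / (1 - c2) = 1"
  using c2_bounds by (simp add: DF_T snd_H dt_def)

text \<open>Moving back along the geodesic through \<open>\<phi> y\<close> with velocity \<open>\<zeta> y\<close> to the height of \<open>y0\<close>. This is
  constant along the integral curves of \<open>T\<close>, which can thus be straightened without solving a
  differential equation.\<close>

definition "\<pi> y = gcos \<epsilon> \<omega> (\<sigma> y) *\<^sub>R \<phi> y - gsin \<epsilon> \<omega> (\<sigma> y) *\<^sub>R \<xi> y"

lemma smooth_\<pi>: "smooth_on U \<pi>"
proof -
  have "smooth_on U (\<lambda>y. gcos \<epsilon> \<omega> (\<sigma> y))" "smooth_on U (\<lambda>y. gsin \<epsilon> \<omega> (\<sigma> y))"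
    by (rule smooth_on_compose[OF U(1) open_UNIV _ smooth_gcos_gsin(1)[OF eps open_UNIV] smooth_\<sigma>], simp)
      (rule smooth_on_compose[OF U(1) open_UNIV _ smooth_gcos_gsin(2)[OF eps open_UNIV] smooth_\<sigma>], simp)
  then show ?thesis
    unfolding \<pi>_def[abs_def] by (intro smooth_on_diff smooth_on_scaleR smooth_\<phi> smooth_\<xi> U)
qed

text \<open>Written in the shape that the derivative rules produce, so that introduction rules alone
  prove the differential of \<pi>.\<close>

abbreviation "D\<pi> y v \<equiv> (gcos \<epsilon> \<omega> (\<sigma> y) *\<^sub>R fst (DF y v) +
    (snd (DF y v) / (1 - c2) * ((- \<epsilon> * \<omega>) * gsin \<epsilon> \<omega> (\<sigma> y))) *\<^sub>R \<phi> y) -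
    (gsin \<epsilon> \<omega> (\<sigma> y) *\<^sub>R ((1 / \<omega>) *\<^sub>R - fst (DH y v)) +
    (snd (DF y v) / (1 - c2) * (\<omega> * gcos \<epsilon> \<omega> (\<sigma> y))) *\<^sub>R \<xi> y)"

lemma D\<pi>:
  assumes y: "y \<in> U"
  shows "(\<pi> has_derivative D\<pi> y) (at y)"
proof -
  have c: "((\<lambda>z. f (\<sigma> z)) has_derivative (\<lambda>v. snd (DF y v) / (1 - c2) * f')) (at y)"
    if "(f has_real_derivative f') (at (\<sigma> y))" for f f'
    using has_derivative_compose[OF D\<sigma>[OF y] that[unfolded has_field_derivative_def]] by (simp add: mult.commute)
  show ?thesis
    unfolding \<pi>_def[abs_def]
    by (intro has_derivative_diff has_derivative_scaleR D\<phi>[OF y] D\<xi>[OF y] c gcos_gsin[OF eps])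
qed

lemma D\<pi>_T: "y \<in> U \<Longrightarrow> D\<pi> y (T y) = 0"
  by (simp only: D\<sigma>_T D\<xi>_T D\<phi>_T) (simp add: \<zeta>_eq mult.commute mult.left_commute)

end

section \<open>Coordinates in which T is the last coordinate field\<close>

context parallel_chart
begin

text \<open>The differential of \<sigma> at y0 is nonzero, so its kernel is a hyperplane of
  \<open>'e \<times> real\<close> and has the dimension of \<open>'e\<close>, the future model space
  of N.\<close>

lemma kernel_parametrization:
  obtains J :: "'e \<Rightarrow> 'e \<times> real" where "linear J" "inj J" "range J = {u. snd (DF y0 u) / (1 - c2) = 0}"
proof -
  let ?l = "\<lambda>u. snd (DF y0 u) / (1 - c2)"
  have lin: "linear ?l" using has_derivative_linear[OF D\<sigma>[OF U(3)]] .
  define a where "a = (\<Sum>b\<in>Basis. ?l b *\<^sub>R b)"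
  have l: "?l u = a \<bullet> u" for u
    unfolding linear_eq_sum_Basis[OF lin, of u] a_def inner_sum_left inner_scaleR_left
    by (rule sum.cong) (simp_all add: inner_commute)
  have "a \<noteq> 0" using D\<sigma>_T[OF U(3)] l[of "T y0"] by auto
  then have "dim {u. a \<bullet> u = 0} = dim (UNIV :: 'e set)" by (simp add: dim_hyperplane)
  with isometries_subspaces[OF subspace_UNIV subspace_hyperplane[of a]]
  obtain J :: "'e \<Rightarrow> 'e \<times> real" and g where J: "linear J" "range J = {u. a \<bullet> u = 0}" "\<And>x. g (J x) = x"
    by (metis UNIV_I)
  show thesis
    by (rule that[OF J(1)]) (use J(2,3) l in \<open>auto intro: inj_on_inverseI\<close>)
qed

text \<open>\<pi> has values in a larger space, so it is followed by a left inverse L of its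
  differential on the kernel of d\<sigma>. The differential of (L \<circ> \<pi>, \<sigma>) sends T
  to (0, 1) and is injective at y0, and the inverse function theorem applies.\<close>

lemma straightening:
  obtains x0 :: 'e and r U' \<Theta> G where "r > 0" "open U'" "U' \<subseteq> U" "y0 \<in> U'"
    "homeomorphism U' (ball x0 r \<times> {-r<..<r}) \<Theta> G" "smooth_on U' \<Theta>" "smooth_on (ball x0 r \<times> {-r<..<r}) G"
    "\<Theta> y0 = (x0, 0)" "\<And>z. z \<in> ball x0 r \<times> {-r<..<r} \<Longrightarrow> fd G z (0, 1) = T (G z)"
    "\<And>z. z \<in> ball x0 r \<times> {-r<..<r} \<Longrightarrow> inj (fd G z)"
    "\<And>z. z \<in> ball x0 r \<times> {-r<..<r} \<Longrightarrow> \<sigma> (G z) = snd z"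
proof -
  obtain J :: "'e \<Rightarrow> 'e \<times> real" where J: "linear J" "inj J" "range J = {u. snd (DF y0 u) / (1 - c2) = 0}"
    by (rule kernel_parametrization)
  have lin_\<pi>: "linear (D\<pi> y0)" by (rule has_derivative_linear[OF D\<pi>[OF U(3)]])
  have "inj (\<lambda>x. D\<pi> y0 (J x))"
    unfolding linear_injective_0[OF linear_compose[OF J(1) lin_\<pi>, unfolded comp_def]]
  proof (intro allI impI)
    \<comment> \<open>At y0 the flow time is 0, so on the kernel of d\<sigma> the differential of
      \<pi> is that of \<phi>; there the vertical component of dF vanishes as well.\<close>
    fix x assume 0: "D\<pi> y0 (J x) = 0"
    have "J x \<in> range J" by simp
    then have s: "snd (DF y0 (J x)) = 0" using J(3) c2_bounds by auto
    have "\<sigma> y0 = 0" by (simp add: \<sigma>_def)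
    with 0 s have "fst (DF y0 (J x)) = 0" by (simp add: gcos_gsin[OF eps])
    with s have "DF y0 (J x) = 0" by (simp add: prod_eq_iff)
    then have "J x = 0" using inj_F[OF U(3)] linear_injective_0[OF linear_DF[OF U(3)]] by blast
    then show "x = 0" using J(2) linear_injective_0[OF J(1)] by blast
  qed
  then obtain L :: "real \<times> 'v \<Rightarrow> 'e" where L: "linear L" "\<And>x. L (D\<pi> y0 (J x)) = x"
    using linear_injective_left_inverse[OF linear_compose[OF J(1) lin_\<pi>, unfolded comp_def]]
    by (auto simp: fun_eq_iff)
  have bl: "bounded_linear L" using L(1) by (simp add: linear_conv_bounded_linear)
  define \<Theta> where "\<Theta> y = (L (\<pi> y), \<sigma> y)" for y
  have smooth: "smooth_on U \<Theta>"
    unfolding \<Theta>_def[abs_def] by (intro smooth_on_Pair smooth_on_bounded_linear[OF U(1) bl] smooth_\<pi> smooth_\<sigma> U)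
  have D\<Theta>: "(\<Theta> has_derivative (\<lambda>v. (L (D\<pi> y v), snd (DF y v) / (1 - c2)))) (at y)" if "y \<in> U" for y
    unfolding \<Theta>_def[abs_def]
    by (rule has_derivative_Pair[OF bounded_linear.has_derivative[OF bl D\<pi>[OF that]] D\<sigma>[OF that]])
  have D\<Theta>_T: "fd \<Theta> y (T y) = (0, 1)" if "y \<in> U" for y
    unfolding frechet_derivative_eqI[OF D\<Theta>[OF that]] D\<pi>_T[OF that] linear_0[OF L(1)]
    unfolding D\<sigma>_T[OF that] ..
  have "inj (fd \<Theta> y0)"
    unfolding frechet_derivative_eqI[OF D\<Theta>[OF U(3)]] linear_injective_0[OF has_derivative_linear[OF D\<Theta>[OF U(3)]]]
  proof (intro allI impI)
    fix u assume u: "(L (D\<pi> y0 u), snd (DF y0 u) / (1 - c2)) = 0"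
    then have "u \<in> range J" using J(3) by (simp add: zero_prod_def)
    then obtain x where x: "u = J x" by blast
    then have "x = 0" using u L(2)[of x] by (simp add: zero_prod_def)
    then show "u = 0" using x linear_0[OF J(1)] by simp
  qed
  from smooth_inverse_function[OF U(1) smooth U(3) this]
  obtain U1 V G where 1: "open U1" "U1 \<subseteq> U" "y0 \<in> U1" "open V" "\<Theta> y0 \<in> V" "homeomorphism U1 V \<Theta> G"
    "smooth_on V G" by metis
  define x0 where "x0 = L (\<pi> y0)"
  have x0: "\<Theta> y0 = (x0, 0)" by (simp add: \<Theta>_def x0_def \<sigma>_def)
  \<comment> \<open>The image is shrunk to a ball times an interval around 0, to match the product
    of N and I in the construction.\<close>
  obtain A B where AB: "open A" "open B" "x0 \<in> A" "0 \<in> B" "A \<times> B \<subseteq> V"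
    using open_prod_elim[OF 1(4,5)] x0 by (metis mem_Sigma_iff)
  obtain r1 r2 where r: "r1 > 0" "ball x0 r1 \<subseteq> A" "r2 > 0" "ball 0 r2 \<subseteq> B"
    using AB by (metis openE)
  define r where "r = min r1 r2"
  let ?I = "{-r<..<r}"
  let ?Box = "ball x0 r \<times> ?I"
  have "?Box \<subseteq> ball x0 r1 \<times> ball 0 r2" by (auto simp: r_def dist_real_def)
  then have Box: "?Box \<subseteq> V" using r AB(5) by blast
  have oBox: "open ?Box" by (intro open_Times) auto
  have rpos: "r > 0" using r by (simp add: r_def)
  have y0Box: "\<Theta> y0 \<in> ?Box" using x0 rpos by simp
  let ?U' = "U1 \<inter> \<Theta> -` ?Box"
  have cont: "continuous_on U1 \<Theta>" using 1(6) by (simp add: homeomorphism_def)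
  have o: "open ?U'" by (rule continuous_open_preimage[OF cont 1(1) oBox])
  have im: "\<Theta> ` ?U' = ?Box"
  proof
    show "?Box \<subseteq> \<Theta> ` ?U'"
    proof
      fix z assume z: "z \<in> ?Box"
      then have "z \<in> V" using Box by blast
      then have "G z \<in> U1" "\<Theta> (G z) = z" using 1(6) by (auto simp: homeomorphism_def)
      then show "z \<in> \<Theta> ` ?U'" using z by (intro image_eqI[of z \<Theta> "G z"]) auto
    qed
  qed auto
  have hom: "homeomorphism ?U' ?Box \<Theta> G"
    by (rule homeomorphism_of_subsets[OF 1(6) _ Box im]) auto
  have G: "smooth_on ?Box G" by (rule smooth_on_subset[OF 1(7) Box])
  have GU: "G z \<in> ?U'" if "z \<in> ?Box" for z using hom that by (auto simp: homeomorphism_def)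
  \<comment> \<open>Inverse maps have inverse differentials: D1 carries the image (0, 1) of T back
    to T, and D2 makes the differential of G injective.\<close>
  have D1: "fd G z (fd \<Theta> (G z) v) = v"
    and D2: "fd \<Theta> (G z) (fd G z v) = v" if z: "z \<in> ?Box" for z v
  proof -
    have y: "G z \<in> U" "G z \<in> ?U'" using GU[OF z] 1(2) by auto
    have \<Theta>G: "\<Theta> (G z) = z" if "z \<in> ?Box" for z by (rule homeomorphism_apply2[OF hom that])
    have DG: "(G has_derivative fd G z) (at z)" by (rule smooth_on_has_derivative[OF G z])
    have DT: "(\<Theta> has_derivative fd \<Theta> (G z)) (at (G z))"
      by (rule smooth_on_has_derivative[OF smooth y(1)])
    have "((\<lambda>v. v) has_derivative fd G z \<circ> fd \<Theta> (G z)) (at (G z))"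
    proof (rule has_derivative_transform_within_open[OF diff_chain_at[OF DT] o y(2)])
      show "(G has_derivative fd G z) (at (\<Theta> (G z)))" unfolding \<Theta>G[OF z] by (rule DG)
      show "(G \<circ> \<Theta>) x = x" if "x \<in> ?U'" for x using homeomorphism_apply1[OF hom that] by simp
    qed
    then have "fd G z \<circ> fd \<Theta> (G z) = (\<lambda>v. v)"
      by (rule has_derivative_unique) (rule has_derivative_ident)
    from fun_cong[OF this, of v]
    show "fd G z (fd \<Theta> (G z) v) = v" by simp
    have "((\<lambda>v. v) has_derivative fd \<Theta> (G z) \<circ> fd G z) (at z)"
      by (rule has_derivative_transform_within_open[OF diff_chain_at[OF DG DT] oBox z]) (simp add: \<Theta>G)
    then have "fd \<Theta> (G z) \<circ> fd G z = (\<lambda>v. v)"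
      by (rule has_derivative_unique) (rule has_derivative_ident)
    from fun_cong[OF this, of v]
    show "fd \<Theta> (G z) (fd G z v) = v" by simp
  qed
  show thesis
  proof (rule that[OF rpos o _ _ hom _ G x0])
    show "?U' \<subseteq> U" "y0 \<in> ?U'" using 1(2,3) y0Box by auto
    then show "smooth_on ?U' \<Theta>" using smooth_on_subset[OF smooth] by blast
    fix z assume z: "z \<in> ?Box"
    have "G z \<in> U" using GU[OF z] 1(2) by blast
    from D1[OF z, of "T (G z)"] show "fd G z (0, 1) = T (G z)"
      unfolding D\<Theta>_T[OF \<open>G z \<in> U\<close>] .
    show "inj (fd G z)" by (rule inj_on_inverseI) (rule D2[OF z])
    have "\<Theta> (G z) = z" by (rule homeomorphism_apply2[OF hom z])
    from arg_cong[where f = snd, OF this] show "\<sigma> (G z) = snd z" by (simp add: \<Theta>_def)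
  qed
qed

end

locale straightened_chart = parallel_chart \<epsilon> U F H T y0
  for \<epsilon> and U :: "('e::euclidean_space \<times> real) set"
    and F H :: "'e \<times> real \<Rightarrow> (real \<times> 'v::euclidean_space) \<times> real" and T y0 +
  fixes x0 :: 'e and r :: real and G :: "'e \<times> real \<Rightarrow> 'e \<times> real"
  assumes r: "r > 0" and G_U: "\<And>z. z \<in> ball x0 r \<times> {-r<..<r} \<Longrightarrow> G z \<in> U"
    and smooth_G: "smooth_on (ball x0 r \<times> {-r<..<r}) G"
    and DG_T: "\<And>z. z \<in> ball x0 r \<times> {-r<..<r} \<Longrightarrow> fd G z (0, 1) = T (G z)"
    and inj_DG: "\<And>z. z \<in> ball x0 r \<times> {-r<..<r} \<Longrightarrow> inj (fd G z)"
    and \<sigma>_G: "\<And>z. z \<in> ball x0 r \<times> {-r<..<r} \<Longrightarrow> \<sigma> (G z) = snd z"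
begin

abbreviation "I \<equiv> {-r<..<r}"
abbreviation "X \<equiv> ball x0 r"
abbreviation "DG z \<equiv> fd G z"

lemma DG: "z \<in> X \<times> I \<Longrightarrow> (G has_derivative DG z) (at z)"
  using smooth_on_has_derivative smooth_G by blast

lemma open_box: "open (X \<times> I)" by (intro open_Times) auto

lemma snd_F_G: "z \<in> X \<times> I \<Longrightarrow> snd (F (G z)) = (1 - c2) * snd z + snd (F y0)"
  using \<sigma>_G[of z] c2_bounds by (simp add: \<sigma>_def field_simps)

definition g :: "'e \<Rightarrow> real \<times> 'v" where "g x = \<phi> (G (x, 0))"
definition \<xi>1 :: "'e \<Rightarrow> real \<times> 'v" where "\<xi>1 x = \<xi> (G (x, 0))"

lemma along_T:
  assumes "(f has_derivative f') (at (G (x, s)))" "x \<in> X" "s \<in> I"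
  shows "((\<lambda>s. f (G (x, s))) has_derivative (\<lambda>h. h *\<^sub>R f' (T (G (x, s))))) (at s)"
proof -
  have z: "(x, s) \<in> X \<times> I" using assms by simp
  have "((\<lambda>s. (x, s)) has_derivative (\<lambda>h. (0, h))) (at s)"
    by (intro has_derivative_Pair has_derivative_const has_derivative_ident)
  from has_derivative_compose[OF has_derivative_compose[OF this DG[OF z]] assms(1)]
  have "((\<lambda>s. f (G (x, s))) has_derivative (\<lambda>h. f' (DG (x, s) (0, h)))) (at s)" .
  moreover have "f' (DG (x, s) (0, h)) = h *\<^sub>R f' (T (G (x, s)))" for h
  proof -
    have "DG (x, s) (0, h) = h *\<^sub>R DG (x, s) (0, 1)"
      using linear_scale[OF has_derivative_linear[OF DG[OF z]], of h "(0, 1)"] by simp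
    then show ?thesis
      by (simp add: DG_T[OF z] linear_scale[OF has_derivative_linear[OF assms(1)]])
  qed
  ultimately show ?thesis by simp
qed

text \<open>Along T the pair (\<phi>, \<xi>) solves u' = \<omega> v, v' = - \<epsilon> \<omega> u.
  In place of a uniqueness theorem, the pair turned back by the parameter s is shown to have
  derivative zero; \<open>gcos_gsin(3)\<close> then recovers \<phi>.\<close>

lemma \<phi>_G:
  assumes x: "x \<in> X" and s: "s \<in> I"
  shows "\<phi> (G (x, s)) = gcos \<epsilon> \<omega> s *\<^sub>R g x + gsin \<epsilon> \<omega> s *\<^sub>R \<xi>1 x"
proof -
  let ?c = "gcos \<epsilon> \<omega>" and ?s = "gsin \<epsilon> \<omega>" and ?u = "\<lambda>s. \<phi> (G (x, s))" and ?v = "\<lambda>s. \<xi> (G (x, s))"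
  have u: "(?u has_derivative (\<lambda>h. h *\<^sub>R (\<omega> *\<^sub>R ?v s))) (at s)"
    and v: "(?v has_derivative (\<lambda>h. h *\<^sub>R ((- \<epsilon> * \<omega>) *\<^sub>R ?u s))) (at s)" if "s \<in> I" for s
  proof -
    have y: "G (x, s) \<in> U" using G_U x that by simp
    show "(?u has_derivative (\<lambda>h. h *\<^sub>R (\<omega> *\<^sub>R ?v s))) (at s)"
      using along_T[OF D\<phi>[OF y] x that] unfolding D\<phi>_T[OF y] \<zeta>_eq[OF y] .
    show "(?v has_derivative (\<lambda>h. h *\<^sub>R ((- \<epsilon> * \<omega>) *\<^sub>R ?u s))) (at s)"
      using along_T[OF D\<xi>[OF y] x that] unfolding D\<xi>_T[OF y] .
  qed
  have c: "(?c has_derivative (\<lambda>h. h * (- \<epsilon> * \<omega> * ?s s))) (at s)"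
    and s': "(?s has_derivative (\<lambda>h. h * (\<omega> * ?c s))) (at s)" for s
    unfolding mult_commute_abs using gcos_gsin(1,2)[OF eps, of \<omega> s] by (simp_all only: has_field_derivative_def)
  have const: "f s = f 0" if "\<And>s. s \<in> I \<Longrightarrow> (f has_derivative (\<lambda>h. 0)) (at s)" for f :: "real \<Rightarrow> real \<times> 'v"
  proof -
    have "\<exists>c. \<forall>x\<in>I. f x = c"
      by (rule has_derivative_zero_constant[OF _ has_derivative_at_withinI[OF that]]) auto
    then show ?thesis using s r by auto
  qed
  have "?c s *\<^sub>R ?u s - ?s s *\<^sub>R ?v s = ?c 0 *\<^sub>R ?u 0 - ?s 0 *\<^sub>R ?v 0"
  proof (rule const)
    fix s assume "s \<in> I"
    from has_derivative_diff[OF has_derivative_scaleR[OF c u[OF this]] has_derivative_scaleR[OF s' v[OF this]]]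
    show "((\<lambda>s. ?c s *\<^sub>R ?u s - ?s s *\<^sub>R ?v s) has_derivative (\<lambda>h. 0)) (at s)"
      by (simp add: algebra_simps)
  qed
  then have 1: "?c s *\<^sub>R ?u s - ?s s *\<^sub>R ?v s = g x" by (simp add: gcos_gsin[OF eps] g_def)
  have "(\<epsilon> * ?s s) *\<^sub>R ?u s + ?c s *\<^sub>R ?v s = (\<epsilon> * ?s 0) *\<^sub>R ?u 0 + ?c 0 *\<^sub>R ?v 0"
  proof (rule const)
    fix s assume "s \<in> I"
    from has_derivative_add[OF has_derivative_scaleR[OF has_derivative_mult_right[OF s', of \<epsilon>] u[OF this]] has_derivative_scaleR[OF c v[OF this]]]
    show "((\<lambda>s. (\<epsilon> * ?s s) *\<^sub>R ?u s + ?c s *\<^sub>R ?v s) has_derivative (\<lambda>h. 0)) (at s)"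
      by (simp add: algebra_simps)
  qed
  then have 2: "(\<epsilon> * ?s s) *\<^sub>R ?u s + ?c s *\<^sub>R ?v s = \<xi>1 x" by (simp add: gcos_gsin[OF eps] \<xi>1_def)
  have "?c s *\<^sub>R g x + ?s s *\<^sub>R \<xi>1 x = (?c s * ?c s + \<epsilon> * ?s s * ?s s) *\<^sub>R ?u s"
    unfolding 1[symmetric] 2[symmetric] by (simp add: algebra_simps)
  then show ?thesis by (simp add: gcos_gsin(3)[OF eps])
qed

end

section \<open>The local normal form\<close>

lemma cinv_id: "y \<in> S \<Longrightarrow> cinv (S, \<lambda>x. x) y = y"
  using f_inv_into_f[of y "\<lambda>x. x" S] by simp

lemma dmap_id: "open S \<Longrightarrow> x \<in> S \<Longrightarrow> dmap (S, \<lambda>x. x) f x = fd f x"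
  using frechet_derivative_cong_open[of S x "f \<circ> cinv (S, \<lambda>x. x)" f] cinv_id[of _ S]
  by (simp add: dmap_def[abs_def])

lemma smooth_map_id:
  assumes "open S" "charts M = {(S, \<lambda>x. x)}"
  shows "smooth_map M f \<longleftrightarrow> smooth_on S f"
proof -
  have "smooth_on S (f \<circ> cinv (S, \<lambda>x. x)) \<longleftrightarrow> smooth_on S f"
    using smooth_on_cong[OF assms(1), of "f \<circ> cinv (S, \<lambda>x. x)" f] smooth_on_cong[OF assms(1), of f "f \<circ> cinv (S, \<lambda>x. x)"]
      cinv_id[of _ S] by auto
  then show ?thesis using assms(2) by (simp add: smooth_map_def)
qed

lemma atlas_id: "open S \<Longrightarrow> atlas {(S, \<lambda>x. x)}"
  unfolding atlas_def
  by (auto intro!: smooth_on_cong[OF _ _ smooth_on_ident] simp: f_inv_into_f[of _ "\<lambda>x. x", simplified])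

lemma second_countable_euclidean: "second_countable (euclidean :: 'a::second_countable_topology topology)"
proof -
  obtain \<B> :: "'a set set" where \<B>: "countable \<B>" "topological_basis \<B>"
    using ex_countable_basis by blast
  have "\<exists>V\<in>\<B>. x \<in> V \<and> V \<subseteq> S" if "open S" "x \<in> S" for S x
    by (rule topological_basisE[OF \<B>(2) that]) (intro bexI conjI)
  with \<B> show ?thesis
    unfolding second_countable_def by (intro exI[of _ \<B>]) (auto intro: topological_basis_open)
qed

lemma open_subset_manifold:
  fixes S :: "'e::euclidean_space set"
  assumes "open S"
  shows "is_manifold \<lparr>topo = top_of_set S, charts = {(S, \<lambda>x. x)}\<rparr>"
  unfolding is_manifold_def
proof (intro conjI ballI)
  show "\<exists>B::'e set. finite B \<and> span B = UNIV" using finite_Basis span_Basis by blast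
  show "Hausdorff_space (topo \<lparr>topo = top_of_set S, charts = {(S, \<lambda>x. x)}\<rparr>)"
    by (simp add: Hausdorff_space_subtopology Hausdorff_space_euclidean)
  show "second_countable (topo \<lparr>topo = top_of_set S, charts = {(S, \<lambda>x. x)}\<rparr>)"
    by (simp add: second_countable_subtopology second_countable_euclidean)
  fix c d assume cd: "c \<in> charts \<lparr>topo = top_of_set S, charts = {(S, \<lambda>x. x)}\<rparr>" "d \<in> charts \<lparr>topo = top_of_set S, charts = {(S, \<lambda>x. x)}\<rparr>"
  have "homeomorphic_map (top_of_set S) (top_of_set S) (\<lambda>x. x)"
    using homeomorphic_map_id[of "top_of_set S" "top_of_set S"] by (simp add: id_def)
  with cd assms atlas_id[OF assms] show "openin (topo \<lparr>topo = top_of_set S, charts = {(S, \<lambda>x. x)}\<rparr>) (fst c)" "open (cimage c)"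
    "homeomorphic_map (subtopology (topo \<lparr>topo = top_of_set S, charts = {(S, \<lambda>x. x)}\<rparr>) (fst c)) (top_of_set (cimage c)) (snd c)"
    "smooth_on (snd c ` (fst c \<inter> fst d)) (snd d \<circ> cinv c)"
    by (auto simp: subtopology_subtopology atlas_def)
qed auto

text \<open>The index for the coordinate map is ignored: the metric is meant for manifolds whose
  only coordinate map is the identity.\<close>

definition induced_metric :: "'w ambient \<Rightarrow> ('e::real_normed_vector \<Rightarrow> 'w::real_normed_vector) \<Rightarrow> ('e, 'e) metric" where
  "induced_metric A f = (\<lambda>_ x u v. form A (fd f x u) (fd f x v))"

lemma induced_metric:
  fixes f :: "'e::euclidean_space \<Rightarrow> 'w::euclidean_space"
  assumes S: "open S" and M: "charts M = {(S, \<lambda>x. x)}" "topspace (topo M) = S"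
    and f: "smooth_on S f" "\<And>x. x \<in> S \<Longrightarrow> f x \<in> points A" "\<And>x. x \<in> S \<Longrightarrow> inj (fd f x)"
    and A: "bounded_bilinear (form A)" "\<And>x. x \<in> S \<Longrightarrow> inner_form_on (form A) (tspace A (f x))"
    and tangent: "\<And>x u. x \<in> S \<Longrightarrow> fd f x u \<in> tspace A (f x)"
  shows "riemannian_metric M (induced_metric A f)" "isometric_immersion A M (induced_metric A f) f"
proof -
  have at: "atlas (charts M)" unfolding M by (rule atlas_id[OF S])
  note D = dmap_id[OF S]
  have lin: "linear (fd f x)" if "x \<in> S" for x
    using smooth_on_has_derivative[OF f(1) that] has_derivative_linear by blast
  have smooth: "smooth_map M f" by (rule smooth_map_id[OF S M(1), THEN iffD2, OF f(1)])
  have reg: "regular_points M f = topspace (topo M)"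
  proof -
    have "x \<in> regular_points M f" if x: "x \<in> S" for x
      using regular_points_chart[OF at _ _ smooth, of "(S, \<lambda>x. x)" x] M x f(3) by (simp add: D[OF x])
    then show ?thesis by (auto simp: regular_points_def M(2))
  qed
  show "isometric_immersion A M (induced_metric A f) f"
    unfolding isometric_immersion_def immersion_def
    using smooth f(2) reg by (auto simp: M D induced_metric_def)
  show "riemannian_metric M (induced_metric A f)"
    unfolding riemannian_metric_def
  proof (intro conjI ballI allI impI)
    fix c x assume c: "c \<in> charts M" "x \<in> fst c"
    then have x: "x \<in> S" by (simp add: M)
    have B: "bilinear (form A)" "\<And>x y. form A x y = form A y x"
      using A(2)[OF x] by (simp_all add: inner_form_on_def)
    show "bilinear (induced_metric A f (snd c) x)"
      unfolding induced_metric_def bilinear_def using lin[OF x] B(1)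
      by (auto intro!: linearI simp: linear_add linear_scale bilinear_ladd bilinear_radd bilinear_lmul bilinear_rmul)
    show "induced_metric A f (snd c) x u v = induced_metric A f (snd c) x v u" for u v
      unfolding induced_metric_def by (rule B(2))
    show "induced_metric A f (snd c) x u u > 0" if "u \<noteq> 0" for u
    proof -
      have "fd f x u \<noteq> 0"
        using that linear_injective_0[OF lin[OF x]] f(3)[OF x] by blast
      then show ?thesis
        using tangent[OF x, of u] A(2)[OF x] by (simp add: induced_metric_def inner_form_on_def)
    qed
  next
    fix c u v assume c: "c \<in> charts M"
    have "smooth_on S (\<lambda>y. form A (fd f y u) (fd f y v))"
      by (intro smooth_on_bilinear[OF S A(1)] smooth_on_derivative f(1))
    then have "smooth_on S (\<lambda>y. induced_metric A f (\<lambda>x. x) (cinv (S, \<lambda>x. x) y) u v)"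
      by (rule smooth_on_cong[OF S, rotated]) (simp add: induced_metric_def cinv_id del: fst_conv snd_conv)
    then show "smooth_on (cimage c) (\<lambda>y. induced_metric A f (snd c) (cinv c y) u v)"
      using c by (simp add: M)
  next
    fix c d x u v assume c: "c \<in> charts M" "d \<in> charts M" "x \<in> fst c \<inter> fst d"
    then have "c = d" "x \<in> fst c" by (auto simp: M)
    then show "induced_metric A f (snd c) x u v = induced_metric A f (snd d) x (dmap c (snd d) x u) (dmap c (snd d) x v)"
      using dmap_chart_self[OF at c(1)] by simp
  qed
qed

context parallel_chart
begin

lemma D\<phi>_tangent:
  assumes y: "y \<in> U"
  shows "fst (DF y u) \<in> tspace (space_form \<epsilon>) (\<phi> y)"
proof (cases "\<epsilon> = 0")
  case True
  have "fst (fst (DF y u)) = 0"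
    by (rule derivative_const[OF has_derivative_fst[OF D\<phi>[OF y]] _ y, of 0])
       (use F_points True in \<open>auto simp: points_cylinder points_space_form mem_Times_iff\<close>)
  then show ?thesis using True by (simp add: tspace_space_form)
qed (use \<phi>_D\<phi>[OF y] in \<open>simp add: tspace_space_form\<close>)

lemma DF_tangent: "y \<in> U \<Longrightarrow> DF y u \<in> tspace (cylinder \<epsilon>) (F y)"
  using D\<phi>_tangent by (simp add: tspace_cylinder mem_Times_iff)

lemma \<xi>_tangent: "y \<in> U \<Longrightarrow> \<xi> y \<in> tspace (space_form \<epsilon>) (\<phi> y)"
  unfolding \<xi>_def using \<zeta>_tangent posdef_ip by (intro subspace_scale) (auto simp: inner_form_on_def)

lemma \<xi>_unit: "y \<in> U \<Longrightarrow> \<omega> \<noteq> 0 \<Longrightarrow> ip (\<xi> y) (\<xi> y) = 1"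
  using \<zeta>_norm[of y] by (simp add: \<xi>_def space_form_simps)

end

section \<open>The model curve and the slice of fixed height\<close>

context straightened_chart
begin

definition kk :: nat where "kk = (if \<omega> = 0 then 0 else 1)"

text \<open>The test for \<open>kk + 1\<close> precedes that for 1, because the height component has
  index 1 when \<open>kk\<close> = 0. For \<epsilon> = 0 the entry 0 vanishes, as
  \<open>coord_cylinder\<close> demands.\<close>

definition \<alpha> :: "real \<Rightarrow> nat \<Rightarrow> real" where
  "\<alpha> s i = (if i = 0 then (if \<epsilon> = 0 then 0 else gcos \<epsilon> \<omega> s) else if i = kk + 1 then (1 - c2) * s
    else if i = 1 then gsin \<epsilon> \<omega> s else 0)"

abbreviation "N \<equiv> \<lparr>topo = top_of_set X, charts = {(X, \<lambda>x. x)}\<rparr>"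
abbreviation "C \<equiv> construction \<epsilon> kk g (\<lambda>_. \<xi>1) \<alpha>"

lemma construction_G:
  assumes z: "z \<in> X \<times> I"
  shows "F (G z) = C z + snd (F y0) *\<^sub>R dt"
proof -
  obtain x s where xs: "z = (x, s)" "x \<in> X" "s \<in> I" using z by auto
  have "C z = (gcos \<epsilon> \<omega> s *\<^sub>R g x + gsin \<epsilon> \<omega> s *\<^sub>R \<xi>1 x, (1 - c2) * s)"
    unfolding construction_def xs(1) case_prod_conv sum_frame_field
    \<comment> \<open>If \<open>kk\<close> = 0 the sum has no \<xi>1 term, and \<open>gsin\<close>
      vanishes since \<omega> = 0; if \<epsilon> = 0 the coefficient 1 of g equals
      \<open>gcos\<close>.\<close>
    using gcos_gsin(7,9)[OF eps] by (auto simp: \<alpha>_def kk_def)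
  then show ?thesis
    using \<phi>_G[OF xs(2,3)] snd_F_G[OF z] by (simp add: prod_eq_iff xs(1) dt_def)
qed

lemma DC:
  assumes z: "z \<in> X \<times> I"
  shows "fd C z = (\<lambda>w. DF (G z) (DG z w))"
proof (rule frechet_derivative_eqI)
  have 1: "((\<lambda>z. F (G z) - snd (F y0) *\<^sub>R dt) has_derivative (\<lambda>w. DF (G z) (DG z w) - 0)) (at z)"
    by (intro has_derivative_diff has_derivative_const has_derivative_compose[OF DG[OF z] DF[OF G_U[OF z]]])
  have "(C has_derivative (\<lambda>w. DF (G z) (DG z w) - 0)) (at z)"
    by (rule has_derivative_transform_within_open[OF 1 open_box z]) (simp add: construction_G)
  then show "(C has_derivative (\<lambda>w. DF (G z) (DG z w))) (at z)" by simp
qed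

lemma smooth_C: "smooth_on (X \<times> I) C"
proof (rule smooth_on_cong[OF open_box])
  show "smooth_on (X \<times> I) (\<lambda>z. F (G z) - snd (F y0) *\<^sub>R dt)"
    by (intro smooth_on_diff smooth_on_const open_box smooth_on_compose[OF open_box U(1) G_U smooth_F smooth_G])
qed (simp add: construction_G)

lemma slice: "x \<in> X \<Longrightarrow> (x, 0) \<in> X \<times> I"
  using r by simp

lemma smooth_slice:
  assumes "smooth_on U f"
  shows "smooth_on X (\<lambda>x. f (G (x, 0)))"
proof -
  have "smooth_on X (\<lambda>x. (x, 0::real))"
    by (intro smooth_on_Pair smooth_on_ident smooth_on_const) auto
  from smooth_on_compose[OF _ open_box _ smooth_G this] have "smooth_on X (\<lambda>x. G (x, 0))" using slice by simp
  from smooth_on_compose[OF _ U(1) _ assms this] show ?thesis using G_U slice by simp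
qed

lemma smooth_g: "smooth_on X g" and smooth_\<xi>1: "smooth_on X \<xi>1"
  unfolding g_def[abs_def] \<xi>1_def[abs_def] by (rule smooth_slice[OF smooth_\<phi>], rule smooth_slice[OF smooth_\<xi>])

lemma D_slice:
  assumes "(f has_derivative f') (at (G (x, 0)))" "x \<in> X"
  shows "fd (\<lambda>x. f (G (x, 0))) x = (\<lambda>u. f' (DG (x, 0) (u, 0)))"
proof (rule frechet_derivative_eqI)
  have "((\<lambda>x. (x, 0::real)) has_derivative (\<lambda>u. (u, 0))) (at x)"
    by (intro has_derivative_Pair has_derivative_const has_derivative_ident)
  from has_derivative_compose[OF has_derivative_compose[OF this DG[OF slice[OF assms(2)]]] assms(1)]
  show "((\<lambda>x. f (G (x, 0))) has_derivative (\<lambda>u. f' (DG (x, 0) (u, 0)))) (at x)" .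
qed

lemma Dg: "x \<in> X \<Longrightarrow> fd g x = (\<lambda>u. fst (DF (G (x, 0)) (DG (x, 0) (u, 0))))"
  unfolding g_def[abs_def] by (rule D_slice[OF D\<phi>[OF G_U[OF slice]]])

lemma D\<xi>1: "x \<in> X \<Longrightarrow> fd \<xi>1 x = (\<lambda>u. (1 / \<omega>) *\<^sub>R - fst (DH (G (x, 0)) (DG (x, 0) (u, 0))))"
  unfolding \<xi>1_def[abs_def] by (rule D_slice[OF D\<xi>[OF G_U[OF slice]]])

lemma snd_DF_slice:
  assumes x: "x \<in> X"
  shows "snd (DF (G (x, 0)) (DG (x, 0) (u, 0))) = 0"
proof -
  have "(\<lambda>u. snd (DF (G (x, 0)) (DG (x, 0) (u, 0)))) = fd (\<lambda>x. snd (F (G (x, 0)))) x"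
    using D_slice[OF has_derivative_snd[OF DF[OF G_U[OF slice[OF x]]]] x] by simp
  also have "\<dots> = fd (\<lambda>x. snd (F y0)) x"
    by (rule frechet_derivative_cong_open[of X]) (use x snd_F_G[OF slice] in auto)
  finally show ?thesis by (simp add: fun_eq_iff)
qed

lemma g_points: "x \<in> X \<Longrightarrow> g x \<in> points (space_form \<epsilon>)"
  using F_points[OF G_U[OF slice]] by (simp add: g_def points_cylinder mem_Times_iff)

lemma Dg_tangent: "x \<in> X \<Longrightarrow> fd g x u \<in> tspace (space_form \<epsilon>) (g x)"
  unfolding Dg using D\<phi>_tangent[OF G_U[OF slice]] by (simp add: g_def)

text \<open>Along the slice the height is constant, so the horizontal part carries the whole of the
  injective map dF \<circ> dG.\<close>

lemma inj_Dg:
  assumes x: "x \<in> X"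
  shows "inj (fd g x)"
proof -
  have lin: "linear (fd g x)"
    by (rule has_derivative_linear[OF smooth_on_has_derivative[OF smooth_g x]])
  have y: "G (x, 0) \<in> U" by (rule G_U[OF slice[OF x]])
  show ?thesis
    unfolding linear_injective_0[OF lin]
  proof (intro allI impI)
    fix u assume "fd g x u = 0"
    then have "DF (G (x, 0)) (DG (x, 0) (u, 0)) = 0" using snd_DF_slice[OF x, of u] by (simp add: Dg[OF x] prod_eq_iff)
    then have "DG (x, 0) (u, 0) = 0" using inj_F[OF y] linear_injective_0[OF linear_DF[OF y]] by blast
    then have "(u, 0::real) = 0"
      using inj_DG[OF slice[OF x]] linear_injective_0[OF has_derivative_linear[OF DG[OF slice[OF x]]]] by blast
    then show "u = 0" by (simp add: prod_eq_iff)
  qed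
qed

lemma charts_box: "charts (times_interval N I) = {(X \<times> I, \<lambda>z. z)}"
  by (simp add: charts_times_interval id_def)

lemma topo_box: "topo (times_interval N I) = top_of_set (X \<times> I)"
  by (simp add: times_interval_def prod_topology_subtopology_eu)

lemma atlas_N: "atlas (charts N)"
  using atlas_id[of X] by simp

lemma slice_isometric: "riemannian_metric N (induced_metric (space_form \<epsilon>) g)"
  "isometric_immersion (space_form \<epsilon>) N (induced_metric (space_form \<epsilon>) g) g"
  using induced_metric[of X N g "space_form \<epsilon>"] smooth_g g_points inj_Dg bil Dg_tangent
    inner_form_on_space_form[OF eps g_points] by simp_all

lemma box_isometric: "riemannian_metric (times_interval N I) (induced_metric (cylinder \<epsilon>) C)"
  "isometric_immersion (cylinder \<epsilon>) (times_interval N I) (induced_metric (cylinder \<epsilon>) C) C"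
proof -
  \<comment> \<open>F \<circ> G and C differ by a vertical translation, which affects neither
    membership in the cylinder nor its tangent spaces.\<close>
  have F: "F (G z) \<in> points (cylinder \<epsilon>) \<longleftrightarrow> C z \<in> points (cylinder \<epsilon>)"
    "tspace (cylinder \<epsilon>) (C z) = tspace (cylinder \<epsilon>) (F (G z))" if "z \<in> X \<times> I" for z
    unfolding construction_G[OF that] by (simp_all add: points_cylinder tspace_cylinder mem_Times_iff dt_def)
  have "inj (fd C z)" if z: "z \<in> X \<times> I" for z
    unfolding DC[OF z] using inj_compose[OF inj_F[OF G_U[OF z]] inj_DG[OF z]] by (simp add: comp_def)
  note prems = open_box charts_box _ smooth_C _ this bilc
  show "riemannian_metric (times_interval N I) (induced_metric (cylinder \<epsilon>) C)"
    by (rule induced_metric(1)[OF prems])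
      (use F F_points[OF G_U] posdef[OF G_U] DF_tangent[OF G_U] DC in \<open>simp_all add: topo_box\<close>)
  show "isometric_immersion (cylinder \<epsilon>) (times_interval N I) (induced_metric (cylinder \<epsilon>) C) C"
    by (rule induced_metric(2)[OF prems])
      (use F F_points[OF G_U] posdef[OF G_U] DF_tangent[OF G_U] DC in \<open>simp_all add: topo_box\<close>)
qed

text \<open>A normal vector \<nu> of the slice need not be normal to F, as T adds the direction
  \<xi>1. Once its \<xi>1-component is removed it is, and parallelism of \<eta> applies; in the
  direction \<xi>1 the derivative has no component because \<xi>1 has unit length.\<close>

lemma parallel_\<xi>1:
  assumes "\<omega> \<noteq> 0"
  shows "parallel_normal_field (space_form \<epsilon>) N g \<xi>1"
proof -
  have smooth_map: "smooth_map N g" "smooth_map N \<xi>1"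
    using smooth_map_id[of X N g] smooth_map_id[of X N \<xi>1] smooth_g smooth_\<xi>1 by simp_all
  have D: "dmap (X, \<lambda>x. x) f x = fd f x" if "x \<in> X" for x and f :: "'e \<Rightarrow> real \<times> 'v"
    by (rule dmap_id[OF _ that]) simp
  have ns: "normal_space (space_form \<epsilon>) N g x =
    {w \<in> tspace (space_form \<epsilon>) (g x). \<forall>u. ip w (fd g x u) = 0}" if x: "x \<in> X" for x
    using normal_space_chart[OF atlas_N _ _ smooth_map(1), of "(X, \<lambda>x. x)" x "space_form \<epsilon>"] x by (simp add: D[OF x])
  have normal: "\<xi>1 x \<in> normal_space (space_form \<epsilon>) N g x" if x: "x \<in> X" for x
    unfolding ns[OF x]
  proof (intro CollectI conjI allI)
    let ?y = "G (x, 0)"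
    have y: "?y \<in> U" by (rule G_U[OF slice[OF x]])
    show "\<xi>1 x \<in> tspace (space_form \<epsilon>) (g x)" using \<xi>_tangent[OF y] by (simp add: \<xi>1_def g_def)
    fix u
    have "ipc (H ?y) (DF ?y (DG (x, 0) (u, 0))) = 0" by (rule H_normal[OF y])
    then have "ip (\<zeta> ?y) (fd g x u) = 0"
      using snd_DF_slice[OF x] by (simp add: form_cylinder Dg[OF x] \<zeta>_def space_form_simps)
    then show "ip (\<xi>1 x) (fd g x u) = 0" by (simp add: \<xi>1_def \<xi>_def space_form_simps)
  qed
  have "normal_connection (space_form \<epsilon>) N (X, \<lambda>x. x) g \<xi>1 x u = 0" if x: "x \<in> X" for x u
  proof -
    let ?y = "G (x, 0)" and ?v = "DG (x, 0) (u, 0)"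
    have y: "?y \<in> U" by (rule G_U[OF slice[OF x]])
    have "ip (fd \<xi>1 x u) \<nu> = 0" if \<nu>: "\<nu> \<in> normal_space (space_form \<epsilon>) N g x" for \<nu>
    proof -
      define t where "t = ip \<nu> (\<xi>1 x)"
      define \<nu>' where "\<nu>' = \<nu> - t *\<^sub>R \<xi>1 x"
      have sub: "subspace (tspace (space_form \<epsilon>) (g x))"
        using inner_form_on_space_form[OF eps g_points[OF x]] by (simp add: inner_form_on_def)
      have \<nu>'t: "\<nu>' \<in> tspace (space_form \<epsilon>) (g x)"
        using \<nu> normal[OF x] unfolding ns[OF x] \<nu>'_def by (intro subspace_diff subspace_scale sub) auto
      have unit: "ip (\<xi>1 z) (\<xi>1 z) = 1" if "z \<in> X" for z
        using \<xi>_unit[OF G_U[OF slice[OF that]] assms] by (simp add: \<xi>1_def)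
      have \<nu>'\<xi>: "ip \<nu>' (\<xi>1 x) = 0" using unit[OF x] by (simp add: \<nu>'_def t_def space_form_simps)
      have \<nu>'g: "ip \<nu>' (fd g x u) = 0" for u
        using \<nu> normal[OF x] unfolding ns[OF x] by (simp add: \<nu>'_def space_form_simps)
      have "ipc (DH ?y ?v) (\<nu>', 0) = 0"
      proof (rule parallel[OF y])
        show "(\<nu>', 0) \<in> tspace (cylinder \<epsilon>) (F ?y)" using \<nu>'t by (simp add: tspace_cylinder g_def)
        fix w
        \<comment> \<open>Every direction is a slice direction plus a multiple of T, and the
          horizontal part of dF(T) is a multiple of \<xi>1, to which \<open>\<nu>'\<close> is
          orthogonal.\<close>
        have "surj (DG (x, 0))"
          by (rule linear_injective_imp_surjective[OF has_derivative_linear[OF DG[OF slice[OF x]]] inj_DG[OF slice[OF x]]]) simp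
        then obtain a b where ab: "w = DG (x, 0) (a, b)" by (metis surj_def surj_pair)
        have "(a, b) = (a, 0) + b *\<^sub>R (0, 1::real)" by simp
        then have "w = DG (x, 0) (a, 0) + b *\<^sub>R T ?y"
          unfolding ab DG_T[OF slice[OF x], symmetric]
          using linear_add[OF has_derivative_linear[OF DG[OF slice[OF x]]]] linear_scale[OF has_derivative_linear[OF DG[OF slice[OF x]]]] by metis
        then have "fst (DF ?y w) = fd g x a + (b * \<omega>) *\<^sub>R \<xi>1 x"
          using linear_add[OF linear_DF[OF y]] linear_scale[OF linear_DF[OF y]] D\<phi>_T[OF y] \<zeta>_eq[OF y]
          by (simp add: Dg[OF x] \<xi>1_def)
        then show "ipc (\<nu>', 0) (DF ?y w) = 0"
          using \<nu>'g \<nu>'\<xi> by (simp add: form_cylinder space_form_simps)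
      qed
      then have 1: "ip (fd \<xi>1 x u) \<nu>' = 0"
        by (simp add: D\<xi>1[OF x] form_cylinder space_form_simps)
      have "ip (\<xi>1 x) (fd \<xi>1 x u) + ip (fd \<xi>1 x u) (\<xi>1 x) = 0"
        using dmap_bilinear_const[OF atlas_N _ _ smooth_map(2) smooth_map(2) bil, of "(X, \<lambda>x. x)" x 1 u] unit x
        by (simp add: D[OF x])
      then have 2: "ip (fd \<xi>1 x u) (\<xi>1 x) = 0"
        using form_space_form_commute[of \<epsilon> "\<xi>1 x" "fd \<xi>1 x u"] by simp
      have "\<nu> = \<nu>' + t *\<^sub>R \<xi>1 x" by (simp add: \<nu>'_def)
      then show ?thesis using 1 2 by (simp add: space_form_simps)
    qed
    then show ?thesis
      using normal_connection_eq_0_iff[where f = g and p = x and M = N, OF inner_form_on_space_form[OF eps g_points[OF x]]]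
      by (simp add: D[OF x])
  qed
  then show ?thesis
    using smooth_map normal by (simp add: parallel_normal_field_def normal_field_def)
qed

lemma smooth_\<alpha>: "smooth_on I (\<lambda>s. \<alpha> s i)"
  unfolding \<alpha>_def using smooth_gcos_gsin[OF eps, of I \<omega>]
  by (cases "i = 0"; cases "\<epsilon> = 0"; cases "i = kk + 1"; cases "i = 1")
    (simp_all add: smooth_on_const smooth_on_mult smooth_on_ident)

lemma \<alpha>_points: "\<alpha> s \<in> points (coord_cylinder \<epsilon> kk)"
proof -
  \<comment> \<open>The sum in the defining equation is then empty; \<omega> = 0 makes the
    horizontal part of the curve constant.\<close>
  have "kk = 0 \<Longrightarrow> gcos \<epsilon> \<omega> s * gcos \<epsilon> \<omega> s = 1"
    using gcos_gsin(8)[OF eps] by (simp add: kk_def split: if_splits)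
  moreover have "\<epsilon> \<noteq> 0 \<Longrightarrow> \<epsilon> * (gcos \<epsilon> \<omega> s * gcos \<epsilon> \<omega> s) + gsin \<epsilon> \<omega> s * gsin \<epsilon> \<omega> s = \<epsilon>"
    using gcos_gsin(3)[OF eps, of \<omega> s] eps by auto
  ultimately show ?thesis
    using gcos_gsin(6)[OF eps, of \<omega> s] unfolding points_coord_cylinder \<alpha>_def kk_def
    by (auto simp: mult.assoc split: if_splits)
qed

lemma deriv_\<alpha>_last: "deriv (\<lambda>r. \<alpha> r (kk + 1)) s = 1 - c2"
  unfolding \<alpha>_def by (rule DERIV_imp_deriv) (auto intro!: derivative_eq_intros)

lemma deriv_deriv_\<alpha>:
  shows "deriv (deriv (\<lambda>r. \<alpha> r (kk + 1))) s = 0"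
    and "i \<le> kk \<Longrightarrow> deriv (deriv (\<lambda>r. \<alpha> r i)) s = (- \<epsilon> * \<omega> * \<omega>) * \<alpha> s i"
proof -
  have "deriv (\<lambda>r. \<alpha> r (kk + 1)) = (\<lambda>_. 1 - c2)" using deriv_\<alpha>_last by blast
  then show "deriv (deriv (\<lambda>r. \<alpha> r (kk + 1))) s = 0" by simp
  have c: "deriv (gcos \<epsilon> \<omega>) = (\<lambda>s. (- \<epsilon> * \<omega>) * gsin \<epsilon> \<omega> s)" and s: "deriv (gsin \<epsilon> \<omega>) = (\<lambda>s. \<omega> * gcos \<epsilon> \<omega> s)"
    using DERIV_imp_deriv[OF gcos_gsin(1)[OF eps]] DERIV_imp_deriv[OF gcos_gsin(2)[OF eps]] by auto
  have c2: "deriv (deriv (gcos \<epsilon> \<omega>)) s = (- \<epsilon> * \<omega> * \<omega>) * gcos \<epsilon> \<omega> s"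
    and s2: "deriv (deriv (gsin \<epsilon> \<omega>)) s = (- \<epsilon> * \<omega> * \<omega>) * gsin \<epsilon> \<omega> s"
    unfolding c s by (rule DERIV_imp_deriv, use gcos_gsin(1,2)[OF eps] in \<open>auto intro!: derivative_eq_intros\<close>)+
  show "deriv (deriv (\<lambda>r. \<alpha> r i)) s = (- \<epsilon> * \<omega> * \<omega>) * \<alpha> s i" if "i \<le> kk"
  proof -
    have "i = 0 \<or> i = 1 \<and> kk = 1" using that unfolding kk_def by (auto split: if_splits)
    then consider "i = 0" "\<epsilon> = 0" | "i = 0" "\<epsilon> \<noteq> 0" | "i = 1" "kk = 1" by blast
    then show ?thesis
    proof cases
      case 1
      have "(\<lambda>r. \<alpha> r i) = (\<lambda>_. 0)" unfolding \<alpha>_def using 1 by simp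
      moreover have "deriv (\<lambda>_. 0 :: real) = (\<lambda>_. 0)" by auto
      ultimately show ?thesis using 1 by simp
    next
      case 2
      have "(\<lambda>r. \<alpha> r i) = gcos \<epsilon> \<omega>" "\<alpha> s i = gcos \<epsilon> \<omega> s" unfolding \<alpha>_def using 2 by auto
      then show ?thesis using c2 by simp
    next
      case 3
      have "(\<lambda>r. \<alpha> r i) = gsin \<epsilon> \<omega>" "\<alpha> s i = gsin \<epsilon> \<omega> s" unfolding \<alpha>_def using 3 by auto
      then show ?thesis using s2 by simp
    qed
  qed
qed

text \<open>The horizontal acceleration is - \<epsilon> \<omega>^2 times the position vector, hence
  normal, and the height is linear in s.\<close>

lemma geodesic_\<alpha>: "geodesic_on (coord_cylinder \<epsilon> kk) I \<alpha>"
  unfolding geodesic_on_def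
  using smooth_\<alpha> \<alpha>_points deriv_deriv_\<alpha>
  by (auto intro!: coord_orth_proj_eq_0I[OF eps, where l = "- \<epsilon> * \<omega> * \<omega>"])

lemma construction_data:
  "construction_data \<epsilon> N (induced_metric (space_form \<epsilon>) g) I kk g (\<lambda>_. \<xi>1) \<alpha>"
  unfolding construction_data_def
proof (intro conjI)
  have unit: "ip (\<xi>1 x) (\<xi>1 x) = 1" if "x \<in> X" "\<omega> \<noteq> 0" for x
    using \<xi>_unit[OF G_U[OF slice[OF that(1)]] that(2)] by (simp add: \<xi>1_def)
  show "is_manifold N" by (rule open_subset_manifold) simp
  show "\<forall>i\<in>{1..kk}. parallel_normal_field (space_form \<epsilon>) N g \<xi>1"
    using parallel_\<xi>1 by (simp add: kk_def)
  \<comment> \<open>The constant family of fields is orthonormal because at most one index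
    occurs.\<close>
  show "\<forall>x\<in>topspace (topo N). \<forall>i\<in>{1..kk}. \<forall>j\<in>{1..kk}. ip (\<xi>1 x) (\<xi>1 x) = (if i = j then 1 else 0)"
    using unit by (auto simp: kk_def)
  show "\<forall>s\<in>I. \<exists>i\<le>kk + 1. deriv (\<lambda>r. \<alpha> r i) s \<noteq> 0" "\<forall>s\<in>I. deriv (\<lambda>r. \<alpha> r (kk + 1)) s \<noteq> 0"
    using deriv_\<alpha>_last c2_bounds by (auto intro!: exI[of _ "kk + 1"])
  show "I \<noteq> {}" using r by auto
  show "is_interval I" by (simp add: is_interval_oo)
qed (use slice_isometric smooth_\<alpha> \<alpha>_points in auto)

end

section \<open>Transport of a box in coordinates to the manifold\<close>

lemma continuous_map_cinv:
  assumes M: "is_manifold M" and c: "c \<in> charts M"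
  shows "continuous_map (top_of_set (cimage c)) (topo M) (cinv c)"
  unfolding continuous_map_def
proof (intro conjI allI impI)
  note ch = manifold_chart[OF M c]
  show "cinv c \<in> topspace (top_of_set (cimage c)) \<rightarrow> topspace (topo M)"
    using openin_subset[OF ch(1)] cinv_mem(1)[of _ c] by auto
  fix V assume V: "openin (topo M) V"
  have "{y \<in> cimage c. cinv c y \<in> V} = snd c ` (V \<inter> fst c)"
  proof (intro set_eqI iffI)
    fix y assume "y \<in> {y \<in> cimage c. cinv c y \<in> V}"
    then show "y \<in> snd c ` (V \<inter> fst c)"
      using cinv_mem[of y c] by (intro image_eqI[of _ _ "cinv c y"]) auto
  qed (auto simp: inv_into_f_f[OF ch(3)])
  moreover have "open (snd c ` (V \<inter> fst c))" using V ch(1) by (intro ch(4) openin_Int) auto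
  ultimately show "openin (top_of_set (cimage c)) {y \<in> topspace (top_of_set (cimage c)). cinv c y \<in> V}"
    using ch(2) by (auto simp: openin_open_eq)
qed

text \<open>B is the box of the normal form, parametrizing a part U of the chart image; P is B as a
  manifold. Following G by the inverse chart yields the isometry \<Phi> required in
  \<open>locally_given\<close>.\<close>

locale local_parametrization =
  fixes M :: "('p, 'e::euclidean_space) manifold" and c and B U :: "'e set" and G \<Theta> :: "'e \<Rightarrow> 'e" and P :: "('e, 'e) manifold"
  assumes M: "is_manifold M" and c: "c \<in> charts M" and B: "open B" and U: "open U" "U \<subseteq> cimage c"
    and hom: "homeomorphism U B \<Theta> G" and smooth_G: "smooth_on B G" and smooth_\<Theta>: "smooth_on U \<Theta>"
    and P: "topo P = top_of_set B" "charts P = {(B, \<lambda>x. x)}"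
begin

definition \<Phi> :: "'e \<Rightarrow> 'p" where "\<Phi> z = cinv c (G z)"
definition W :: "'p set" where "W = {q \<in> fst c. snd c q \<in> U}"

lemmas ch = manifold_chart[OF M c]

lemma G_mem: "z \<in> B \<Longrightarrow> G z \<in> U" "z \<in> B \<Longrightarrow> G z \<in> cimage c"
  using hom U(2) by (auto simp: homeomorphism_def)

lemma openin_W: "openin (topo M) W"
  unfolding W_def by (rule ch(5)[OF U(1)])

lemma \<Phi>_mem: "z \<in> B \<Longrightarrow> \<Phi> z \<in> fst c" "z \<in> B \<Longrightarrow> snd c (\<Phi> z) = G z" "z \<in> B \<Longrightarrow> \<Phi> z \<in> W"
  using cinv_mem[OF G_mem(2)] G_mem(1) by (simp_all add: \<Phi>_def W_def)

lemma \<Theta>_\<Phi>: "z \<in> B \<Longrightarrow> \<Theta> (snd c (\<Phi> z)) = z"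
  using homeomorphism_apply2[OF hom] by (simp add: \<Phi>_mem)

lemma \<Phi>_\<Theta>: "q \<in> W \<Longrightarrow> \<Theta> (snd c q) \<in> B" "q \<in> W \<Longrightarrow> \<Phi> (\<Theta> (snd c q)) = q"
proof -
  assume q: "q \<in> W"
  then have 1: "snd c q \<in> U" "q \<in> fst c" by (auto simp: W_def)
  then show "\<Theta> (snd c q) \<in> B" using hom by (auto simp: homeomorphism_def)
  show "\<Phi> (\<Theta> (snd c q)) = q"
    using homeomorphism_apply1[OF hom 1(1)] inv_into_f_f[OF ch(3) 1(2)] by (simp add: \<Phi>_def)
qed

lemma topspace_RM: "topspace (topo (restrict_manifold M W)) = W"
  using openin_subset[OF openin_W] by (auto simp: restrict_manifold_def)

lemma homeomorphic_maps: "homeomorphic_maps (topo P) (topo (restrict_manifold M W)) \<Phi> (\<lambda>q. \<Theta> (snd c q))"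
  unfolding homeomorphic_maps_def
proof (intro conjI ballI)
  have "continuous_map (top_of_set B) (top_of_set (cimage c)) G"
    using smooth_on_imp_continuous_on[OF smooth_G] G_mem(2) by auto
  from continuous_map_compose[OF this continuous_map_cinv[OF M c]]
  have "continuous_map (top_of_set B) (topo M) \<Phi>" by (simp add: \<Phi>_def[abs_def] comp_def)
  then show "continuous_map (topo P) (topo (restrict_manifold M W)) \<Phi>"
    using \<Phi>_mem(3) by (auto simp: P restrict_manifold_def continuous_map_in_subtopology)
  show "continuous_map (topo (restrict_manifold M W)) (topo P) (\<lambda>q. \<Theta> (snd c q))"
    unfolding continuous_map_def topspace_RM
  proof (intro conjI allI impI)
    show "(\<lambda>q. \<Theta> (snd c q)) \<in> W \<rightarrow> topspace (topo P)" using \<Phi>_\<Theta>(1) by (auto simp: P)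
    fix V assume "openin (topo P) V"
    then have "open V" using B by (simp add: P openin_open_eq)
    have "open (U \<inter> \<Theta> -` V)"
      by (rule continuous_open_preimage[OF smooth_on_imp_continuous_on[OF smooth_\<Theta>] U(1) \<open>open V\<close>])
    from ch(5)[OF this] have "openin (topo M) {q \<in> W. \<Theta> (snd c q) \<in> V}"
      by (rule back_subst[of "openin (topo M)"]) (auto simp: W_def)
    then show "openin (topo (restrict_manifold M W)) {q \<in> W. \<Theta> (snd c q) \<in> V}"
      by (simp add: restrict_manifold_def openin_open_subtopology[OF openin_W])
  qed
qed (use \<Theta>_\<Phi> \<Phi>_\<Theta> in \<open>simp_all add: P topspace_RM\<close>)

lemma homeomorphic: "homeomorphic_map (topo P) (topo (restrict_manifold M W)) \<Phi>"
  by (rule homeomorphic_maps_imp_map[OF homeomorphic_maps])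

lemma inv_\<Phi>: "q \<in> W \<Longrightarrow> inv_into (topspace (topo P)) \<Phi> q = \<Theta> (snd c q)"
  using \<Phi>_\<Theta>[of q] \<Theta>_\<Phi> by (intro inv_into_f_eq inj_on_inverseI[of _ "\<lambda>q. \<Theta> (snd c q)"]) (auto simp: P)

text \<open>Isometries are tested in every chart d of M, so \<Phi> is read through the transition
  from c to d; its domain is the preimage under G of the transition domain.\<close>

lemma overlap:
  assumes d: "d \<in> charts M"
  shows "open {z \<in> B. \<Phi> z \<in> fst d}" "smooth_on {z \<in> B. \<Phi> z \<in> fst d} (\<lambda>z. (snd d \<circ> cinv c) (G z))"
proof -
  let ?S = "snd c ` (fst c \<inter> fst d)"
  have S: "open ?S" "smooth_on ?S (snd d \<circ> cinv c)" using manifold_atlas[OF M] c d by (auto simp: atlas_def)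
  have eq: "{z \<in> B. \<Phi> z \<in> fst d} = B \<inter> G -` ?S"
  proof (intro set_eqI iffI)
    fix z assume "z \<in> {z \<in> B. \<Phi> z \<in> fst d}"
    then show "z \<in> B \<inter> G -` ?S" using \<Phi>_mem[of z] by (auto intro!: image_eqI[of _ _ "\<Phi> z"])
  next
    fix z assume "z \<in> B \<inter> G -` ?S"
    then obtain q where "z \<in> B" "q \<in> fst c" "q \<in> fst d" "G z = snd c q" by auto
    then show "z \<in> {z \<in> B. \<Phi> z \<in> fst d}" using inv_into_f_f[OF ch(3)] by (simp add: \<Phi>_def)
  qed
  show o: "open {z \<in> B. \<Phi> z \<in> fst d}"
    unfolding eq by (rule continuous_open_preimage[OF smooth_on_imp_continuous_on[OF smooth_G] B S(1)])
  show "smooth_on {z \<in> B. \<Phi> z \<in> fst d} (\<lambda>z. (snd d \<circ> cinv c) (G z))"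
    by (rule smooth_on_compose[OF o S(1) _ S(2) smooth_on_subset[OF smooth_G]]) (auto simp: eq)
qed

lemma diffeomorphism: "diffeomorphism P (restrict_manifold M W) \<Phi>"
  unfolding diffeomorphism_def
proof (intro conjI homeomorphic)
  show "smooth_between P (restrict_manifold M W) \<Phi>"
    unfolding smooth_between_def
  proof (intro conjI ballI homeomorphic_imp_continuous_map[OF homeomorphic])
    fix b d' assume "b \<in> charts P" "d' \<in> charts (restrict_manifold M W)"
    then obtain d where d: "d \<in> charts M" "d' = restrict_chart d W" and b: "b = (B, \<lambda>x. x)"
      by (auto simp: P charts_restrict_manifold)
    have "snd b ` {p \<in> fst b. \<Phi> p \<in> fst d'} = {z \<in> B. \<Phi> z \<in> fst d}" using \<Phi>_mem(3) by (auto simp: b d)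
    moreover have "smooth_on {z \<in> B. \<Phi> z \<in> fst d} (snd d' \<circ> \<Phi> \<circ> cinv b)"
      by (rule smooth_on_cong[OF overlap(1)[OF d(1)] _ overlap(2)[OF d(1)]])
        (use cinv_id[of _ B] in \<open>simp add: b d \<Phi>_def\<close>)
    ultimately show "smooth_on (snd b ` {p \<in> fst b. \<Phi> p \<in> fst d'}) (snd d' \<circ> \<Phi> \<circ> cinv b)" by simp
  qed
  let ?\<Psi> = "inv_into (topspace (topo P)) \<Phi>"
  show "smooth_between (restrict_manifold M W) P ?\<Psi>"
    unfolding smooth_between_def
  proof (intro conjI ballI)
    have "continuous_map (topo (restrict_manifold M W)) (topo P) (\<lambda>q. \<Theta> (snd c q))"
      using homeomorphic_maps by (simp add: homeomorphic_maps_def)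
    then show "continuous_map (topo (restrict_manifold M W)) (topo P) ?\<Psi>"
      by (rule continuous_map_eq) (simp add: topspace_RM inv_\<Phi>)
    fix d' b assume "d' \<in> charts (restrict_manifold M W)" "b \<in> charts P"
    then obtain d where d: "d \<in> charts M" "d' = restrict_chart d W" and b: "b = (B, \<lambda>x. x)"
      by (auto simp: P charts_restrict_manifold)
    note chd = manifold_chart[OF M d(1)]
    let ?S = "snd d ` (fst d \<inter> fst c)" and ?O = "snd d ` (fst d \<inter> W)"
    have S: "smooth_on ?S (snd c \<circ> cinv d)" using manifold_atlas[OF M] c d(1) by (auto simp: atlas_def)
    have o: "open ?O" by (rule chd(4)[OF openin_Int[OF chd(1) openin_W]]) auto
    have sub: "?O \<subseteq> ?S" by (auto simp: W_def)
    have "smooth_on ?O (\<lambda>y. \<Theta> ((snd c \<circ> cinv d) y))"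
      by (rule smooth_on_compose[OF o U(1) _ smooth_\<Theta> smooth_on_subset[OF S sub]])
        (auto simp: W_def inv_into_f_f[OF chd(3)])
    then have "smooth_on ?O (snd b \<circ> ?\<Psi> \<circ> cinv d')"
      by (rule smooth_on_cong[OF o, rotated])
        (auto simp: b d inv_\<Phi> inv_into_f_f[OF chd(3)] inv_into_f_f[OF inj_on_subset[OF chd(3)]])
    moreover have "snd d' ` {p \<in> fst d'. ?\<Psi> p \<in> fst b} = ?O"
      using inv_\<Phi> \<Phi>_\<Theta>(1) by (auto simp: d b)
    ultimately show "smooth_on (snd d' ` {p \<in> fst d'. ?\<Psi> p \<in> fst b}) (snd b \<circ> ?\<Psi> \<circ> cinv d')" by simp
  qed
qed

text \<open>The right-hand side does not involve d: comparing metrics in an arbitrary chart is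
  thereby reduced to the box.\<close>

lemma dmap_compose_\<Phi>:
  assumes f: "smooth_map M f" and d: "d \<in> charts M" and z: "z \<in> B" "\<Phi> z \<in> fst d"
  shows "dmap d f (\<Phi> z) (dmap (B, \<lambda>x. x) (snd d \<circ> \<Phi>) z u) = fd (\<lambda>z. f (cinv c (G z))) z u"
proof -
  let ?O = "{z \<in> B. \<Phi> z \<in> fst d}" and ?A = "\<lambda>z. (snd d \<circ> cinv c) (G z)"
  have zO: "z \<in> ?O" using z by simp
  note A = smooth_on_has_derivative[OF overlap(2)[OF d] zO]
  have eq: "?A z = snd d (\<Phi> z)" for z by (simp add: \<Phi>_def)
  have "dmap (B, \<lambda>x. x) (snd d \<circ> \<Phi>) z = fd ?A z"
    by (rule dmap_eqI[OF overlap(1)[OF d], where F = ?A]) (use zO A cinv_id[of _ B] in \<open>auto simp: \<Phi>_def\<close>)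
  moreover have "((f \<circ> cinv d) has_derivative dmap d f (\<Phi> z)) (at (?A z))"
    unfolding eq using f d z(2) by (intro has_derivative_dmap) (auto simp: smooth_map_def)
  from has_derivative_compose[OF A this]
  have "((\<lambda>z. f (cinv c (G z))) has_derivative (\<lambda>u. dmap d f (\<Phi> z) (fd ?A z u))) (at z)"
    by (rule has_derivative_transform_within_open[OF _ overlap(1)[OF d] zO])
      (simp add: \<Phi>_def inv_into_f_f[OF manifold_chart(3)[OF M d]])
  ultimately show ?thesis using frechet_derivative_eqI by metis
qed

end

theorem locally_given_of_parallel:
  fixes M :: "('p, 'e::euclidean_space \<times> real) manifold" and f :: "'p \<Rightarrow> (real \<times> 'v::euclidean_space) \<times> real"
  assumes eps: "\<epsilon> \<in> {-1, 0, 1}" and M: "is_manifold M" and iso: "isometric_immersion (cylinder \<epsilon>) M h f"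
    and dec: "dt_decomposition \<epsilon> M f T \<eta>" and nonzero: "\<forall>c\<in>charts M. \<forall>p\<in>fst c. T (snd c) p \<noteq> 0"
    and par: "parallel_normal_field (cylinder \<epsilon>) M f \<eta>"
  shows "locally_given \<epsilon> M h f"
  unfolding locally_given_def
proof
  have at: "atlas (charts M)" by (rule manifold_atlas[OF M])
  have smooth_f: "smooth_map M f" and smooth_\<eta>: "smooth_map M \<eta>" and reg: "regular_points M f = topspace (topo M)"
    and f_points: "\<And>q. q \<in> topspace (topo M) \<Longrightarrow> f q \<in> points (cylinder \<epsilon>)"
    and normal: "\<And>q. q \<in> topspace (topo M) \<Longrightarrow> \<eta> q \<in> normal_space (cylinder \<epsilon>) M f q"
    using iso par by (auto simp: isometric_immersion_def immersion_def parallel_normal_field_def normal_field_def)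
  fix p assume p: "p \<in> topspace (topo M)"
  then obtain c where c: "c \<in> charts M" "p \<in> fst c" using M by (auto simp: is_manifold_def)
  note ch = manifold_chart[OF M c(1)]
  define y0 where "y0 = snd c p"
  have "y0 \<in> cimage c" using c(2) by (simp add: y0_def)
  \<comment> \<open>A ball instead of the whole chart image, for the convexity required by
    \<open>parallel_chart\<close>.\<close>
  then obtain e where e: "e > 0" "ball y0 e \<subseteq> cimage c" using ch(2) openE by blast
  let ?U = "ball y0 e" and ?F = "f \<circ> cinv c" and ?H = "\<eta> \<circ> cinv c" and ?T = "\<lambda>y. T (snd c) (cinv c y)"
  have q: "cinv c y \<in> fst c" "snd c (cinv c y) = y" "cinv c y \<in> topspace (topo M)" if "y \<in> ?U" for y
  proof -
    have "y \<in> cimage c" using that e(2) by blast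
    then show "cinv c y \<in> fst c" "snd c (cinv c y) = y" "cinv c y \<in> topspace (topo M)"
      using cinv_mem[of y c] openin_subset[OF ch(1)] by blast+
  qed
  have D: "fd (k \<circ> cinv c) y = dmap c k (cinv c y)" if "y \<in> ?U"
    for y and k :: "'p \<Rightarrow> (real \<times> 'v) \<times> real" using q(2)[OF that] by (simp add: dmap_def fun_eq_iff)
  interpret parallel_chart \<epsilon> ?U ?F ?H ?T y0
  proof
    show "smooth_on ?U ?F" "smooth_on ?U ?H"
      using smooth_f smooth_\<eta> c(1) e(2) by (auto simp: smooth_map_def intro: smooth_on_subset)
    fix y assume y: "y \<in> ?U"
    note q = q[OF y] and D = D[OF y]
    show "?F y \<in> points (cylinder \<epsilon>)" using f_points[OF q(3)] by simp
    then have A: "inner_form_on (form (cylinder \<epsilon>)) (tspace (cylinder \<epsilon>) (f (cinv c y)))"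
      using inner_form_on_cylinder[OF eps] by simp
    show "inj (fd ?F y)"
      using reg regular_points_chart[OF at c(1) q(1) smooth_f] q(3) by (simp add: D)
    note ns = normal_space_chart[OF at c(1) q(1) smooth_f, of "cylinder \<epsilon>"]
    show "?H y \<in> tspace (cylinder \<epsilon>) (?F y)"
      "form (cylinder \<epsilon>) (?H y) (fd ?F y u) = 0" for u
      using normal[OF q(3)] by (simp_all add: ns D del: split_paired_All)
    show "dt = fd ?F y (?T y) + ?H y"
      using dec c(1) q(1) by (simp add: D dt_decomposition_def)
    show "?T y \<noteq> 0" using nonzero c(1) q(1) by simp
    show "form (cylinder \<epsilon>) (fd ?H y u) \<nu> = 0"
      if "\<nu> \<in> tspace (cylinder \<epsilon>) (?F y)" "\<And>w. form (cylinder \<epsilon>) \<nu> (fd ?F y w) = 0" for u \<nu>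
    proof -
      have "normal_connection (cylinder \<epsilon>) M c f \<eta> (cinv c y) u = 0"
        using par c(1) q(1) by (simp add: parallel_normal_field_def del: split_paired_All)
      then show ?thesis
        using that unfolding normal_connection_eq_0_iff[where f = f and M = M, OF A] by (simp add: ns D del: split_paired_All)
    qed
  qed (use eps e in auto)
  obtain x0 :: 'e and r U' \<Theta> G where S: "r > 0" "open U'" "U' \<subseteq> ?U" "y0 \<in> U'"
    "homeomorphism U' (ball x0 r \<times> {-r<..<r}) \<Theta> G" "smooth_on U' \<Theta>" "smooth_on (ball x0 r \<times> {-r<..<r}) G"
    "\<Theta> y0 = (x0, 0)" "\<And>z. z \<in> ball x0 r \<times> {-r<..<r} \<Longrightarrow> fd G z (0, 1) = ?T (G z)"
    "\<And>z. z \<in> ball x0 r \<times> {-r<..<r} \<Longrightarrow> inj (fd G z)"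
    "\<And>z. z \<in> ball x0 r \<times> {-r<..<r} \<Longrightarrow> \<sigma> (G z) = snd z"
    by (rule straightening) (rule that)
  interpret S: straightened_chart \<epsilon> ?U ?F ?H ?T y0 x0 r G
  proof
    show "G z \<in> ?U" if "z \<in> ball x0 r \<times> {-r<..<r}" for z
      using homeomorphism_image2[OF S(5)] S(3) that by blast
  qed (fact S)+
  interpret L: local_parametrization M c "S.X \<times> S.I" U' G \<Theta> "times_interval S.N S.I"
    by unfold_locales
      (use M c(1) S.open_box S(2,3,5-7) e(2) S.topo_box S.charts_box in auto)
  have "isometry (times_interval S.N S.I) (induced_metric (cylinder \<epsilon>) S.C) (restrict_manifold M L.W) h L.\<Phi>"
    unfolding isometry_def
  proof (intro conjI L.diffeomorphism ballI impI allI)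
    fix b d' z u v
    assume "b \<in> charts (times_interval S.N S.I)" "d' \<in> charts (restrict_manifold M L.W)" "z \<in> fst b" "L.\<Phi> z \<in> fst d'"
    then obtain d where d: "d \<in> charts M" "d' = restrict_chart d L.W" "L.\<Phi> z \<in> fst d"
      and b: "b = (S.X \<times> S.I, \<lambda>z. z)" "z \<in> S.X \<times> S.I"
      unfolding charts_restrict_manifold S.charts_box by auto
    \<comment> \<open>In the box, f and the construction differ by a constant, so they have the same
      differential and induce the same metric.\<close>
    have "fd (\<lambda>z. f (cinv c (G z))) z = fd S.C z"
      using frechet_derivative_eqI[OF has_derivative_compose[OF S.DG[OF b(2)] DF[OF S.G_U[OF b(2)]]]]
      unfolding S.DC[OF b(2)] by (simp add: comp_def)
    then have "dmap d f (L.\<Phi> z) (dmap b (snd d \<circ> L.\<Phi>) z w) = fd S.C z w" for w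
      using L.dmap_compose_\<Phi>[OF smooth_f d(1) b(2) d(3), of w] by (simp add: b(1))
    moreover have "h (snd d) (L.\<Phi> z) u' v' = form (cylinder \<epsilon>) (dmap d f (L.\<Phi> z) u') (dmap d f (L.\<Phi> z) v')" for u' v'
      using iso d(1,3) by (simp add: isometric_immersion_def del: split_paired_All)
    ultimately show "h (snd d') (L.\<Phi> z) (dmap b (snd d' \<circ> L.\<Phi>) z u) (dmap b (snd d' \<circ> L.\<Phi>) z v) =
      induced_metric (cylinder \<epsilon>) S.C (snd b) z u v"
      by (simp add: d(2) induced_metric_def)
  qed
  \<comment> \<open>The model curve has height 0 at s = 0, so the translation is the height of f at
    p.\<close>
  moreover have "f (L.\<Phi> z) = S.C z + snd (?F y0) *\<^sub>R dt" if "z \<in> topspace (topo (times_interval S.N S.I))" for z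
    using S.construction_G[of z] that unfolding S.topo_box by (simp add: L.\<Phi>_def)
  moreover have "p \<in> L.W" using c(2) S(4) by (simp add: L.W_def y0_def)
  ultimately show "\<exists>W (N :: ('e, 'e) manifold) hN I k g \<xi> \<alpha> hP \<Phi> \<tau>.
          openin (topo M) W \<and> p \<in> W \<and>
          construction_data \<epsilon> N hN I k g \<xi> \<alpha> \<and> geodesic_on (coord_cylinder \<epsilon> k) I \<alpha> \<and>
          riemannian_metric (times_interval N I) hP \<and>
          isometric_immersion (cylinder \<epsilon>) (times_interval N I) hP (construction \<epsilon> k g \<xi> \<alpha>) \<and>
          isometry (times_interval N I) hP (restrict_manifold M W) h \<Phi> \<and>
          (\<forall>q\<in>topspace (topo (times_interval N I)). f (\<Phi> q) = construction \<epsilon> k g \<xi> \<alpha> q + \<tau> *\<^sub>R dt)"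
    using L.openin_W S.construction_data S.geodesic_\<alpha> S.box_isometric
    by (intro exI[of _ L.W] exI[of _ S.N] exI conjI ballI)
qed

theorem corollary4:
  fixes \<epsilon> :: real
    and N :: "('q, 'd::real_normed_vector) manifold"
    and hN :: "('q, 'd) metric"
    and I :: "real set" and k :: nat
    and g :: "'q \<Rightarrow> real \<times> 'v::euclidean_space"
    and \<xi> :: "nat \<Rightarrow> 'q \<Rightarrow> real \<times> 'v"
    and \<alpha> :: "real \<Rightarrow> nat \<Rightarrow> real"
    and M :: "('p, 'e::euclidean_space \<times> real) manifold"
    and h :: "('p, 'e \<times> real) metric"
    and f :: "'p \<Rightarrow> (real \<times> 'v) \<times> real"
    and T :: "('p, 'e \<times> real) vfield"
    and \<eta> :: "'p \<Rightarrow> (real \<times> 'v) \<times> real"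
  assumes "\<epsilon> \<in> {-1, 0, 1}"
  shows "(construction_data \<epsilon> N hN I k g \<xi> \<alpha> \<and> geodesic_on (coord_cylinder \<epsilon> k) I \<alpha> \<longrightarrow>
           (let F = construction \<epsilon> k g \<xi> \<alpha>;
                P = times_interval N I;
                R = regular_points P F;
                PR = restrict_manifold P R
            in openin (topo P) R \<and> immersion (cylinder \<epsilon>) PR F \<and>
               (\<exists>T' \<eta>'. dt_decomposition \<epsilon> PR F T' \<eta>' \<and>
                        parallel_normal_field (cylinder \<epsilon>) PR F \<eta>'))) \<and>
         (is_manifold M \<and> riemannian_metric M h \<and> isometric_immersion (cylinder \<epsilon>) M h f \<and>
          dt_decomposition \<epsilon> M f T \<eta> \<and>
          (\<forall>c\<in>charts M. \<forall>p\<in>fst c. T (snd c) p \<noteq> 0) \<and>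
          parallel_normal_field (cylinder \<epsilon>) M f \<eta> \<longrightarrow>
            locally_given \<epsilon> M h f)"
proof (intro conjI impI)
  assume "construction_data \<epsilon> N hN I k g \<xi> \<alpha> \<and> geodesic_on (coord_cylinder \<epsilon> k) I \<alpha>"
  then interpret immersion_construction \<epsilon> N hN I k g \<xi> \<alpha> by unfold_locales (use assms in auto)
  show "let F = construction \<epsilon> k g \<xi> \<alpha>;
                P = times_interval N I;
                R = regular_points P F;
                PR = restrict_manifold P R
            in openin (topo P) R \<and> immersion (cylinder \<epsilon>) PR F \<and>
               (\<exists>T' \<eta>'. dt_decomposition \<epsilon> PR F T' \<eta>' \<and>
                        parallel_normal_field (cylinder \<epsilon>) PR F \<eta>')"
    unfolding Let_def construction_comb_curve by (intro conjI openin_R immersion_PR regular_part)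
qed (use locally_given_of_parallel[OF assms] in blast)

end
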